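(* Let $d\ge 3$, let $\mathsf{P}^d_\infty$ be the weak limit for the local topology, as $n\to\infty$, of the uniform probability distributions on the sets $\mathcal{T}^d_n$, and let $\mathcal{S}^d=\mathrm{Supp}(\mathsf{P}^d_\infty)$. Then the extended closure operation $\Phi$ defines a continuous mapping from $\mathcal{S}^d$ to $\overline{\mathcal{M}}^d$, with respect to the local topology.
   Context: Blossoming trees. A blossoming tree is a plane tree, endowed with one of its two proper 2-colorings of vertices in black and white, in which each corner may carry some dangling half-edges; a half-edge attached to a black vertex is called an opening stem, one attached to a white vertex a closing stem. The degree of a vertex counts both its incident tree edges and its incident stems; the tree is $d$-regular if all vertices have degree $d$. A rooted tree has a distinguished root corner (stems being taken into account in the definition of corners); it is black-rooted if the root vertex is black. The charge of a finite blossoming tree is its number of closing stems minus its number of opening stems; in a rooted finite tree the charge of a vertex $v$ is the charge of the subtree consisting of $v$ and its descendants. A finite rooted blossoming tree is well-charged if every black vertex has charge at most $1$ and every white vertex has charge at least $0$. $\mathcal{T}^d_n$ is the set of finite black-rooted well-charged $d$-regular blossoming trees of charge $0$ with $n$ black vertices, and $\mathcal{T}^d=\bigsqcup_{n\ge1}\mathcal{T}^d_n$. Maps. A planar map is a proper embedding of a finite connected planar graph (loops and multiple edges allowed) in the 2-sphere, up to orientation-preserving homeomorphism, rooted at a distinguished corner. $\mathcal{M}^d$ is the set of finite planar maps, with a proper black/white coloring of the vertices, all vertices of degree $d$, and black root vertex. Local topologies. For $\mathrm{m}\in\mathcal{M}^d$, $B_R(\mathrm{m})$ is the rooted submap consisting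 of all vertices at distance at most $R$ from the root vertex and all edges with at least one extremity at distance at most $R-1$; for $\mathrm{t}\in\mathcal{T}^d$, $B_R(\mathrm{t})$ is defined likewise, keeping the stems attached to vertices at distance at most $R-1$. In both cases $\mathrm{d}_{\mathrm{loc}}(x,x')=\bigl(1+\sup\{R\ge0:B_R(x)=B_R(x')\}\bigr)^{-1}$, and $\overline{\mathcal{M}}^d$, $\overline{\mathcal{T}}^d$ are the completions of $\mathcal{M}^d$, $\mathcal{T}^d$. Elements of $\overline{\mathcal{T}}^d\setminus\mathcal{T}^d$ are infinite $d$-regular blossoming trees. A spine is an infinite self-avoiding path starting at the root vertex. An infinite tree with a single spine admits a unique function $\mathrm{c}$ from its vertices to $\mathbb{Z}$ that vanishes at the root vertex and is such that $\mathrm{c}(v)$ equals the number of closing stems at $v$ minus the number of opening stems at $v$ plus the sum of $\mathrm{c}$ over the children of $v$; the tree is well-charged if $\mathrm{c}\le1$ on black vertices and $\mathrm{c}\ge0$ on white vertices. The limit law. The uniform distributions on $\mathcal{T}^d_n$ converge weakly on $\overline{\mathcal{T}}^d$ to a probability measure $\mathsf{P}^d_\infty$ supported on the set of infinite $d$-regular well-charged blossoming trees with a single spine; elements of $\mathcal{S}^d$ are regarded as such trees. A tree with a single spine has a unique embedding in the plane (up to homeomorphism) with unique accumulation point at $\infty$. Contour walk. Let $T\in\mathcal{S}^d$, drawn with the root at the bottom and children above. Starting from the root corner, walk around the tree to the right (counterclockwise contour, exploring the right side of the spine), and let $\omega_{l-1}$ be the kind (closing or opening) of the $l$-th stem encountered,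 $l\ge1$; walking similarly to the left from the root corner, let $\omega_{-l}$ be the kind of the $l$-th stem encountered. This gives a bi-infinite word, and the integer $k$ is the index of the stem recorded by $\omega_k$. The contour walk of stems $\mathcal{C}_T:\mathbb{Z}\to\mathbb{Z}$ is given by $\mathcal{C}_T(0)=0$ and $\mathcal{C}_T(k+1)-\mathcal{C}_T(k)=-1$ if $\omega_k$ is closing, $+1$ if $\omega_k$ is opening. Closure. For $T\in\mathcal{S}^d$, the matching of stems is defined by $\sigma_T(k)=\sup\{j<k:\omega_j\text{ closing},\ \mathcal{C}_T(j)=\mathcal{C}_T(k)+1\}$ if $\omega_k$ is opening, and $\sigma_T(k)=\inf\{j>k:\omega_j\text{ opening},\ \mathcal{C}_T(j)=\mathcal{C}_T(k)-1\}$ if $\omega_k$ is closing; this is a perfect matching between the closing and opening stems of $T$. The closure $\Phi(T)$ is the infinite map obtained from $T$ by merging, for every $k$, the stems of indices $k$ and $\sigma_T(k)$ into a single edge, the edges being drawn without crossings, so that each new edge, oriented from its opening stem to its closing stem, has the infinite face on its left at the time it is drawn. In particular the vertices (with colors) and the cyclic order of half-edges around each vertex are those of $T$. $\Phi(T)$ is rooted at the root corner of $T$ and has no marked face.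
   Formalization: S^d is taken as the trees in the topological support of P that are d-regular, well-charged, have a single spine, a bi-infinite contour word and a well-defined stem matching; the full closed support also contains trees on which the closure is undefined. *)

theory Defs
  imports "HOL-Probability.Probability" "HOL-Combinatorics.Orbits" "HOL-Library.Sublist"
begin

section \<open>Local distances\<close>

text \<open>The distance attached to a family of balls \<open>B R x\<close>. The first case is the one where the
  supremum of the radii is infinite.\<close>

definition dloc :: "(nat \<Rightarrow> 'a \<Rightarrow> 'b) \<Rightarrow> 'a \<Rightarrow> 'a \<Rightarrow> real" where
  "dloc B x y = (if \<forall>R. B R x = B R y then 0
                 else inverse (1 + real (Sup {R. B R x = B R y})))"

lemma dloc_eq_0_iff: "dloc B x y = 0 \<longleftrightarrow> (\<forall>R. B R x = B R y)"
  by (simp add: dloc_def)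

lemma dloc_le_iff:
  fixes B :: "nat \<Rightarrow> 'a \<Rightarrow> 'b"
  assumes dc: "\<And>R x y. B (Suc R) x = B (Suc R) y \<Longrightarrow> B R x = B R y"
  shows "dloc B x y \<le> inverse (2 + real R) \<longleftrightarrow> B (Suc R) x = B (Suc R) y"
proof (cases "\<forall>R. B R x = B R y")
  case True
  then show ?thesis by (simp add: dloc_def)
next
  case False
  let ?A = "{R. B R x = B R y}"
  obtain S where S: "B S x \<noteq> B S y" using False by blast
  have down: "B m x = B m y" if "B n x = B n y" "m \<le> n" for m n
    using that(2,1)
  proof (induction m rule: inc_induct)
    case (step m)
    then show ?case by (metis dc)
  qed
  have "?A \<subseteq> {..<S}"
  proof
    fix m assume "m \<in> ?A"
    then show "m \<in> {..<S}" using down[of m S] S by (cases "m < S") auto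
  qed
  then have fin: "finite ?A" by (rule finite_subset) simp
  have "Suc R \<le> Sup ?A \<longleftrightarrow> Suc R \<in> ?A"
  proof
    assume le: "Suc R \<le> Sup ?A"
    then have ne: "?A \<noteq> {}" by (auto simp: Sup_nat_def split: if_splits)
    then have "Sup ?A \<in> ?A" using fin by (metis Max_in Sup_nat_def)
    then have "B (Sup ?A) x = B (Sup ?A) y" by blast
    then have "B (Suc R) x = B (Suc R) y" using le by (rule down)
    then show "Suc R \<in> ?A" by simp
  next
    assume a: "Suc R \<in> ?A"
    then show "Suc R \<le> Sup ?A" using fin by (meson bdd_above_finite cSup_upper)
  qed
  moreover have "dloc B x y \<le> inverse (2 + real R) \<longleftrightarrow> Suc R \<le> Sup ?A"
  proof -
    have "dloc B x y = inverse (1 + real (Sup ?A))" using False unfolding dloc_def by (rule if_not_P)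
    moreover have "inverse (1 + real (Sup ?A)) \<le> inverse (2 + real R) \<longleftrightarrow> 2 + real R \<le> 1 + real (Sup ?A)"
      by (rule inverse_le_iff_le) auto
    ultimately show ?thesis by linarith
  qed
  ultimately show ?thesis by simp
qed

lemma dloc_values: "dloc B x y = 0 \<or> (\<exists>n::nat. dloc B x y = inverse (1 + real n))"
  by (auto simp: dloc_def)

lemma dloc_ultra:
  fixes B :: "nat \<Rightarrow> 'a \<Rightarrow> 'b"
  assumes dc: "\<And>R x y. B (Suc R) x = B (Suc R) y \<Longrightarrow> B R x = B R y"
  shows "dloc B x y \<le> max (dloc B x z) (dloc B y z)"
proof -
  have iff: "dloc B u v \<le> inverse (2 + real R) \<longleftrightarrow> B (Suc R) u = B (Suc R) v" for u v R
    by (rule dloc_le_iff) (rule dc)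
  let ?M = "max (dloc B x z) (dloc B y z)"
  consider "?M = 0" | n :: nat where "?M = inverse (1 + real n)"
    using dloc_values[of B x z] dloc_values[of B y z] unfolding max_def by presburger
  then show ?thesis
  proof cases
    case 1
    have "dloc B x z \<ge> 0" "dloc B y z \<ge> 0" by (auto simp: dloc_def)
    then have "dloc B x z = 0" "dloc B y z = 0" using 1 by auto
    then have "\<forall>R. B R x = B R z" "\<forall>R. B R y = B R z"
      unfolding dloc_eq_0_iff by auto
    then show ?thesis by (simp add: dloc_def)
  next
    case (2 n)
    show ?thesis
    proof (cases n)
      case 0
      have "dloc B x y \<le> 1" by (auto simp: dloc_def inverse_eq_divide)
      then show ?thesis using 2 0 by simp
    next
      case (Suc R)
      then have M: "?M = inverse (2 + real R)" using 2 by simp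
      then have "dloc B x z \<le> inverse (2 + real R)" "dloc B y z \<le> inverse (2 + real R)" by auto
      then have "B (Suc R) x = B (Suc R) y" by (simp add: iff)
      then have "dloc B x y \<le> inverse (2 + real R)" by (simp add: iff)
      then show ?thesis using M by simp
    qed
  qed
qed

lemma dloc_triangle:
  fixes B :: "nat \<Rightarrow> 'a \<Rightarrow> 'b"
  assumes "\<And>R x y. B (Suc R) x = B (Suc R) y \<Longrightarrow> B R x = B R y"
  shows "dloc B x y \<le> dloc B x z + dloc B y z"
proof -
  have "dloc B x z \<ge> 0" "dloc B y z \<ge> 0" by (auto simp: dloc_def)
  with dloc_ultra[of B x y z, OF assms] show ?thesis by linarith
qed


section \<open>Blossoming trees\<close>

text \<open>A rooted plane tree with stems, finite or infinite, all degrees being finite. The half-edges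
  at a vertex that do not lead to its parent are listed in counterclockwise order, starting from the
  root corner at the root vertex and from the edge to the parent at any other vertex: \<open>None\<close> is a
  stem, \<open>Some s\<close> an edge to a child with subtree of descendants \<open>s\<close>. Two trees are
  equal iff they agree up to isomorphism of rooted plane trees.

  Only black-rooted trees are considered, so the proper coloring is given by the parity of the depth
  and is not recorded.\<close>

codatatype btree = Node (slots: "btree option list")

primrec tree_ball :: "nat \<Rightarrow> btree \<Rightarrow> btree" where
  "tree_ball 0 t = Node []"
| "tree_ball (Suc R) t = Node (map (map_option (tree_ball R)) (slots t))"

lemma tree_ball_Suc_eqD: "tree_ball (Suc R) x = tree_ball (Suc R) y \<Longrightarrow> tree_ball R x = tree_ball R y"
proof (induction R arbitrary: x y)
  case 0
  then show ?case by simp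
next
  case (Suc R)
  from Suc.prems have eq: "map (map_option (tree_ball (Suc R))) (slots x) =
      map (map_option (tree_ball (Suc R))) (slots y)"
    unfolding tree_ball.simps(2)[of "Suc R"] btree.inject .
  have "list_all2 (\<lambda>a b. map_option (tree_ball R) a = map_option (tree_ball R) b) (slots x) (slots y)"
  proof (rule list_all2_all_nthI)
    show len: "length (slots x) = length (slots y)" using eq by (rule map_eq_imp_length_eq)
    fix i assume i: "i < length (slots x)"
    then have "map_option (tree_ball (Suc R)) (slots x ! i) = map_option (tree_ball (Suc R)) (slots y ! i)"
      using arg_cong[OF eq, of "\<lambda>l. l ! i"] len by simp
    then show "map_option (tree_ball R) (slots x ! i) = map_option (tree_ball R) (slots y ! i)"
      by (cases "slots x ! i"; cases "slots y ! i")
        (simp_all del: tree_ball.simps, erule Suc.IH)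
  qed
  then have "map (map_option (tree_ball R)) (slots x) = map (map_option (tree_ball R)) (slots y)"
    by (simp add: list_all2_conv_all_nth list_eq_iff_nth_eq)
  then show ?case by simp
qed

lemma tree_ball_separates:
  assumes "\<forall>R. tree_ball R x = tree_ball R y"
  shows "x = y"
  using assms
proof (coinduction arbitrary: x y rule: btree.coinduct)
  case Eq_btree
  have eq: "map (map_option (tree_ball R)) (slots x) = map (map_option (tree_ball R)) (slots y)" for R
    using Eq_btree[rule_format, of "Suc R"] by simp
  show ?case
  proof (rule list_all2_all_nthI)
    show len: "length (slots x) = length (slots y)" using eq by (rule map_eq_imp_length_eq)
    fix i assume i: "i < length (slots x)"
    then have "map_option (tree_ball R) (slots x ! i) = map_option (tree_ball R) (slots y ! i)" for R
      using arg_cong[OF eq, of "\<lambda>l. l ! i"] len by simp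
    then show "rel_option (\<lambda>x y. \<exists>xa ya. x = xa \<and> y = ya \<and> (\<forall>R. tree_ball R xa = tree_ball R ya))
        (slots x ! i) (slots y ! i)"
      by (cases "slots x ! i"; cases "slots y ! i") auto
  qed
qed

instantiation btree :: metric_space
begin

definition dist_btree :: "btree \<Rightarrow> btree \<Rightarrow> real" where
  "dist_btree = dloc tree_ball"

definition uniformity_btree :: "(btree \<times> btree) filter" where
  "uniformity_btree = (INF e\<in>{0 <..}. principal {(x, y). dist x y < e})"

definition open_btree :: "btree set \<Rightarrow> bool" where
  "open_btree U \<longleftrightarrow> (\<forall>x\<in>U. eventually (\<lambda>(x', y). x' = x \<longrightarrow> y \<in> U) uniformity)"

instance
proof
  show "dist x y = 0 \<longleftrightarrow> x = y" for x y :: btree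
    by (auto simp: dist_btree_def dloc_eq_0_iff tree_ball_separates)
  show "dist x y \<le> dist x z + dist y z" for x y z :: btree
    unfolding dist_btree_def by (rule dloc_triangle) (rule tree_ball_Suc_eqD)
qed (simp_all add: uniformity_btree_def open_btree_def)

end

primcorec glue_balls :: "(nat \<Rightarrow> btree) \<Rightarrow> btree" where
  "slots (glue_balls b) = map (map_option glue_balls)
     (map (\<lambda>i. if slots (b 1) ! i = None then None else Some (\<lambda>R. the (slots (b (Suc R)) ! i)))
        [0..<length (slots (b 1))])"

lemma tree_ball_glue_balls:
  assumes "\<And>R. tree_ball R (b (Suc R)) = b R"
  shows "tree_ball R (glue_balls b) = b R"
  using assms
proof (induction R arbitrary: b)
  case 0
  then have "b 0 = Node []" by (metis tree_ball.simps(1))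
  then show ?case by simp
next
  case (Suc R)
  have sl: "slots (b (Suc R)) = map (map_option (tree_ball R)) (slots (b (Suc (Suc R))))" for R
    using Suc.prems[of "Suc R"] by (metis btree.sel tree_ball.simps(2))
  have len: "length (slots (b (Suc R))) = length (slots (b 1))" for R
  proof (induction R)
    case (Suc R)
    have "length (slots (b (Suc R))) = length (slots (b (Suc (Suc R))))"
      by (subst sl) (rule length_map)
    with Suc show ?case by (metis (no_types))
  qed simp
  have nth: "slots (b (Suc R)) ! i = map_option (tree_ball R) (slots (b (Suc (Suc R))) ! i)"
    if "i < length (slots (b 1))" for R i
    by (subst sl) (rule nth_map, use len[of "Suc R"] that in simp)
  have none: "slots (b (Suc R)) ! i = None \<longleftrightarrow> slots (b 1) ! i = None"
    if "i < length (slots (b 1))" for R i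
  proof (induction R)
    case (Suc R)
    then show ?case by (subst (asm) nth[OF that]) simp
  qed simp
  have "map (map_option (tree_ball R)) (slots (glue_balls b)) = slots (b (Suc R))"
  proof (rule nth_equalityI)
    show "length (map (map_option (tree_ball R)) (slots (glue_balls b))) = length (slots (b (Suc R)))"
      by (simp add: len[of R])
    fix i assume "i < length (map (map_option (tree_ball R)) (slots (glue_balls b)))"
    then have i: "i < length (slots (b 1))" by simp
    show "map (map_option (tree_ball R)) (slots (glue_balls b)) ! i = slots (b (Suc R)) ! i"
    proof (cases "slots (b 1) ! i = None")
      case True
      then show ?thesis using i none[OF i, of R] by simp
    next
      case False
      have "tree_ball Q (the (slots (b (Suc (Suc Q))) ! i)) = the (slots (b (Suc Q)) ! i)" for Q
        using nth[OF i, of Q] none[OF i, of "Suc Q"] False by (simp add: option.map_sel)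
      then have "tree_ball R (glue_balls (\<lambda>R. the (slots (b (Suc R)) ! i))) = the (slots (b (Suc R)) ! i)"
        by (rule Suc.IH)
      then show ?thesis using i False none[OF i, of R] by auto
    qed
  qed
  then show ?case by simp
qed

lemma tree_ball_tree_ball: "tree_ball R (tree_ball (Suc R) t) = tree_ball R t"
proof (induction R arbitrary: t)
  case (Suc R)
  have "tree_ball R \<circ> tree_ball (Suc R) = tree_ball R"
    using Suc.IH by (simp add: fun_eq_iff del: tree_ball.simps)
  moreover have "map_option f \<circ> map_option g = map_option (f \<circ> g)"
    for f g :: "btree \<Rightarrow> btree" by (simp add: fun_eq_iff option.map_comp)
  ultimately have "map_option (tree_ball R) \<circ> map_option (tree_ball (Suc R)) = map_option (tree_ball R)"
    by (simp only:)
  moreover have "tree_ball (Suc R) (tree_ball (Suc (Suc R)) t) =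
      Node (map (map_option (tree_ball R) \<circ> map_option (tree_ball (Suc R))) (slots t))"
    by (subst (2) tree_ball.simps(2), subst tree_ball.simps(2)) (simp del: tree_ball.simps)
  ultimately show ?case by (simp del: tree_ball.simps add: tree_ball.simps(2)[of R t])
qed simp

text \<open>By completeness, the completion of a set of trees is its closure.\<close>

instance btree :: complete_space
proof
  fix X :: "nat \<Rightarrow> btree" assume C: "Cauchy X"
  have le: "dist x y \<le> inverse (2 + real R) \<longleftrightarrow> tree_ball (Suc R) x = tree_ball (Suc R) y"
    for R and x y :: btree
    unfolding dist_btree_def by (rule dloc_le_iff) (rule tree_ball_Suc_eqD)
  have "\<exists>N. \<forall>n\<ge>N. tree_ball (Suc R) (X n) = tree_ball (Suc R) (X N)" for R
  proof -
    have "0 < inverse (2 + real R)" by simp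
    then obtain N where "\<forall>m\<ge>N. \<forall>n\<ge>N. dist (X m) (X n) < inverse (2 + real R)"
      using C unfolding Cauchy_def by blast
    then show ?thesis using le by (meson less_imp_le order_refl)
  qed
  then obtain N where N: "\<And>R n. n \<ge> N R \<Longrightarrow> tree_ball (Suc R) (X n) = tree_ball (Suc R) (X (N R))"
    by metis
  define b where "b R = tree_ball R (X (N R))" for R
  have b: "tree_ball R (X n) = b R" if "n \<ge> N R" for R n
    unfolding b_def by (rule tree_ball_Suc_eqD) (rule N[OF that])
  have "tree_ball R (b (Suc R)) = b R" for R
    using b[of R "max (N R) (N (Suc R))"] b[of "Suc R" "max (N R) (N (Suc R))"]
      tree_ball_tree_ball[of R "X (max (N R) (N (Suc R)))"] by simp
  then have g: "tree_ball R (glue_balls b) = b R" for R by (rule tree_ball_glue_balls)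
  have "X \<longlonglongrightarrow> glue_balls b"
  proof (rule metric_LIMSEQ_I)
    fix e :: real assume "0 < e"
    then obtain R where R: "inverse (real (Suc R)) < e" using reals_Archimedean by blast
    have "dist (X n) (glue_balls b) < e" if "n \<ge> N (Suc R)" for n
    proof -
      have "dist (X n) (glue_balls b) \<le> inverse (2 + real R)"
        unfolding le using b[OF that] g by simp
      also have "\<dots> \<le> inverse (real (Suc R))" by (simp add: inverse_eq_divide frac_le)
      finally show ?thesis using R by simp
    qed
    then show "\<exists>no. \<forall>n\<ge>no. dist (X n) (glue_balls b) < e" by blast
  qed
  then show "convergent X" by (rule convergentI)
qed


section \<open>Maps\<close>

text \<open>Rooted maps on oriented surfaces, finite or infinite with all degrees finite, as rotation
  systems: \<open>rot\<close> sends a half-edge to the next one in counterclockwise order around its vertex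
  \<open>org\<close>, and \<open>opp\<close> to the other half of the same edge. The root corner is the one just before
  \<open>root_half\<close> in counterclockwise order; \<open>None\<close> is only used for the map with a single vertex
  and no edge.\<close>

record ('v, 'h) cmap =
  verts :: "'v set"
  halves :: "'h set"
  org :: "'h \<Rightarrow> 'v"
  rot :: "'h \<Rightarrow> 'h"
  opp :: "'h \<Rightarrow> 'h"
  is_black :: "'v \<Rightarrow> bool"
  root_vertex :: "'v"
  root_half :: "'h option"

definition halves_at :: "('v, 'h) cmap \<Rightarrow> 'v \<Rightarrow> 'h set" where
  "halves_at m v = {h \<in> halves m. org m h = v}"

definition adj :: "('v, 'h) cmap \<Rightarrow> ('v \<times> 'v) set" where
  "adj m = {(org m h, org m (opp m h)) | h. h \<in> halves m}"

text \<open>Note that \<^const>\<open>cyclic_on\<close> forces the set to be finite.\<close>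

definition rooted_map :: "('v, 'h) cmap \<Rightarrow> bool" where
  "rooted_map m \<longleftrightarrow>
     root_vertex m \<in> verts m \<and>
     (\<forall>h\<in>halves m. org m h \<in> verts m \<and> opp m h \<in> halves m \<and> opp m h \<noteq> h \<and> opp m (opp m h) = h) \<and>
     (\<forall>v\<in>verts m. halves_at m v = {} \<or> cyclic_on (rot m) (halves_at m v)) \<and>
     (\<forall>v\<in>verts m. (root_vertex m, v) \<in> (adj m)\<^sup>*) \<and>
     (case root_half m of None \<Rightarrow> halves_at m (root_vertex m) = {}
                        | Some h \<Rightarrow> h \<in> halves_at m (root_vertex m))"

definition root_dist :: "('v, 'h) cmap \<Rightarrow> 'v \<Rightarrow> nat" where
  "root_dist m v = (LEAST n. (root_vertex m, v) \<in> adj m ^^ n)"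

definition first_return :: "('a \<Rightarrow> 'a) \<Rightarrow> 'a set \<Rightarrow> 'a \<Rightarrow> 'a" where
  "first_return f A x = (f ^^ (LEAST k. 0 < k \<and> (f ^^ k) x \<in> A)) x"

definition ball_halves :: "nat \<Rightarrow> ('v, 'h) cmap \<Rightarrow> 'h set" where
  "ball_halves R m =
     {h \<in> halves m. root_dist m (org m h) < R \<or> root_dist m (org m (opp m h)) < R}"

text \<open>All edges at the root vertex belong to the ball if \<open>R > 0\<close>, so that its root corner is that of
  the map.\<close>

definition cmap_ball :: "nat \<Rightarrow> ('v, 'h) cmap \<Rightarrow> ('v, 'h) cmap" where
  "cmap_ball R m = m\<lparr>
     verts := {v \<in> verts m. root_dist m v \<le> R},
     halves := ball_halves R m,
     rot := first_return (rot m) (ball_halves R m),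
     root_half := (if R = 0 then None else root_half m)\<rparr>"

definition iso_by :: "('v \<Rightarrow> 'w) \<Rightarrow> ('h \<Rightarrow> 'k) \<Rightarrow> ('v, 'h) cmap \<Rightarrow> ('w, 'k) cmap \<Rightarrow> bool" where
  "iso_by f g m m' \<longleftrightarrow>
     bij_betw f (verts m) (verts m') \<and> bij_betw g (halves m) (halves m') \<and>
     (\<forall>h\<in>halves m. org m' (g h) = f (org m h) \<and> rot m' (g h) = g (rot m h) \<and> opp m' (g h) = g (opp m h)) \<and>
     (\<forall>v\<in>verts m. is_black m' (f v) \<longleftrightarrow> is_black m v) \<and>
     f (root_vertex m) = root_vertex m' \<and> map_option g (root_half m) = root_half m'"

definition map_iso :: "('v, 'h) cmap \<Rightarrow> ('w, 'k) cmap \<Rightarrow> bool" where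
  "map_iso m m' \<longleftrightarrow> rooted_map m \<and> rooted_map m' \<and> (\<exists>f g. iso_by f g m m')"


subsection \<open>Balls of maps\<close>

lemma first_return_step:
  assumes "0 < k" "(f ^^ k) x \<in> A"
  shows "first_return f A x = (if f x \<in> A then f x else first_return f A (f x))"
proof (cases "f x \<in> A")
  case True
  have "(LEAST k. 0 < k \<and> (f ^^ k) x \<in> A) = 1"
    by (rule Least_equality) (use True in auto)
  then show ?thesis using True by (simp add: first_return_def)
next
  case False
  define k0 where "k0 = (LEAST k. 0 < k \<and> (f ^^ k) x \<in> A)"
  have k0: "0 < k0" "(f ^^ k0) x \<in> A"
    using LeastI[of "\<lambda>k. 0 < k \<and> (f ^^ k) x \<in> A" k] assms unfolding k0_def by blast+
  have min: "k0 \<le> j" if "0 < j" "(f ^^ j) x \<in> A" for j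
    unfolding k0_def by (rule Least_le) (use that in blast)
  have "k0 \<noteq> 1" using k0 False by (metis One_nat_def funpow_0 funpow_simps_right(2) o_apply)
  then obtain j where j: "k0 = Suc j" "0 < j" using k0 by (cases k0) auto
  have "(LEAST k. 0 < k \<and> (f ^^ k) (f x) \<in> A) = j"
  proof (rule Least_equality)
    show "0 < j \<and> (f ^^ j) (f x) \<in> A" using k0 j by (simp add: funpow_swap1)
    fix i assume "0 < i \<and> (f ^^ i) (f x) \<in> A"
    then have "(f ^^ Suc i) x \<in> A" by (simp add: funpow_swap1)
    then show "j \<le> i" using min[of "Suc i"] j by simp
  qed
  then have "first_return f A (f x) = (f ^^ k0) x"
    using j by (simp add: first_return_def funpow_swap1)
  then show ?thesis using False by (simp add: first_return_def k0_def)
qed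

lemma cyclic_on_first_return:
  assumes cyc: "cyclic_on f S" and ne: "S \<inter> A \<noteq> {}"
  shows "cyclic_on (first_return f A) (S \<inter> A)"
proof -
  let ?g = "first_return f A"
  have ret: "\<exists>k>0. (f ^^ k) x \<in> A" if "x \<in> S" for x
  proof -
    obtain a where a: "a \<in> S" "a \<in> A" using ne by auto
    have "a \<in> orbit f x" using cyc that a(1) by (metis orbit_cyclic_eq3)
    then show ?thesis using a(2) by (auto simp: orbit_altdef)
  qed
  have fS: "f x \<in> S" if "x \<in> S" for x using cyc that by (rule cyclic_on_inI)
  have in_orb: "(f ^^ n) x \<in> A \<Longrightarrow> 0 < n \<Longrightarrow> x \<in> S \<Longrightarrow> \<exists>k>0. (f ^^ n) x = (?g ^^ k) x \<and> ?g x \<in> S \<inter> A" for n x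
  proof (induction n arbitrary: x rule: less_induct)
    case (less n)
    obtain j where j: "n = Suc j" using less.prems by (cases n) auto
    have st: "?g x = (if f x \<in> A then f x else ?g (f x))"
      using first_return_step[of n f x A] less.prems by simp
    show ?case
    proof (cases "j = 0")
      case True
      then have "?g x = (f ^^ n) x \<and> ?g x \<in> S \<inter> A" using st less.prems j fS by auto
      then show ?thesis by (intro exI[of _ 1]) auto
    next
      case False
      have "(f ^^ j) (f x) = (f ^^ n) x" using j by (simp add: funpow_swap1)
      then obtain k where k: "0 < k" "(f ^^ n) x = (?g ^^ k) (f x)" "?g (f x) \<in> S \<inter> A"
        using less.IH[of j "f x"] less.prems False j fS by auto
      show ?thesis
      proof (cases "f x \<in> A")
        case True
        then have "(?g ^^ Suc k) x = (f ^^ n) x" using k st by (simp add: funpow_swap1)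
        moreover have "?g x \<in> S \<inter> A" using st True fS less.prems by auto
        ultimately show ?thesis by (metis zero_less_Suc)
      next
        case False
        then have "?g x = ?g (f x)" using st by simp
        then have "(?g ^^ k) x = (f ^^ n) x" using k
          by (metis (no_types, lifting) funpow_swap1 gr0_conv_Suc funpow_simps_right(2) o_apply)
        then show ?thesis using k \<open>?g x = ?g (f x)\<close> by metis
      qed
    qed
  qed
  obtain s where s: "s \<in> S" "s \<in> A" using ne by auto
  have gS: "?g x \<in> S \<inter> A" if "x \<in> S" for x
  proof -
    show ?thesis using ret[OF that] in_orb[OF _ _ that] by metis
  qed
  have "S \<inter> A = orbit ?g s"
  proof
    show "orbit ?g s \<subseteq> S \<inter> A"
    proof
      fix x assume "x \<in> orbit ?g s"
      then show "x \<in> S \<inter> A" by induction (use gS s in auto)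
    qed
    show "S \<inter> A \<subseteq> orbit ?g s"
    proof
      fix x assume x: "x \<in> S \<inter> A"
      then have "x \<in> orbit f s" using cyc s by (metis IntD1 orbit_cyclic_eq3)
      then obtain n where n: "x = (f ^^ n) s" "0 < n" by (auto simp: orbit_altdef)
      then obtain k where "0 < k" "x = (?g ^^ k) s" using in_orb[of n s] x s by auto
      then show "x \<in> orbit ?g s" by (auto simp: orbit_altdef)
    qed
  qed
  then show ?thesis unfolding cyclic_on_def using s by blast
qed

lemma first_return_first_return:
  assumes cyc: "cyclic_on f S" and BA: "B \<subseteq> A" and x: "x \<in> S" and ne: "S \<inter> B \<noteq> {}"
  shows "first_return (first_return f A) B x = first_return f B x"
proof -
  let ?g = "first_return f A"
  have neA: "S \<inter> A \<noteq> {}" using ne BA by auto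
  have ret: "\<exists>k>0. (f ^^ k) x \<in> C" if x: "x \<in> S" and C: "S \<inter> C \<noteq> {}" for x C
  proof -
    obtain a where a: "a \<in> S" "a \<in> C" using C by auto
    have "a \<in> orbit f x" using cyc x a(1) by (metis orbit_cyclic_eq3)
    then show ?thesis using a(2) by (auto simp: orbit_altdef)
  qed
  have stA: "?g x = (if f x \<in> A then f x else ?g (f x))" if "x \<in> S" for x
    using ret[OF that neA] first_return_step by metis
  have fS: "f x \<in> S" if "x \<in> S" for x using cyc that by (rule cyclic_on_inI)
  have "\<exists>k>0. (?g ^^ k) x \<in> B \<and> first_return ?g B x = first_return f B x"
    if "(f ^^ n) x \<in> B" "0 < n" "x \<in> S" for n x
    using that
  proof (induction n arbitrary: x rule: less_induct)
    case (less n)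
    obtain j where j: "n = Suc j" using less.prems by (cases n) auto
    have stB: "first_return f B x = (if f x \<in> B then f x else first_return f B (f x))"
      using first_return_step[of n f x B] less.prems by simp
    show ?case
    proof (cases "f x \<in> B")
      case True
      then have "?g x = f x" using stA less.prems BA by auto
      then have "(?g ^^ 1) x \<in> B" using True by simp
      then show ?thesis using first_return_step[of 1 ?g x B] True \<open>?g x = f x\<close> stB by (metis zero_less_one)
    next
      case False
      then have "0 < j" using less.prems j by (cases j) auto
      have "(f ^^ j) (f x) = (f ^^ n) x" using j by (simp add: funpow_swap1)
      then obtain k where k: "0 < k" "(?g ^^ k) (f x) \<in> B" "first_return ?g B (f x) = first_return f B (f x)"
        using less.IH[of j "f x"] less.prems \<open>0 < j\<close> j fS by auto
      show ?thesis
      proof (cases "f x \<in> A")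
        case True
        then have g: "?g x = f x" using stA less.prems by auto
        then have sk: "(?g ^^ Suc k) x \<in> B" using k by (simp add: funpow_swap1)
        then have "first_return ?g B x = first_return ?g B (f x)"
          using first_return_step[of "Suc k" ?g x B] False g by simp
        then show ?thesis using k stB False sk by (metis zero_less_Suc)
      next
        case fA: False
        then have g: "?g x = ?g (f x)" using stA less.prems by auto
        obtain i where i: "k = Suc i" using k by (cases k) auto
        have sk: "(?g ^^ k) x \<in> B" using k(2) g unfolding i by (simp only: funpow_Suc_right o_apply)
        have "first_return ?g B x = first_return ?g B (f x)"
          using first_return_step[of k ?g x B] first_return_step[of k ?g "f x" B] k sk g by simp
        then show ?thesis using k stB False sk by metis
      qed
    qed
  qed
  then show ?thesis using ret[OF x ne] x by blast
qed


lemma rooted_mapD: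
  assumes "rooted_map m"
  shows "root_vertex m \<in> verts m"
    and "h \<in> halves m \<Longrightarrow> org m h \<in> verts m"
    and "h \<in> halves m \<Longrightarrow> opp m h \<in> halves m"
    and "h \<in> halves m \<Longrightarrow> opp m h \<noteq> h"
    and "h \<in> halves m \<Longrightarrow> opp m (opp m h) = h"
    and "v \<in> verts m \<Longrightarrow> halves_at m v = {} \<or> cyclic_on (rot m) (halves_at m v)"
    and "v \<in> verts m \<Longrightarrow> (root_vertex m, v) \<in> (adj m)\<^sup>*"
    and "root_half m = None \<Longrightarrow> halves_at m (root_vertex m) = {}"
    and "root_half m = Some h \<Longrightarrow> h \<in> halves_at m (root_vertex m)"
  using assms unfolding rooted_map_def by auto

lemma cyclic_halves:
  assumes "rooted_map m" "h \<in> halves m"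
  shows "cyclic_on (rot m) (halves_at m (org m h))" "h \<in> halves_at m (org m h)"
    "rot m h \<in> halves m" "org m (rot m h) = org m h"
proof -
  show h: "h \<in> halves_at m (org m h)" using assms by (simp add: halves_at_def)
  then show c: "cyclic_on (rot m) (halves_at m (org m h))"
    using rooted_mapD(6)[OF assms(1) rooted_mapD(2)[OF assms]] by auto
  have "rot m h \<in> halves_at m (org m h)" using c h by (rule cyclic_on_inI)
  then show "rot m h \<in> halves m" "org m (rot m h) = org m h" by (auto simp: halves_at_def)
qed

lemma relpow_subset: "A \<subseteq> B \<Longrightarrow> A ^^ n \<subseteq> B ^^ n" for A B :: "('a \<times> 'a) set"
  by (induction n) auto

lemma root_dist_path:
  assumes "rooted_map m" "v \<in> verts m"
  shows "(root_vertex m, v) \<in> adj m ^^ root_dist m v"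
  unfolding root_dist_def
  by (rule LeastI_ex) (use rooted_mapD(7)[OF assms] rtrancl_imp_relpow in blast)

lemma root_dist_le: "(root_vertex m, v) \<in> adj m ^^ n \<Longrightarrow> root_dist m v \<le> n"
  unfolding root_dist_def by (rule Least_le)

lemma root_dist_root [simp]: "root_dist m (root_vertex m) = 0"
  using root_dist_le[of m "root_vertex m" 0] by simp

lemma root_dist_opp:
  assumes "rooted_map m" "h \<in> halves m"
  shows "root_dist m (org m (opp m h)) \<le> Suc (root_dist m (org m h))"
proof -
  have "(org m h, org m (opp m h)) \<in> adj m" using assms by (auto simp: adj_def)
  then have "(root_vertex m, org m (opp m h)) \<in> adj m ^^ Suc (root_dist m (org m h))"
    using root_dist_path[OF assms(1) rooted_mapD(2)[OF assms]] by (rule relpow_Suc_I[rotated])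
  then show ?thesis by (rule root_dist_le)
qed

lemma cmap_ball_simps [simp]:
  "verts (cmap_ball R m) = {v \<in> verts m. root_dist m v \<le> R}"
  "halves (cmap_ball R m) = ball_halves R m"
  "org (cmap_ball R m) = org m"
  "rot (cmap_ball R m) = first_return (rot m) (ball_halves R m)"
  "opp (cmap_ball R m) = opp m"
  "is_black (cmap_ball R m) = is_black m"
  "root_vertex (cmap_ball R m) = root_vertex m"
  "root_half (cmap_ball R m) = (if R = 0 then None else root_half m)"
  by (simp_all add: cmap_ball_def)

lemma ball_halvesD:
  assumes "rooted_map m" "h \<in> ball_halves R m"
  shows "h \<in> halves m" "opp m h \<in> ball_halves R m" "root_dist m (org m h) \<le> R"
  using assms root_dist_opp[of m h] root_dist_opp[of m "opp m h"] rooted_mapD[OF assms(1)]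
  by (auto simp: ball_halves_def)

lemma halves_at_cmap_ball: "halves_at (cmap_ball R m) v = halves_at m v \<inter> ball_halves R m"
  by (auto simp: halves_at_def ball_halves_def)

lemma adj_cmap_ball: "adj (cmap_ball R m) = {(org m h, org m (opp m h)) | h. h \<in> ball_halves R m}"
  by (simp add: adj_def)

lemma cmap_ball_path:
  assumes m: "rooted_map m" and v: "v \<in> verts m" and R: "root_dist m v \<le> R"
  shows "(root_vertex m, v) \<in> adj (cmap_ball R m) ^^ root_dist m v"
  using v R
proof (induction "root_dist m v" arbitrary: v)
  case 0
  then show ?case using root_dist_path[OF m, of v] by simp
next
  case (Suc n)
  have "(root_vertex m, v) \<in> adj m ^^ Suc n" using root_dist_path[OF m Suc.prems(1)] Suc.hyps(2) by simp
  then obtain u where u: "(root_vertex m, u) \<in> adj m ^^ n" "(u, v) \<in> adj m" by auto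
  then obtain h where h: "h \<in> halves m" "org m h = u" "org m (opp m h) = v" by (auto simp: adj_def)
  have "root_dist m u \<le> n" using u by (rule_tac root_dist_le)
  moreover have "Suc n \<le> Suc (root_dist m u)" using root_dist_opp[OF m h(1)] h Suc.hyps(2) by simp
  ultimately have n: "root_dist m u = n" by simp
  have "u \<in> verts m" using h rooted_mapD(2)[OF m] by blast
  then have "(root_vertex m, u) \<in> adj (cmap_ball R m) ^^ n"
    using Suc.hyps(1)[of u] n Suc.hyps(2) Suc.prems by simp
  moreover have "h \<in> ball_halves R m" using h n Suc.hyps(2) Suc.prems by (simp add: ball_halves_def)
  then have "(u, v) \<in> adj (cmap_ball R m)" using h by (auto simp: adj_cmap_ball)
  ultimately have "(root_vertex m, v) \<in> adj (cmap_ball R m) ^^ Suc n" by (rule relpow_Suc_I)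
  then show ?case using Suc.hyps(2) by metis
qed

lemma root_dist_cmap_ball:
  assumes m: "rooted_map m" and v: "v \<in> verts m" and R: "root_dist m v \<le> R"
  shows "root_dist (cmap_ball R m) v = root_dist m v"
proof (rule antisym)
  show "root_dist (cmap_ball R m) v \<le> root_dist m v"
    using cmap_ball_path[OF assms] by (intro root_dist_le) simp
  have "adj (cmap_ball R m) \<subseteq> adj m" by (auto simp: adj_cmap_ball adj_def ball_halves_def)
  moreover have "(root_vertex m, v) \<in> adj (cmap_ball R m) ^^ root_dist (cmap_ball R m) v"
    unfolding root_dist_def[of "cmap_ball R m"] using cmap_ball_path[OF assms] by (simp, rule LeastI)
  ultimately have "(root_vertex m, v) \<in> adj m ^^ root_dist (cmap_ball R m) v"
    using relpow_subset by blast
  then show "root_dist m v \<le> root_dist (cmap_ball R m) v" by (rule root_dist_le)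
qed

lemma rooted_map_cmap_ball:
  assumes m: "rooted_map m"
  shows "rooted_map (cmap_ball R m)"
  unfolding rooted_map_def
proof (intro conjI ballI)
  show "root_vertex (cmap_ball R m) \<in> verts (cmap_ball R m)" using rooted_mapD(1)[OF m] by simp
next
  fix h assume "h \<in> halves (cmap_ball R m)"
  then have h: "h \<in> ball_halves R m" by simp
  note D = ball_halvesD[OF m h]
  show "org (cmap_ball R m) h \<in> verts (cmap_ball R m)" using D rooted_mapD(2)[OF m] by simp
  show "opp (cmap_ball R m) h \<in> halves (cmap_ball R m)" using D by simp
  show "opp (cmap_ball R m) h \<noteq> h" using D rooted_mapD(4)[OF m] by simp
  show "opp (cmap_ball R m) (opp (cmap_ball R m) h) = h" using D rooted_mapD(5)[OF m] by simp
next
  fix v assume "v \<in> verts (cmap_ball R m)"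
  then have v: "v \<in> verts m" "root_dist m v \<le> R" by auto
  show "halves_at (cmap_ball R m) v = {} \<or> cyclic_on (rot (cmap_ball R m)) (halves_at (cmap_ball R m) v)"
    using rooted_mapD(6)[OF m v(1)] cyclic_on_first_return unfolding halves_at_cmap_ball cmap_ball_simps
    by blast
  show "(root_vertex (cmap_ball R m), v) \<in> (adj (cmap_ball R m))\<^sup>*"
    using cmap_ball_path[OF m v] by (simp add: relpow_imp_rtrancl)
next
  show "case root_half (cmap_ball R m) of None \<Rightarrow> halves_at (cmap_ball R m) (root_vertex (cmap_ball R m)) = {}
        | Some h \<Rightarrow> h \<in> halves_at (cmap_ball R m) (root_vertex (cmap_ball R m))"
  proof (cases "R = 0")
    case True
    then show ?thesis by (auto simp: halves_at_cmap_ball ball_halves_def)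
  next
    case False
    then have "halves_at (cmap_ball R m) (root_vertex m) = halves_at m (root_vertex m)"
      unfolding halves_at_cmap_ball by (auto simp: halves_at_def ball_halves_def)
    then show ?thesis using False rooted_mapD(8,9)[OF m] by (auto split: option.split)
  qed
qed


subsection \<open>Isomorphisms\<close>

lemma iso_byD:
  assumes "iso_by f g m m'"
  shows "bij_betw f (verts m) (verts m')" "bij_betw g (halves m) (halves m')"
    and "h \<in> halves m \<Longrightarrow> org m' (g h) = f (org m h)"
    and "h \<in> halves m \<Longrightarrow> rot m' (g h) = g (rot m h)"
    and "h \<in> halves m \<Longrightarrow> opp m' (g h) = g (opp m h)"
    and "h \<in> halves m \<Longrightarrow> g h \<in> halves m'"
    and "v \<in> verts m \<Longrightarrow> f v \<in> verts m'"
    and "v \<in> verts m \<Longrightarrow> is_black m' (f v) \<longleftrightarrow> is_black m v"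
    and "f (root_vertex m) = root_vertex m'" "map_option g (root_half m) = root_half m'"
  using assms unfolding iso_by_def by (auto dest: bij_betwE)

lemma map_iso_refl: "rooted_map m \<Longrightarrow> map_iso m m"
  unfolding map_iso_def by (auto simp: iso_by_def option.map_ident intro!: exI[of _ "\<lambda>x. x"] bij_betw_imageI)

lemma map_iso_sym:
  assumes "map_iso m m'"
  shows "map_iso m' m"
proof -
  from assms obtain f g where m: "rooted_map m" "rooted_map m'" and i: "iso_by f g m m'"
    by (auto simp: map_iso_def)
  let ?f = "inv_into (verts m) f" and ?g = "inv_into (halves m) g"
  note D = iso_byD[OF i]
  have fi: "?f (f v) = v" if "v \<in> verts m" for v using D(1) that by (simp add: bij_betw_inv_into_left)
  have gi: "?g (g h) = h" if "h \<in> halves m" for h using D(2) that by (simp add: bij_betw_inv_into_left)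
  have "iso_by ?f ?g m' m"
    unfolding iso_by_def
  proof (intro conjI ballI)
    show "bij_betw ?f (verts m') (verts m)" using D(1) by (rule bij_betw_inv_into)
    show "bij_betw ?g (halves m') (halves m)" using D(2) by (rule bij_betw_inv_into)
  next
    fix h' assume "h' \<in> halves m'"
    then obtain h where h: "h' = g h" "h \<in> halves m" using D(2) by (auto simp: bij_betw_def)
    show "org m (?g h') = ?f (org m' h')" using h D(3) gi fi rooted_mapD(2)[OF m(1)] by simp
    show "rot m (?g h') = ?g (rot m' h')" using h D(4) gi cyclic_halves(3)[OF m(1)] by simp
    show "opp m (?g h') = ?g (opp m' h')" using h D(5) gi rooted_mapD(3)[OF m(1)] by simp
  next
    fix v' assume "v' \<in> verts m'"
    then obtain v where v: "v' = f v" "v \<in> verts m" using D(1) by (auto simp: bij_betw_def)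
    then show "is_black m (?f v') \<longleftrightarrow> is_black m' v'" using D(8) fi by simp
  next
    show "?f (root_vertex m') = root_vertex m" using D(9) fi rooted_mapD(1)[OF m(1)] by metis
    show "map_option ?g (root_half m') = root_half m"
      using D(10)[symmetric] gi rooted_mapD(9)[OF m(1)] by (cases "root_half m") (auto simp: halves_at_def)
  qed
  then show ?thesis using m unfolding map_iso_def by blast
qed

lemma map_iso_trans:
  assumes "map_iso m m'" "map_iso m' m''"
  shows "map_iso m m''"
proof -
  from assms obtain f g f' g' where m: "rooted_map m" "rooted_map m''"
    and i: "iso_by f g m m'" "iso_by f' g' m' m''"
    by (auto simp: map_iso_def)
  note D = iso_byD[OF i(1)] and E = iso_byD[OF i(2)]
  have "iso_by (f' \<circ> f) (g' \<circ> g) m m''"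
    unfolding iso_by_def
    using bij_betw_trans[OF D(1) E(1)] bij_betw_trans[OF D(2) E(2)] D E
    by (auto simp: option.map_comp[symmetric])
  then show ?thesis using m unfolding map_iso_def by blast
qed


lemma iso_by_root_dist:
  assumes m: "rooted_map m" "rooted_map m'" and i: "iso_by f g m m'" and v: "v \<in> verts m"
  shows "root_dist m' (f v) = root_dist m v"
proof -
  note D = iso_byD[OF i]
  have 1: "(root_vertex m, v) \<in> adj m ^^ n \<Longrightarrow> (root_vertex m', f v) \<in> adj m' ^^ n" for n v
  proof (induction n arbitrary: v)
    case (Suc n)
    then obtain u h where u: "(root_vertex m, u) \<in> adj m ^^ n" "h \<in> halves m" "u = org m h" "v = org m (opp m h)"
      by (auto simp: adj_def)
    have "f u = org m' (g h)" "f v = org m' (opp m' (g h))" "g h \<in> halves m'"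
      using u D(3,5,6) rooted_mapD(3)[OF m(1)] by auto
    then have "(f u, f v) \<in> adj m'" by (auto simp: adj_def)
    then show ?case using Suc.IH[OF u(1)] by (rule relpow_Suc_I[rotated])
  qed (use D(9) in simp)
  have 2: "(root_vertex m', w) \<in> adj m' ^^ n \<Longrightarrow> \<exists>v\<in>verts m. w = f v \<and> (root_vertex m, v) \<in> adj m ^^ n" for n w
  proof (induction n arbitrary: w)
    case 0
    then show ?case using D(9) rooted_mapD(1)[OF m(1)] by auto
  next
    case (Suc n)
    then obtain u' h' where u': "(root_vertex m', u') \<in> adj m' ^^ n" "h' \<in> halves m'"
      "u' = org m' h'" "w = org m' (opp m' h')"
      by (auto simp: adj_def)
    obtain u where u: "u \<in> verts m" "u' = f u" "(root_vertex m, u) \<in> adj m ^^ n" using Suc.IH[OF u'(1)] by blast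
    obtain h where h: "h' = g h" "h \<in> halves m" using D(2) u'(2) by (auto simp: bij_betw_def)
    have "f (org m h) = f u" using h u u' D(3) by simp
    then have "org m h = u" using D(1) rooted_mapD(2)[OF m(1) h(2)] u by (auto simp: bij_betw_def inj_on_def)
    then have "(u, org m (opp m h)) \<in> adj m" using h by (auto simp: adj_def)
    then have "(root_vertex m, org m (opp m h)) \<in> adj m ^^ Suc n" using u(3) by (rule relpow_Suc_I[rotated])
    moreover have "w = f (org m (opp m h))" using u' h D(3,5) rooted_mapD(3)[OF m(1)] by simp
    ultimately show ?case using rooted_mapD(2,3)[OF m(1)] h(2) by blast
  qed
  have "(root_vertex m', f v) \<in> adj m' ^^ n \<longleftrightarrow> (root_vertex m, v) \<in> adj m ^^ n" for n
    using 1[of v n] 2[of "f v" n] D(1) v by (auto simp: bij_betw_def inj_on_def)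
  then show ?thesis by (simp add: root_dist_def)
qed

lemma map_iso_cmap_ball:
  assumes "map_iso m m'"
  shows "map_iso (cmap_ball R m) (cmap_ball R m')"
proof -
  from assms obtain f g where m: "rooted_map m" "rooted_map m'" and i: "iso_by f g m m'"
    by (auto simp: map_iso_def)
  note D = iso_byD[OF i]
  note dist = iso_by_root_dist[OF m i]
  have H: "g h \<in> ball_halves R m' \<longleftrightarrow> h \<in> ball_halves R m" if "h \<in> halves m" for h
  proof -
    have "root_dist m' (org m' (g h)) = root_dist m (org m h)"
      "root_dist m' (org m' (opp m' (g h))) = root_dist m (org m (opp m h))"
      using D(3,5) that dist rooted_mapD(2,3)[OF m(1)] by simp_all
    then show ?thesis using D(6) that by (simp add: ball_halves_def)
  qed
  have pow: "(rot m' ^^ k) (g h) = g ((rot m ^^ k) h) \<and> (rot m ^^ k) h \<in> halves m" if "h \<in> halves m" for k h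
    by (induction k) (use that D(4) cyclic_halves(3)[OF m(1)] in auto)
  have "iso_by f g (cmap_ball R m) (cmap_ball R m')"
    unfolding iso_by_def cmap_ball_simps
  proof (intro conjI ballI)
    show "bij_betw f {v \<in> verts m. root_dist m v \<le> R} {v \<in> verts m'. root_dist m' v \<le> R}"
    proof (rule bij_betw_imageI)
      show "inj_on f {v \<in> verts m. root_dist m v \<le> R}" 
        by (rule inj_on_subset[OF bij_betw_imp_inj_on[OF D(1)]]) auto
      show "f ` {v \<in> verts m. root_dist m v \<le> R} = {v \<in> verts m'. root_dist m' v \<le> R}"
      proof
        show "f ` {v \<in> verts m. root_dist m v \<le> R} \<subseteq> {v \<in> verts m'. root_dist m' v \<le> R}"
          using D(7) dist by auto
        show "{v \<in> verts m'. root_dist m' v \<le> R} \<subseteq> f ` {v \<in> verts m. root_dist m v \<le> R}"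
        proof
          fix w assume w: "w \<in> {v \<in> verts m'. root_dist m' v \<le> R}"
          then have "w \<in> f ` verts m" using D(1) unfolding bij_betw_def by blast
          then obtain v where v: "v \<in> verts m" "w = f v" by blast
          then show "w \<in> f ` {v \<in> verts m. root_dist m v \<le> R}" using w dist by simp
        qed
      qed
    qed
    have sub: "ball_halves R m \<subseteq> halves m" "ball_halves R m' \<subseteq> halves m'" by (auto simp: ball_halves_def)
    show "bij_betw g (ball_halves R m) (ball_halves R m')"
    proof (rule bij_betw_imageI)
      show "inj_on g (ball_halves R m)" 
        using bij_betw_imp_inj_on[OF D(2)] sub(1) by (rule inj_on_subset)
      show "g ` ball_halves R m = ball_halves R m'"
      proof
        show "g ` ball_halves R m \<subseteq> ball_halves R m'" using H sub by blast
        show "ball_halves R m' \<subseteq> g ` ball_halves R m"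
        proof
          fix h' assume h': "h' \<in> ball_halves R m'"
          then have "h' \<in> g ` halves m" using D(2) sub unfolding bij_betw_def by blast
          then obtain h where "h \<in> halves m" "h' = g h" by blast
          then show "h' \<in> g ` ball_halves R m" using H h' by blast
        qed
      qed
    qed
  next
    fix h assume "h \<in> ball_halves R m"
    then have h: "h \<in> halves m" by (simp add: ball_halves_def)
    show "org m' (g h) = f (org m h)" "opp m' (g h) = g (opp m h)" using D(3,5) h by auto
    have eq: "(rot m' ^^ k) (g h) \<in> ball_halves R m' \<longleftrightarrow> (rot m ^^ k) h \<in> ball_halves R m" for k
      using pow[OF h, of k] H by simp
    show "first_return (rot m') (ball_halves R m') (g h) = g (first_return (rot m) (ball_halves R m) h)"
      unfolding first_return_def eq by (rule pow[OF h, THEN conjunct1])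
  next
    fix v assume "v \<in> {v \<in> verts m. root_dist m v \<le> R}"
    then show "is_black m' (f v) \<longleftrightarrow> is_black m v" using D(8) by simp
  next
    show "f (root_vertex m) = root_vertex m'" by (rule D(9))
    show "map_option g (if R = 0 then None else root_half m) = (if R = 0 then None else root_half m')"
      using D(10) by simp
  qed
  then show ?thesis
    using rooted_map_cmap_ball[OF m(1)] rooted_map_cmap_ball[OF m(2)] unfolding map_iso_def by blast
qed

lemma cmap_ball_Suc_ball:
  assumes m: "rooted_map m"
  shows "map_iso (cmap_ball R (cmap_ball (Suc R) m)) (cmap_ball R m)"
proof -
  let ?b = "cmap_ball (Suc R) m"
  have b: "rooted_map ?b" using m by (rule rooted_map_cmap_ball)
  have dist: "root_dist ?b v = root_dist m v" if "v \<in> verts m" "root_dist m v \<le> Suc R" for v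
    using root_dist_cmap_ball[OF m that] .
  have halves_eq: "ball_halves R ?b = ball_halves R m"
  proof -
    have "h \<in> ball_halves R ?b \<longleftrightarrow> h \<in> ball_halves R m" for h
    proof (cases "h \<in> ball_halves (Suc R) m")
      case True
      note E = ball_halvesD[OF m True]
      have "root_dist ?b (org m h) = root_dist m (org m h)"
        by (rule dist) (use E rooted_mapD(2)[OF m] in auto)
      moreover have "root_dist ?b (org m (opp m h)) = root_dist m (org m (opp m h))"
        by (rule dist) (use ball_halvesD[OF m E(2)] rooted_mapD(2)[OF m] in auto)
      ultimately show ?thesis using True E by (simp add: ball_halves_def)
    next
      case False
      then show ?thesis by (auto simp: ball_halves_def)
    qed
    then show ?thesis by blast
  qed
  have sub: "ball_halves R m \<subseteq> ball_halves (Suc R) m" by (auto simp: ball_halves_def)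
  have rot_eq: "first_return (first_return (rot m) (ball_halves (Suc R) m)) (ball_halves R m) h
      = first_return (rot m) (ball_halves R m) h" if h: "h \<in> ball_halves R m" for h
  proof (rule first_return_first_return[OF _ sub])
    have hm: "h \<in> halves m" using h by (simp add: ball_halves_def)
    show "cyclic_on (rot m) (halves_at m (org m h))" by (rule cyclic_halves[OF m hm])
    show "h \<in> halves_at m (org m h)" by (rule cyclic_halves[OF m hm])
    then show "halves_at m (org m h) \<inter> ball_halves R m \<noteq> {}" using h by auto
  qed
  have "iso_by (\<lambda>v. v) (\<lambda>h. h) (cmap_ball R ?b) (cmap_ball R m)"
    unfolding iso_by_def cmap_ball_simps halves_eq
  proof (intro conjI ballI)
    have "{v \<in> {v \<in> verts m. root_dist m v \<le> Suc R}. root_dist ?b v \<le> R} = {v \<in> verts m. root_dist m v \<le> R}"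
      using dist by auto
    then show "bij_betw (\<lambda>v. v) {v \<in> {v \<in> verts m. root_dist m v \<le> Suc R}. root_dist ?b v \<le> R}
        {v \<in> verts m. root_dist m v \<le> R}" by (auto simp: bij_betw_def)
  qed (use rot_eq in \<open>auto simp: bij_betw_def option.map_ident\<close>)
  then show ?thesis
    unfolding map_iso_def using rooted_map_cmap_ball[OF b] rooted_map_cmap_ball[OF m] by blast
qed

text \<open>Half-edges of a map are reached from the root by words in \<open>rot\<close> and \<open>opp\<close>.\<close>

definition follow :: "('v, 'h) cmap \<Rightarrow> bool list \<Rightarrow> 'h \<Rightarrow> 'h" where
  "follow m w = fold (\<lambda>b. if b then rot m else opp m) w"

lemma follow_Nil [simp]: "follow m [] h = h"
  and follow_snoc [simp]: "follow m (w @ [b]) h = (if b then rot m else opp m) (follow m w h)"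
  by (simp_all add: follow_def)

lemma follow_halves:
  assumes m: "rooted_map m" and h: "h \<in> halves m"
  shows "follow m w h \<in> halves m"
  by (induction w rule: rev_induct) (use h rooted_mapD(3)[OF m] cyclic_halves(3)[OF m] in auto)

lemma follow_dist:
  assumes m: "rooted_map m" and r: "root_half m = Some r"
  shows "root_dist m (org m (follow m w r)) \<le> length w"
proof (induction w rule: rev_induct)
  case Nil
  then show ?case using rooted_mapD(9)[OF m r] by (simp add: halves_at_def)
next
  case (snoc b w)
  have "r \<in> halves m" using rooted_mapD(9)[OF m r] by (simp add: halves_at_def)
  then have h: "follow m w r \<in> halves m" by (rule follow_halves[OF m])
  show ?case using snoc root_dist_opp[OF m h] cyclic_halves(4)[OF m h] by auto
qed

lemma follow_cmap_ball:
  assumes m: "rooted_map m" and r: "root_half m = Some r"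
  shows "length w \<le> R \<Longrightarrow> follow (cmap_ball R m) w r = follow m w r"
proof (induction w rule: rev_induct)
  case (snoc b w)
  have "r \<in> halves m" using rooted_mapD(9)[OF m r] by (simp add: halves_at_def)
  then have h: "follow m w r \<in> halves m" by (rule follow_halves[OF m])
  have "root_dist m (org m (follow m w r)) < R" using follow_dist[OF m r, of w] snoc.prems by simp
  then have "rot m (follow m w r) \<in> ball_halves R m"
    using cyclic_halves(3,4)[OF m h] by (simp add: ball_halves_def)
  then have "first_return (rot m) (ball_halves R m) (follow m w r) = rot m (follow m w r)"
    using first_return_step[of 1 "rot m" "follow m w r" "ball_halves R m"] by simp
  then show ?case using snoc by simp
qed simp

lemma follow_surj:
  assumes m: "rooted_map m" and r: "root_half m = Some r" and h: "h \<in> halves m"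
  shows "\<exists>w. h = follow m w r"
proof -
  have rr: "r \<in> halves_at m (root_vertex m)" using rooted_mapD(9)[OF m r] .
  have around: "\<exists>w. k' = follow m w r"
    if k: "\<exists>w. k = follow m w r" "k \<in> halves_at m v" "k' \<in> halves_at m v" for k k' v
  proof -
    obtain w where w: "k = follow m w r" using k by blast
    have "cyclic_on (rot m) (halves_at m v)" using cyclic_halves[OF m, of k] k(2) by (auto simp: halves_at_def)
    then have "k' \<in> orbit (rot m) k" using k by (metis orbit_cyclic_eq3)
    then show ?thesis
    proof induction
      case base
      then show ?case using w follow_snoc[of m w True r] by metis
    next
      case (step y)
      then obtain u where "y = follow m u r" by blast
      then show ?case using follow_snoc[of m u True r] by metis
    qed
  qed
  have "\<forall>h\<in>halves_at m v. \<exists>w. h = follow m w r" if "(root_vertex m, v) \<in> (adj m)\<^sup>*" for v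
    using that
  proof (induction rule: rtrancl_induct)
    case base
    have "\<exists>w. r = follow m w r" using follow_Nil by metis
    then show ?case using around rr by blast
  next
    case (step u v)
    then obtain k where k: "k \<in> halves m" "org m k = u" "org m (opp m k) = v" by (auto simp: adj_def)
    then obtain w where "k = follow m w r" using step.IH by (auto simp: halves_at_def)
    then have "\<exists>w. opp m k = follow m w r" using follow_snoc[of m w False r] by metis
    moreover have "opp m k \<in> halves_at m v" using k rooted_mapD(3)[OF m] by (simp add: halves_at_def)
    ultimately show ?case using around by blast
  qed
  then show ?thesis using rooted_mapD(7)[OF m rooted_mapD(2)[OF m h]] h by (auto simp: halves_at_def)
qed

lemma vertex_has_half:
  assumes m: "rooted_map m" and r: "root_half m = Some r" and v: "v \<in> verts m"
  shows "\<exists>w. v = org m (follow m w r)"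
proof -
  have "\<exists>h\<in>halves m. org m h = v"
  proof (cases "v = root_vertex m")
    case True
    then show ?thesis using rooted_mapD(9)[OF m r] by (auto simp: halves_at_def)
  next
    case False
    then obtain u where "(u, v) \<in> adj m" using rooted_mapD(7)[OF m v] by (metis rtranclE)
    then show ?thesis using rooted_mapD(3)[OF m] by (auto simp: adj_def)
  qed
  then show ?thesis using follow_surj[OF m r] by metis
qed

lemma iso_by_follow:
  assumes m: "rooted_map m" and i: "iso_by f g m m'" and r: "root_half m = Some r"
  shows "root_half m' = Some (g r)" "follow m' w (g r) = g (follow m w r)"
proof -
  note D = iso_byD[OF i]
  show "root_half m' = Some (g r)" using D(10) r by simp
  have "r \<in> halves m" using rooted_mapD(9)[OF m r] by (simp add: halves_at_def)
  then show "follow m' w (g r) = g (follow m w r)"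
    by (induction w rule: rev_induct) (use follow_halves[OF m] D(4,5) in auto)
qed

lemma iso_by_follow_iff:
  assumes m: "rooted_map m" and i: "iso_by f g m m'" and r: "root_half m = Some r" "root_half m' = Some r'"
  shows "follow m' u r' = follow m' w r' \<longleftrightarrow> follow m u r = follow m w r"
    and "org m' (follow m' u r') = org m' (follow m' w r') \<longleftrightarrow> org m (follow m u r) = org m (follow m w r)"
    and "is_black m' (org m' (follow m' u r')) \<longleftrightarrow> is_black m (org m (follow m u r))"
proof -
  note D = iso_byD[OF i]
  have rm: "r \<in> halves m" using rooted_mapD(9)[OF m r(1)] by (simp add: halves_at_def)
  have r': "r' = g r" using iso_by_follow(1)[OF m i r(1)] r(2) by simp
  note F = iso_by_follow(2)[OF m i r(1), folded r'] follow_halves[OF m rm]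
  show "follow m' u r' = follow m' w r' \<longleftrightarrow> follow m u r = follow m w r"
    using F D(2) by (auto simp: bij_betw_def inj_on_def)
  have "org m' (follow m' u r') = f (org m (follow m u r))" for u using F D(3) by simp
  then show "org m' (follow m' u r') = org m' (follow m' w r') \<longleftrightarrow> org m (follow m u r) = org m (follow m w r)"
    "is_black m' (org m' (follow m' u r')) \<longleftrightarrow> is_black m (org m (follow m u r))"
    using D(1,8) F rooted_mapD(2)[OF m] by (auto simp: bij_betw_def inj_on_def)
qed

lemma map_iso_separates:
  assumes m: "rooted_map m" "rooted_map m'"
    and iso: "\<And>R. map_iso (cmap_ball R m) (cmap_ball R m')"
  shows "map_iso m m'"
proof (cases "root_half m")
  case None
  obtain f g where i: "iso_by f g (cmap_ball 1 m) (cmap_ball 1 m')" using iso[of 1] by (auto simp: map_iso_def)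
  have None': "root_half m' = None" using iso_byD(10)[OF i] None by simp
  have trivial: "verts x = {root_vertex x} \<and> halves x = {}" if x: "rooted_map x" "root_half x = None"
    for x :: "('x, 'y) cmap"
  proof -
    have e: "halves_at x (root_vertex x) = {}" using rooted_mapD(8)[OF x] .
    have "v = root_vertex x" if "v \<in> verts x" for v
      using rooted_mapD(7)[OF x(1) that]
    proof (cases rule: converse_rtranclE)
      case (step u)
      then show ?thesis using e by (auto simp: adj_def halves_at_def)
    qed simp
    then have v: "verts x = {root_vertex x}" using rooted_mapD(1)[OF x(1)] by blast
    have "h \<notin> halves x" for h
    proof
      assume h: "h \<in> halves x"
      then have "org x h = root_vertex x" using rooted_mapD(2)[OF x(1) h] v by simp
      then show False using e h by (simp add: halves_at_def)
    qed
    then show ?thesis using v by blast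
  qed
  have "is_black m' (root_vertex m') \<longleftrightarrow> is_black m (root_vertex m)"
    using iso_byD(8)[OF i, of "root_vertex m"] iso_byD(9)[OF i] rooted_mapD(1)[OF m(1)] by simp
  then have "iso_by (\<lambda>_. root_vertex m') g m m'"
    using trivial[OF m(1) None] trivial[OF m(2) None'] None None' by (auto simp: iso_by_def bij_betw_def)
  then show ?thesis using m unfolding map_iso_def by blast
next
  case (Some r)
  obtain f1 g1 where i1: "iso_by f1 g1 (cmap_ball 1 m) (cmap_ball 1 m')" using iso[of 1] by (auto simp: map_iso_def)
  obtain r' where Some': "root_half m' = Some r'" using iso_byD(10)[OF i1, symmetric] Some by auto
  have key: "(follow m' u r' = follow m' w r' \<longleftrightarrow> follow m u r = follow m w r) \<and>
      (org m' (follow m' u r') = org m' (follow m' w r') \<longleftrightarrow> org m (follow m u r) = org m (follow m w r)) \<and>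
      (is_black m' (org m' (follow m' u r')) \<longleftrightarrow> is_black m (org m (follow m u r)))" for u w
  proof -
    define R where "R = Suc (length u + length w)"
    obtain f g where i: "iso_by f g (cmap_ball R m) (cmap_ball R m')" using iso[of R] by (auto simp: map_iso_def)
    have "root_half (cmap_ball R m) = Some r" "root_half (cmap_ball R m') = Some r'"
      using Some Some' by (simp_all add: R_def)
    note I = iso_by_follow_iff[OF rooted_map_cmap_ball[OF m(1)] i this]
    have "follow (cmap_ball R m) u r = follow m u r" "follow (cmap_ball R m) w r = follow m w r"
      "follow (cmap_ball R m') u r' = follow m' u r'" "follow (cmap_ball R m') w r' = follow m' w r'"
      by (rule follow_cmap_ball[OF m(1) Some] follow_cmap_ball[OF m(2) Some'], simp add: R_def)+
    then show ?thesis using I(1,2)[of u w] I(3)[of u] by simp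
  qed
  have rm: "r \<in> halves m" "org m r = root_vertex m" using rooted_mapD(9)[OF m(1) Some] by (auto simp: halves_at_def)
  have rm': "r' \<in> halves m'" "org m' r' = root_vertex m'" using rooted_mapD(9)[OF m(2) Some'] by (auto simp: halves_at_def)
  define g where "g h = follow m' (SOME w. h = follow m w r) r'" for h
  define f where "f v = org m' (follow m' (SOME w. v = org m (follow m w r)) r')" for v
  have g: "g (follow m w r) = follow m' w r'" for w
  proof -
    have "follow m w r = follow m (SOME u. follow m w r = follow m u r) r" by (rule someI) (rule refl)
    then show ?thesis unfolding g_def using key by metis
  qed
  have f: "f (org m (follow m w r)) = org m' (follow m' w r')" for w
  proof -
    have "org m (follow m w r) = org m (follow m (SOME u. org m (follow m w r) = org m (follow m u r)) r)"
      by (rule someI) (rule refl)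
    then show ?thesis unfolding f_def using key by metis
  qed
  note hs = follow_surj[OF m(1) Some] and hs' = follow_surj[OF m(2) Some']
  note vs = vertex_has_half[OF m(1) Some] and vs' = vertex_has_half[OF m(2) Some']
  have "iso_by f g m m'"
    unfolding iso_by_def
  proof (intro conjI ballI)
    show "bij_betw f (verts m) (verts m')"
    proof (rule bij_betw_imageI)
      show "inj_on f (verts m)"
      proof (rule inj_onI)
        fix x y assume a: "x \<in> verts m" "y \<in> verts m" "f x = f y"
        obtain u w where "x = org m (follow m u r)" "y = org m (follow m w r)" using vs a by meson
        then show "x = y" using a(3) f key by metis
      qed
      show "f ` verts m = verts m'"
      proof
        show "f ` verts m \<subseteq> verts m'"
        proof
          fix y assume "y \<in> f ` verts m"
          then obtain u where "y = org m' (follow m' u r')" using vs f by (metis imageE)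
          then show "y \<in> verts m'" using rooted_mapD(2)[OF m(2) follow_halves[OF m(2) rm'(1)]] by simp
        qed
        show "verts m' \<subseteq> f ` verts m"
        proof
          fix y assume "y \<in> verts m'"
          then obtain u where "y = org m' (follow m' u r')" using vs' by blast
          then have "y = f (org m (follow m u r))" using f by simp
          then show "y \<in> f ` verts m" using rooted_mapD(2)[OF m(1) follow_halves[OF m(1) rm(1)]] by blast
        qed
      qed
    qed
    show "bij_betw g (halves m) (halves m')"
    proof (rule bij_betw_imageI)
      show "inj_on g (halves m)"
      proof (rule inj_onI)
        fix x y assume a: "x \<in> halves m" "y \<in> halves m" "g x = g y"
        obtain u w where "x = follow m u r" "y = follow m w r" using hs a by meson
        then show "x = y" using a(3) g key by metis
      qed
      show "g ` halves m = halves m'"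
      proof
        show "g ` halves m \<subseteq> halves m'"
        proof
          fix y assume "y \<in> g ` halves m"
          then obtain u where "y = follow m' u r'" using hs g by (metis imageE)
          then show "y \<in> halves m'" using follow_halves[OF m(2) rm'(1)] by simp
        qed
        show "halves m' \<subseteq> g ` halves m"
        proof
          fix y assume "y \<in> halves m'"
          then obtain u where "y = follow m' u r'" using hs' by blast
          then have "y = g (follow m u r)" using g by simp
          then show "y \<in> g ` halves m" using follow_halves[OF m(1) rm(1)] by blast
        qed
      qed
    qed
  next
    fix h assume "h \<in> halves m"
    then obtain w where w: "h = follow m w r" using hs by blast
    show "org m' (g h) = f (org m h)" unfolding w g f ..
    show "rot m' (g h) = g (rot m h)" unfolding w g using g[of "w @ [True]"] by simp
    show "opp m' (g h) = g (opp m h)" unfolding w g using g[of "w @ [False]"] by simp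
  next
    fix v assume "v \<in> verts m"
    then obtain w where w: "v = org m (follow m w r)" using vs by blast
    show "is_black m' (f v) \<longleftrightarrow> is_black m v" unfolding w f using key by blast
  next
    show "f (root_vertex m) = root_vertex m'" using f[of "[]"] rm rm' by simp
    show "map_option g (root_half m) = root_half m'" using g[of "[]"] Some Some' by simp
  qed
  then show ?thesis using m unfolding map_iso_def by blast
qed


subsection \<open>The space of rooted maps up to isomorphism\<close>

text \<open>The types of vertices and half-edges are countably infinite, so every rooted map has a copy on
  them. They are those used for the vertices and half-edges of blossoming trees: a vertex is the list
  of slots leading to it from the root, \<open>Up v\<close> is the half-edge at \<open>v\<close> of the edge to its
  parent, and \<open>Slot v i\<close> is slot number \<open>i\<close> at \<open>v\<close>.\<close>

datatype half = Up "nat list" | Slot "nat list" nat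

quotient_type rmap = "(nat list, half) cmap" / partial: "map_iso"
proof (rule part_equivpI)
  let ?m = "\<lparr>verts = {[]}, halves = {}, org = (\<lambda>_. []), rot = id, opp = id, is_black = (\<lambda>_. True),
    root_vertex = [], root_half = None\<rparr> :: (nat list, half) cmap"
  have "rooted_map ?m" by (simp add: rooted_map_def halves_at_def)
  then show "\<exists>x :: (nat list, half) cmap. map_iso x x" using map_iso_refl by blast
  show "symp (map_iso :: (nat list, half) cmap \<Rightarrow> _)" by (rule sympI) (rule map_iso_sym)
  show "transp (map_iso :: (nat list, half) cmap \<Rightarrow> _)" by (rule transpI) (rule map_iso_trans)
qed

lift_definition map_ball :: "nat \<Rightarrow> rmap \<Rightarrow> rmap" is cmap_ball
  by (rule map_iso_cmap_ball)

lemma map_ball_Suc_ball: "map_ball R (map_ball (Suc R) x) = map_ball R x"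
  by transfer (rule cmap_ball_Suc_ball, simp add: map_iso_def)

lemma map_ball_Suc_eqD: "map_ball (Suc R) x = map_ball (Suc R) y \<Longrightarrow> map_ball R x = map_ball R y"
  by (metis map_ball_Suc_ball)

lemma map_ball_separates: "\<forall>R. map_ball R x = map_ball R y \<Longrightarrow> x = y"
  by transfer (rule map_iso_separates, auto simp: map_iso_def)

instantiation rmap :: metric_space
begin

definition dist_rmap :: "rmap \<Rightarrow> rmap \<Rightarrow> real" where
  "dist_rmap = dloc map_ball"

definition uniformity_rmap :: "(rmap \<times> rmap) filter" where
  "uniformity_rmap = (INF e\<in>{0 <..}. principal {(x, y). dist x y < e})"

definition open_rmap :: "rmap set \<Rightarrow> bool" where
  "open_rmap U \<longleftrightarrow> (\<forall>x\<in>U. eventually (\<lambda>(x', y). x' = x \<longrightarrow> y \<in> U) uniformity)"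

instance
proof
  show "dist x y = 0 \<longleftrightarrow> x = y" for x y :: rmap
    by (auto simp: dist_rmap_def dloc_eq_0_iff map_ball_separates)
  show "dist x y \<le> dist x z + dist y z" for x y z :: rmap
    unfolding dist_rmap_def by (rule dloc_triangle) (rule map_ball_Suc_eqD)
qed (simp_all add: uniformity_rmap_def open_rmap_def)

end


definition proper_coloring :: "('v, 'h) cmap \<Rightarrow> bool" where
  "proper_coloring m \<longleftrightarrow>
     (\<forall>h\<in>halves m. is_black m (org m (opp m h)) \<longleftrightarrow> \<not> is_black m (org m h))"

definition regular_map :: "nat \<Rightarrow> ('v, 'h) cmap \<Rightarrow> bool" where
  "regular_map d m \<longleftrightarrow> (\<forall>v\<in>verts m. card (halves_at m v) = d)"

definition faces :: "('v, 'h) cmap \<Rightarrow> 'h set set" where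
  "faces m = orbit (rot m \<circ> opp m) ` halves m"

text \<open>Euler's relation, for maps with at least one edge.\<close>

definition planar_map :: "('v, 'h) cmap \<Rightarrow> bool" where
  "planar_map m \<longleftrightarrow> card (verts m) + card (faces m) = card (halves m) div 2 + 2"

definition finite_maps :: "nat \<Rightarrow> rmap set" where
  "finite_maps d = {abs_rmap m | m. rooted_map m \<and> finite (verts m) \<and> planar_map m \<and>
     proper_coloring m \<and> regular_map d m \<and> is_black m (root_vertex m)}"

text \<open>The completion of the set of finite maps, realized inside the space of all finite or infinite
  rooted maps.\<close>

definition maps_completion :: "nat \<Rightarrow> rmap set" where
  "maps_completion d = closure (finite_maps d)"


section \<open>Charges\<close>

primrec subtree :: "nat list \<Rightarrow> btree \<Rightarrow> btree option" where
  "subtree [] t = Some t"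
| "subtree (i # v) t = (if i < length (slots t) then Option.bind (slots t ! i) (subtree v) else None)"

definition tree_verts :: "btree \<Rightarrow> nat list set" where
  "tree_verts t = {v. subtree v t \<noteq> None}"

definition slots_at :: "btree \<Rightarrow> nat list \<Rightarrow> btree option list" where
  "slots_at t v = slots (the (subtree v t))"

definition children :: "btree \<Rightarrow> nat list \<Rightarrow> nat list set" where
  "children t v = {w \<in> tree_verts t. \<exists>i. w = v @ [i]}"

abbreviation black :: "nat list \<Rightarrow> bool" where
  "black v \<equiv> even (length v)"

primrec half_vertex :: "half \<Rightarrow> nat list" where
  "half_vertex (Up v) = v"
| "half_vertex (Slot v i) = v"

definition tree_halves :: "btree \<Rightarrow> half set" where
  "tree_halves t = {Up v | v. v \<in> tree_verts t \<and> v \<noteq> []} \<union>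
                   {Slot v i | v i. v \<in> tree_verts t \<and> i < length (slots_at t v)}"

definition stems :: "btree \<Rightarrow> half set" where
  "stems t = {Slot v i | v i. v \<in> tree_verts t \<and> i < length (slots_at t v) \<and> slots_at t v ! i = None}"

definition opening_stems :: "btree \<Rightarrow> half set" where
  "opening_stems t = {h \<in> stems t. black (half_vertex h)}"

definition closing_stems :: "btree \<Rightarrow> half set" where
  "closing_stems t = {h \<in> stems t. \<not> black (half_vertex h)}"

definition regular_tree :: "nat \<Rightarrow> btree \<Rightarrow> bool" where
  "regular_tree d t \<longleftrightarrow> (\<forall>v\<in>tree_verts t. card {h \<in> tree_halves t. half_vertex h = v} = d)"

definition charge :: "btree \<Rightarrow> nat list \<Rightarrow> int" where
  "charge t v = int (card {h \<in> closing_stems t. prefix v (half_vertex h)})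
              - int (card {h \<in> opening_stems t. prefix v (half_vertex h)})"

definition charge_bounds :: "btree \<Rightarrow> (nat list \<Rightarrow> int) \<Rightarrow> bool" where
  "charge_bounds t c \<longleftrightarrow> (\<forall>v\<in>tree_verts t. if black v then c v \<le> 1 else c v \<ge> 0)"

definition finite_trees_of_size :: "nat \<Rightarrow> nat \<Rightarrow> btree set" where
  "finite_trees_of_size d n = {t. finite (tree_verts t) \<and> regular_tree d t \<and> charge_bounds t (charge t) \<and>
     charge t [] = 0 \<and> card {v \<in> tree_verts t. black v} = n}"

definition finite_trees :: "nat \<Rightarrow> btree set" where
  "finite_trees d = (\<Union>n\<in>{1..}. finite_trees_of_size d n)"

definition trees_completion :: "nat \<Rightarrow> btree set" where
  "trees_completion d = closure (finite_trees d)"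

definition is_spine :: "btree \<Rightarrow> (nat \<Rightarrow> nat list) \<Rightarrow> bool" where
  "is_spine t p \<longleftrightarrow> p 0 = [] \<and> inj p \<and> (\<forall>n. p n \<in> tree_verts t) \<and>
     (\<forall>n. p (Suc n) \<in> children t (p n) \<or> p n \<in> children t (p (Suc n)))"

definition single_spine :: "btree \<Rightarrow> bool" where
  "single_spine t \<longleftrightarrow> (\<exists>!p. is_spine t p)"

definition is_charge_function :: "btree \<Rightarrow> (nat list \<Rightarrow> int) \<Rightarrow> bool" where
  "is_charge_function t c \<longleftrightarrow> c [] = 0 \<and>
     (\<forall>v\<in>tree_verts t. c v = int (card {h \<in> closing_stems t. half_vertex h = v})
                          - int (card {h \<in> opening_stems t. half_vertex h = v})
                          + (\<Sum>w\<in>children t v. c w))"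

text \<open>On the vertices of a tree with a single spine, there is exactly one charge function.\<close>

definition well_charged_infinite :: "btree \<Rightarrow> bool" where
  "well_charged_infinite t \<longleftrightarrow> (\<exists>c. is_charge_function t c \<and> charge_bounds t c)"


section \<open>Contour walk and closure\<close>

primrec tree_rot :: "btree \<Rightarrow> half \<Rightarrow> half" where
  "tree_rot t (Up v) = (if slots_at t v = [] then Up v else Slot v 0)"
| "tree_rot t (Slot v i) = (if Suc i < length (slots_at t v) then Slot v (Suc i)
                            else if v = [] then Slot [] 0 else Up v)"

primrec tree_opp :: "half \<Rightarrow> half" where
  "tree_opp (Up v) = Slot (butlast v) (last v)"
| "tree_opp (Slot v i) = Up (v @ [i])"

text \<open>The sequences of half-edges met when walking around the tree from the root corner, to the right
  and to the left; an edge met from one end is followed to its other end.\<close>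

primrec right_walk :: "btree \<Rightarrow> nat \<Rightarrow> half" where
  "right_walk t 0 = Slot [] 0"
| "right_walk t (Suc n) =
     tree_rot t (if right_walk t n \<in> stems t then right_walk t n else tree_opp (right_walk t n))"

definition tree_rot_inv :: "btree \<Rightarrow> half \<Rightarrow> half" where
  "tree_rot_inv t = inv_into (tree_halves t) (tree_rot t)"

primrec left_walk :: "btree \<Rightarrow> nat \<Rightarrow> half" where
  "left_walk t 0 = tree_rot_inv t (Slot [] 0)"
| "left_walk t (Suc n) =
     tree_rot_inv t (if left_walk t n \<in> stems t then left_walk t n else tree_opp (left_walk t n))"

definition right_times :: "btree \<Rightarrow> nat set" where
  "right_times t = {n. right_walk t n \<in> stems t}"

definition left_times :: "btree \<Rightarrow> nat set" where
  "left_times t = {n. left_walk t n \<in> stems t}"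

definition stem_at :: "btree \<Rightarrow> int \<Rightarrow> half" where
  "stem_at t k = (if 0 \<le> k then right_walk t (Infinite_Set.enumerate (right_times t) (nat k))
                  else left_walk t (Infinite_Set.enumerate (left_times t) (nat (- k - 1))))"

definition closing_at :: "btree \<Rightarrow> int \<Rightarrow> bool" where
  "closing_at t k \<longleftrightarrow> stem_at t k \<in> closing_stems t"

definition opening_at :: "btree \<Rightarrow> int \<Rightarrow> bool" where
  "opening_at t k \<longleftrightarrow> stem_at t k \<in> opening_stems t"

definition contour :: "btree \<Rightarrow> int \<Rightarrow> int" where
  "contour t k = (\<Sum>j\<in>{0..<k}. if closing_at t j then - 1 else 1)
               - (\<Sum>j\<in>{k..<0}. if closing_at t j then - 1 else 1)"

definition partners :: "btree \<Rightarrow> int \<Rightarrow> int set" where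
  "partners t k = (if opening_at t k then {j. j < k \<and> closing_at t j \<and> contour t j = contour t k + 1}
                   else {j. k < j \<and> opening_at t j \<and> contour t j = contour t k - 1})"

definition stem_matching :: "btree \<Rightarrow> int \<Rightarrow> int" where
  "stem_matching t k = (if opening_at t k then Sup (partners t k) else Inf (partners t k))"

text \<open>The contour word is infinite on both sides, and the supremum or infimum defining the partner of
  each stem is that of a nonempty set.\<close>

definition has_matching :: "btree \<Rightarrow> bool" where
  "has_matching t \<longleftrightarrow> infinite (right_times t) \<and> infinite (left_times t) \<and> (\<forall>k. partners t k \<noteq> {})"

definition closure_map :: "btree \<Rightarrow> (nat list, half) cmap" where
  "closure_map t = \<lparr>verts = tree_verts t, halves = tree_halves t, org = half_vertex, rot = tree_rot t,
     opp = (\<lambda>h. if h \<in> stems t then stem_at t (stem_matching t (THE k. stem_at t k = h)) else tree_opp h),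
     is_black = black, root_vertex = [], root_half = Some (Slot [] 0)\<rparr>"

definition tree_closure :: "btree \<Rightarrow> rmap" where
  "tree_closure t = abs_rmap (closure_map t)"


section \<open>The limit law\<close>

definition weak_limit_on :: "'a::topological_space set \<Rightarrow> (nat \<Rightarrow> 'a pmf) \<Rightarrow> 'a measure \<Rightarrow> bool" where
  "weak_limit_on X \<mu> P \<longleftrightarrow>
     (\<forall>f :: 'a \<Rightarrow> real. continuous_on X f \<and> bounded (f ` X) \<longrightarrow>
        (\<lambda>n. measure_pmf.expectation (\<mu> n) f) \<longlonglongrightarrow> (\<integral>x. f x \<partial>P))"

definition uniform_tree :: "nat \<Rightarrow> nat \<Rightarrow> btree pmf" where
  "uniform_tree d n = pmf_of_set (finite_trees_of_size d n)"

definition is_limit_law :: "nat \<Rightarrow> btree measure \<Rightarrow> bool" where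
  "is_limit_law d P \<longleftrightarrow> prob_space P \<and> sets P = sets (restrict_space borel (trees_completion d)) \<and>
     weak_limit_on (trees_completion d) (uniform_tree d) P"

definition topological_support :: "'a::topological_space measure \<Rightarrow> 'a set" where
  "topological_support P = {x \<in> space P. \<forall>U. open U \<and> x \<in> U \<longrightarrow> 0 < emeasure P (U \<inter> space P)}"

text \<open>The topological support of the limit law also contains trees with several spines, and trees with
  a single spine whose stems cannot be perfectly matched. The set below keeps the trees that have all
  the properties needed to define their closure.\<close>

definition limit_support :: "nat \<Rightarrow> btree measure \<Rightarrow> btree set" where
  "limit_support d P = {t \<in> topological_support P.
     regular_tree d t \<and> single_spine t \<and> well_charged_infinite t \<and> has_matching t}"

end

theory Submission
  imports Defs
begin

text \<open>Write \<open>walk t\<close> for the bi-infinite contour of a tree \<open>t\<close>, indexed by all integers and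
  obtained by iterating "cross the edge, then turn". In this parametrization a closing stem at time \<open>n\<close>
  and an opening stem at a later time \<open>m\<close> are merged iff the height walk stays strictly below its
  value at \<open>n\<close> until just after \<open>m\<close>. This condition makes sense for finite trees of charge 0 too, whose contour
  is periodic, and it depends only on a bounded part of the contour, hence on a ball of the tree: on
  the trees whose stems are all visited and matched, finite or not, the closure is therefore
  continuous. The support of the limit law lies in the closure of the set of finite trees, so it
  remains to see that finite trees have planar closures: a noncrossing matching of \<open>2 k\<close> stems
  around a cycle produces \<open>k + 1\<close> faces, because each new pair splits a face.\<close>

section \<open>Half-edges and the contour of a tree\<close>

text \<open>The closure as defined on infinite trees does not carry over verbatim to finite ones: on
  a periodic contour each stem has infinitely many indices, so \<open>THE k. stem_at t k = h\<close>
  has no unique solution. Yet the finite trees must lie in the same domain as their limits for the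
  completion to be reached by approximation. Merging is therefore recast as a relation between
  half-edges that forgets when they are visited.

  The second obstacle is that a ball of the closure is not controlled by a ball of the tree of a
  radius fixed in advance, since a merged edge may join vertices that are far apart in the tree. The
  neighbourhood is chosen after the tree: a ball of its closure has finitely many half-edges, and
  each of them is settled by a finite stretch of the contour.

  The single spine ensures that the contour, which has to explore an infinite tree from both sides,
  misses no half-edge.\<close>

lemma subtree_append: "subtree (v @ w) t = Option.bind (subtree v t) (subtree w)"
  by (induction v arbitrary: t) (auto split: bind_split)

lemma root_in_tree_verts [simp]: "[] \<in> tree_verts t"
  by (simp add: tree_verts_def)

lemma snoc_in_tree_verts:
  "v @ [i] \<in> tree_verts t \<longleftrightarrow>
     v \<in> tree_verts t \<and> i < length (slots_at t v) \<and> slots_at t v ! i \<noteq> None"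
  by (cases "subtree v t") (auto simp: tree_verts_def slots_at_def subtree_append split: bind_split)

lemma prefix_in_tree_verts: "v @ w \<in> tree_verts t \<Longrightarrow> v \<in> tree_verts t"
  by (cases "subtree v t") (auto simp: tree_verts_def subtree_append)

lemma in_tree_halves [simp]:
  "Up v \<in> tree_halves t \<longleftrightarrow> v \<in> tree_verts t \<and> v \<noteq> []"
  "Slot v i \<in> tree_halves t \<longleftrightarrow> v \<in> tree_verts t \<and> i < length (slots_at t v)"
  by (auto simp: tree_halves_def)

lemma in_stems [simp]:
  "Up v \<notin> stems t"
  "Slot v i \<in> stems t \<longleftrightarrow> v \<in> tree_verts t \<and> i < length (slots_at t v) \<and> slots_at t v ! i = None"
  by (auto simp: stems_def)

lemma stems_subset: "stems t \<subseteq> tree_halves t"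
  by (auto simp: stems_def)

lemma half_vertex_in_tree_verts: "h \<in> tree_halves t \<Longrightarrow> half_vertex h \<in> tree_verts t"
  by (cases h) auto

text \<open>Stems are made fixed points, which gives an involution of all half-edges: the contour
  goes around a stem by simply turning past it.\<close>

definition edge_opp :: "btree \<Rightarrow> half \<Rightarrow> half" where
  "edge_opp t h = (if h \<in> stems t then h else tree_opp h)"

lemma tree_opp_tree_opp:
  assumes "h \<in> tree_halves t" "h \<notin> stems t"
  shows "tree_opp h \<in> tree_halves t" "tree_opp h \<notin> stems t" "tree_opp (tree_opp h) = h" "tree_opp h \<noteq> h"
proof -
  have "tree_opp h \<in> tree_halves t \<and> tree_opp h \<notin> stems t \<and> tree_opp (tree_opp h) = h \<and> tree_opp h \<noteq> h"
  proof (cases h)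
    case (Up v)
    then obtain u i where "v = u @ [i]" using assms by (cases v rule: rev_cases) auto
    then show ?thesis using assms Up snoc_in_tree_verts[of u i t] by auto
  next
    case (Slot v i)
    then show ?thesis using assms snoc_in_tree_verts[of v i t] by auto
  qed
  then show "tree_opp h \<in> tree_halves t" "tree_opp h \<notin> stems t" "tree_opp (tree_opp h) = h" "tree_opp h \<noteq> h"
    by auto
qed

lemma edge_opp:
  assumes "h \<in> tree_halves t"
  shows "edge_opp t h \<in> tree_halves t" "edge_opp t (edge_opp t h) = h"
    "edge_opp t h \<in> stems t \<longleftrightarrow> h \<in> stems t"
  using assms tree_opp_tree_opp[OF assms] by (auto simp: edge_opp_def)

lemma tree_rot:
  assumes "h \<in> tree_halves t"
  shows "tree_rot t h \<in> tree_halves t" "half_vertex (tree_rot t h) = half_vertex h"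
  using assms by (cases h; auto)+

lemma inj_on_tree_rot: "inj_on (tree_rot t) (tree_halves t)"
proof (rule inj_onI)
  fix x y assume a: "x \<in> tree_halves t" "y \<in> tree_halves t" "tree_rot t x = tree_rot t y"
  have "half_vertex x = half_vertex y" using tree_rot(2)[OF a(1)] tree_rot(2)[OF a(2)] a(3) by simp
  then show "x = y" using a by (cases x; cases y) (auto split: if_splits)
qed

lemma cyclic_on_tree_rot:
  assumes v: "v \<in> tree_verts t" and ne: "{h \<in> tree_halves t. half_vertex h = v} \<noteq> {}"
  shows "cyclic_on (tree_rot t) {h \<in> tree_halves t. half_vertex h = v}" (is "cyclic_on ?r ?S")
proof -
  define n where "n = length (slots_at t v)"
  \<comment> \<open>The half-edge just before slot 0 in the cyclic order, so that the orbit runs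
    through the slots without wrapping around. At the root, \<open>n - 1\<close> is a genuine index
    by \<open>n0\<close>.\<close>
  define s where "s = (if v = [] then Slot v (n - 1) else Up v)"
  have n0: "0 < n" if "v = []"
  proof -
    obtain h where "h \<in> ?S" using ne by auto
    then show ?thesis using that by (cases h) (auto simp: n_def)
  qed
  have sS: "s \<in> ?S" using v n0 by (auto simp: s_def n_def)
  have "orbit ?r s \<subseteq> ?S"
  proof
    fix x assume "x \<in> orbit ?r s"
    then show "x \<in> ?S" by induction (use sS tree_rot[of _ t] in auto)
  qed
  moreover have slot: "Slot v i \<in> orbit ?r s" if "i < n" for i
    using that
  proof (induction i)
    case 0
    then have "?r s = Slot v 0" using v by (auto simp: s_def n_def)
    then show ?case using orbit.base[of ?r s] by simp
  next
    case (Suc i)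
    then have "?r (Slot v i) = Slot v (Suc i)" by (simp add: n_def)
    then show ?case using orbit.step[of "Slot v i" ?r s] Suc by simp
  qed
  moreover have "Up v \<in> orbit ?r s" if "v \<noteq> []"
  proof (cases n)
    case 0
    then have "?r s = Up v" using that by (simp add: s_def n_def)
    then show ?thesis using orbit.base[of ?r s] by simp
  next
    case (Suc m)
    then have "?r (Slot v m) = Up v" using that by (simp add: n_def)
    then show ?thesis using orbit.step[OF slot[of m]] Suc by simp
  qed
  ultimately have "?S = orbit ?r s"
  proof (intro equalityI)
    show "?S \<subseteq> orbit ?r s" 
    proof
      fix x assume "x \<in> ?S"
      then show "x \<in> orbit ?r s" 
        using slot \<open>v \<noteq> [] \<Longrightarrow> Up v \<in> orbit ?r s\<close> by (cases x) (auto simp: n_def)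
    qed
  qed
  then show ?thesis unfolding cyclic_on_def using sS by blast
qed

lemma finite_halves_at_tree: "finite {h \<in> tree_halves t. half_vertex h = v}"
proof (rule finite_subset)
  show "{h \<in> tree_halves t. half_vertex h = v} \<subseteq> insert (Up v) (Slot v ` {..<length (slots_at t v)})"
  proof
    fix h assume "h \<in> {h \<in> tree_halves t. half_vertex h = v}"
    then show "h \<in> insert (Up v) (Slot v ` {..<length (slots_at t v)})" by (cases h) auto
  qed
qed simp

text \<open>The tree may be infinite, so injectivity does not suffice. Each half-edge lies in its
  own orbit around its vertex and thus has a predecessor. This makes \<open>tree_rot_inv\<close> a
  two-sided inverse.\<close>

lemma tree_rot_image: "tree_rot t ` tree_halves t = tree_halves t"
proof
  show "tree_rot t ` tree_halves t \<subseteq> tree_halves t" using tree_rot by blast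
  show "tree_halves t \<subseteq> tree_rot t ` tree_halves t"
  proof
    fix h assume h: "h \<in> tree_halves t"
    let ?S = "{k \<in> tree_halves t. half_vertex k = half_vertex h}"
    have "cyclic_on (tree_rot t) ?S"
      using h by (intro cyclic_on_tree_rot half_vertex_in_tree_verts) auto
    then have "h \<in> orbit (tree_rot t) h" "orbit (tree_rot t) h \<subseteq> tree_halves t"
      using h orbit_cyclic_eq3[of "tree_rot t" ?S h] by auto
    then show "h \<in> tree_rot t ` tree_halves t" using h orbit.cases[of h "tree_rot t" h] by blast
  qed
qed

lemma tree_rot_inv:
  assumes "h \<in> tree_halves t"
  shows "tree_rot_inv t h \<in> tree_halves t" "tree_rot t (tree_rot_inv t h) = h"
  using assms inv_into_into[of h "tree_rot t" "tree_halves t"] f_inv_into_f[of h "tree_rot t" "tree_halves t"]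
  by (simp_all add: tree_rot_inv_def tree_rot_image)

lemma tree_rot_inv_tree_rot: "h \<in> tree_halves t \<Longrightarrow> tree_rot_inv t (tree_rot t h) = h"
  by (simp add: tree_rot_inv_def inv_into_f_f[OF inj_on_tree_rot])

text \<open>The face permutation \<open>rot o opp\<close> of the tree in which every stem is its own
  opposite.\<close>

definition contour_step :: "btree \<Rightarrow> half \<Rightarrow> half" where
  "contour_step t h = tree_rot t (edge_opp t h)"

lemma contour_step_in: "h \<in> tree_halves t \<Longrightarrow> contour_step t h \<in> tree_halves t"
  by (simp add: contour_step_def edge_opp tree_rot)

lemma inj_on_contour_step: "inj_on (contour_step t) (tree_halves t)"
  unfolding contour_step_def
  by (rule inj_onI) (metis edge_opp(1,2) inj_on_tree_rot inj_onD)

text \<open>The left walk reaches each edge from the end at which the forward contour arrives after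
  crossing it. Taking \<open>edge_opp\<close> at negative times restores the forward convention, so
  that one step rule holds on all integers.\<close>

definition walk :: "btree \<Rightarrow> int \<Rightarrow> half" where
  "walk t n = (if 0 \<le> n then right_walk t (nat n) else edge_opp t (left_walk t (nat (- n - 1))))"

lemma walk_0 [simp]: "walk t 0 = Slot [] 0"
  by (simp add: walk_def)

lemma int_bi_induct [case_names zero up down]:
  fixes n :: int
  assumes "P 0" "\<And>n. 0 \<le> n \<Longrightarrow> P n \<Longrightarrow> P (n + 1)" "\<And>n. n \<le> 0 \<Longrightarrow> P n \<Longrightarrow> P (n - 1)"
  shows "P n"
  using int_induct[of P 0 n] assms by blast

context
  fixes t :: btree
  assumes root: "slots t \<noteq> []"
begin

lemma root_slot: "Slot [] 0 \<in> tree_halves t"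
  using root by (simp add: slots_at_def)

lemma right_walk_in: "right_walk t n \<in> tree_halves t"
  by (induction n) (use root_slot contour_step_in in \<open>auto simp: contour_step_def edge_opp_def\<close>)

lemma left_walk_in: "left_walk t n \<in> tree_halves t"
  by (induction n)
    (use root_slot tree_rot_inv(1) edge_opp(1) in \<open>auto simp: edge_opp_def split: if_splits\<close>)

lemma walk_in: "walk t n \<in> tree_halves t"
  by (simp add: walk_def right_walk_in left_walk_in edge_opp)

lemma walk_Suc: "walk t (n + 1) = contour_step t (walk t n)"
proof -
  consider "0 \<le> n" | "n = -1" | "n < -1" by linarith
  then show ?thesis
  proof cases
    case 1
    then have "nat (n + 1) = Suc (nat n)" by simp
    then show ?thesis using 1 by (simp add: walk_def contour_step_def edge_opp_def)
  next
    case 2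
    have "edge_opp t (edge_opp t (left_walk t 0)) = left_walk t 0"
      by (rule edge_opp(2)[OF left_walk_in])
    then have "contour_step t (walk t (- 1)) = tree_rot t (left_walk t 0)"
      by (simp add: walk_def contour_step_def del: left_walk.simps)
    then show ?thesis using 2 tree_rot_inv(2)[OF root_slot] by simp
  next
    case 3
    define k where "k = nat (- n - 2)"
    have k: "nat (- n - 1) = Suc k" "nat (- (n + 1) - 1) = k" using 3 by (auto simp: k_def)
    have "left_walk t (Suc k) = tree_rot_inv t (edge_opp t (left_walk t k))"
      by (simp add: edge_opp_def)
    then show ?thesis using 3 k left_walk_in
      by (simp add: walk_def contour_step_def edge_opp tree_rot_inv del: left_walk.simps)
  qed
qed

text \<open>The walk iterates a step that is injective on half-edges, so a coincidence propagates
  backwards as well as forwards.\<close>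

lemma walk_shift:
  assumes "walk t n = walk t m"
  shows "walk t (n + i) = walk t (m + i)"
proof (induction i rule: int_bi_induct)
  case zero
  then show ?case using assms by simp
next
  case (up i)
  then show ?case using walk_Suc[of "n + i"] walk_Suc[of "m + i"] by (simp add: add.assoc)
next
  case (down i)
  have "contour_step t (walk t (n + (i - 1))) = contour_step t (walk t (m + (i - 1)))"
    using walk_Suc[of "n + (i - 1)"] walk_Suc[of "m + (i - 1)"] down by (simp add: algebra_simps)
  then show ?case by (rule inj_onD[OF inj_on_contour_step _ walk_in walk_in])
qed

end

section \<open>Matching of the stems\<close>

definition walk_sum :: "(int \<Rightarrow> int) \<Rightarrow> int \<Rightarrow> int" where
  "walk_sum s k = (\<Sum>j\<in>{0..<k}. s j) - (\<Sum>j\<in>{k..<0}. s j)"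

lemma walk_sum_0 [simp]: "walk_sum s 0 = 0"
  by (simp add: walk_sum_def)

lemma walk_sum_Suc: "walk_sum s (k + 1) = walk_sum s k + s k"
proof (cases "0 \<le> k")
  case True
  then have "{0..<k + 1} = insert k {0..<k}" by auto
  then show ?thesis using True by (simp add: walk_sum_def)
next
  case False
  then have "{k..<0} = insert k {k + 1..<0}" by auto
  then show ?thesis using False by (simp add: walk_sum_def)
qed

lemma walk_sum_cong:
  assumes "\<And>j. \<bar>j\<bar> \<le> \<bar>k\<bar> \<Longrightarrow> s j = s' j"
  shows "walk_sum s k = walk_sum s' k"
  unfolding walk_sum_def by (intro arg_cong2[of _ _ _ _ "(-)"] sum.cong) (use assms in auto)

text \<open>Tree edges count 0, so that the height at walk times reproduces the contour walk of
  stems once the edges are skipped.\<close>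

definition stem_step :: "btree \<Rightarrow> half \<Rightarrow> int" where
  "stem_step t h = (if h \<in> closing_stems t then - 1 else if h \<in> opening_stems t then 1 else 0)"

definition contour_height :: "btree \<Rightarrow> int \<Rightarrow> int" where
  "contour_height t = walk_sum (\<lambda>n. stem_step t (walk t n))"

lemma contour_height_0 [simp]: "contour_height t 0 = 0"
  by (simp add: contour_height_def)

lemma contour_height_Suc: "contour_height t (n + 1) = contour_height t n + stem_step t (walk t n)"
  by (simp add: contour_height_def walk_sum_Suc)

lemma stems_cases: "h \<in> stems t \<longleftrightarrow> h \<in> closing_stems t \<or> h \<in> opening_stems t"
  by (auto simp: closing_stems_def opening_stems_def)

lemma closing_opening_disjoint: "h \<in> closing_stems t \<Longrightarrow> h \<notin> opening_stems t"
  by (auto simp: closing_stems_def opening_stems_def)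

lemma stem_step_simps [simp]:
  "h \<in> closing_stems t \<Longrightarrow> stem_step t h = - 1"
  "h \<in> opening_stems t \<Longrightarrow> stem_step t h = 1"
  "h \<notin> stems t \<Longrightarrow> stem_step t h = 0"
  using closing_opening_disjoint[of h t] stems_cases[of h t] by (auto simp: stem_step_def)

text \<open>Heights are taken before the step made at the same time: the closing step at
  \<open>n\<close> leads down to the level of \<open>m\<close>, and the opening step at
  \<open>m\<close> climbs back to the level of \<open>n\<close>. A height bound in between replaces
  the \<open>Sup\<close> and \<open>Inf\<close> of the original matching, which treats both ends
  alike.\<close>

definition matched :: "btree \<Rightarrow> int \<Rightarrow> int \<Rightarrow> bool" where
  "matched t n m \<longleftrightarrow> n < m \<and> walk t n \<in> closing_stems t \<and> walk t m \<in> opening_stems t \<and>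
     contour_height t n = contour_height t m + 1 \<and> (\<forall>i\<in>{n<..m}. contour_height t i \<le> contour_height t m)"

lemma matchedD:
  assumes "matched t n m"
  shows "n < m" "walk t n \<in> closing_stems t" "walk t m \<in> opening_stems t"
    "contour_height t n = contour_height t m + 1" "n < i \<Longrightarrow> i \<le> m \<Longrightarrow> contour_height t i \<le> contour_height t m"
    "contour_height t (m + 1) = contour_height t m + 1"
  using assms contour_height_Suc[of t m] by (auto simp: matched_def)

text \<open>Just after the earlier candidate the height is back at its level at \<open>n\<close>,
  above the bound that the later candidate imposes there.\<close>

lemma matched_unique_right:
  assumes "matched t n m" "matched t n m'"
  shows "m = m'"
proof -
  have "\<not> a < b" if a: "matched t n a" and b: "matched t n b" for a b
  proof
    assume "a < b"
    then show False using matchedD(1,4,6)[OF a] matchedD(4)[OF b] matchedD(5)[OF b, of "a + 1"] by simp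
  qed
  then show ?thesis using assms by (meson linorder_neqE)
qed

text \<open>The later start lies inside the longer pair, one unit above the bound valid
  there.\<close>

lemma matched_unique_left:
  assumes "matched t n m" "matched t n' m"
  shows "n = n'"
proof -
  have "\<not> a < b" if a: "matched t a m" and b: "matched t b m" for a b
  proof
    assume "a < b"
    then show False using matchedD(5)[OF a, of b] matchedD(1,4)[OF b] by simp
  qed
  then show ?thesis using assms by (meson linorder_neqE)
qed

text \<open>If \<open>d\<close> came after \<open>b\<close>, the climb at \<open>b\<close> would
  happen inside the pair \<open>(c, d)\<close> and lead above the level of \<open>c\<close>, where
  that pair forbids it.\<close>

lemma matched_noncrossing:
  assumes "matched t a b" "matched t c d" "a < c" "c < b"
  shows "d \<le> b"
proof (rule ccontr)
  assume "\<not> d \<le> b"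
  then show False
    using matchedD(5)[OF assms(1), of c] matchedD(4)[OF assms(2)] matchedD(6)[OF assms(1)]
      matchedD(5)[OF assms(2), of "b + 1"] assms(3,4) by simp
qed

text \<open>Quantifying over the times removes the dependence on the visit: the contour of a finite
  tree meets each half-edge infinitely often.\<close>

definition mates :: "btree \<Rightarrow> half \<Rightarrow> half \<Rightarrow> bool" where
  "mates t h h' \<longleftrightarrow> (\<exists>n m. walk t n = h \<and> walk t m = h' \<and> (matched t n m \<or> matched t m n))"

lemma mates_sym: "mates t h h' \<Longrightarrow> mates t h' h"
  by (auto simp: mates_def)

lemma mates_stems:
  assumes "mates t h h'"
  shows "h \<in> stems t" "h' \<in> stems t" "h \<in> closing_stems t \<longleftrightarrow> h' \<in> opening_stems t" "h \<noteq> h'"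
proof -
  have "h \<in> closing_stems t \<and> h' \<in> opening_stems t \<or> h \<in> opening_stems t \<and> h' \<in> closing_stems t"
    using assms matchedD(2,3) unfolding mates_def by blast
  then show "h \<in> stems t" "h' \<in> stems t" "h \<in> closing_stems t \<longleftrightarrow> h' \<in> opening_stems t" "h \<noteq> h'"
    using closing_opening_disjoint[of h t] closing_opening_disjoint[of h' t]
      stems_cases[of h t] stems_cases[of h' t] by auto
qed

definition stem_mate :: "btree \<Rightarrow> half \<Rightarrow> half" where
  "stem_mate t h = (THE h'. mates t h h')"

text \<open>The same map as \<open>closure_map\<close>, except that stems are paired without
  reference to their indices.\<close>

definition glued_map :: "btree \<Rightarrow> (nat list, half) cmap" where
  "glued_map t = closure_map t\<lparr>opp := \<lambda>h. if h \<in> stems t then stem_mate t h else tree_opp h\<rparr>"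

lemma glued_map_simps [simp]:
  "verts (glued_map t) = tree_verts t"
  "halves (glued_map t) = tree_halves t"
  "org (glued_map t) = half_vertex"
  "rot (glued_map t) = tree_rot t"
  "opp (glued_map t) h = (if h \<in> stems t then stem_mate t h else tree_opp h)"
  "is_black (glued_map t) = black"
  "root_vertex (glued_map t) = []"
  "root_half (glued_map t) = Some (Slot [] 0)"
  by (simp_all add: glued_map_def closure_map_def)

text \<open>This covers finite trees, whose contour is periodic, as well as infinite ones.\<close>

definition closable :: "btree \<Rightarrow> bool" where
  "closable t \<longleftrightarrow> slots t \<noteq> [] \<and> tree_halves t \<subseteq> range (walk t) \<and>
     (\<forall>n. walk t n \<in> stems t \<longrightarrow> (\<exists>m. matched t n m \<or> matched t m n)) \<and>
     (\<forall>n m. walk t n = walk t m \<longrightarrow> contour_height t n = contour_height t m)"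

section \<open>The glued map of a closable tree\<close>

context
  fixes t :: btree
  assumes t: "closable t"
begin

lemma closable_root: "slots t \<noteq> []"
  using t by (simp add: closable_def)

lemma closable_shift:
  assumes "walk t n = walk t m"
  shows "walk t (n + i) = walk t (m + i)" "contour_height t (n + i) = contour_height t (m + i)"
proof -
  show "walk t (n + i) = walk t (m + i)" using walk_shift[OF closable_root assms] .
  then show "contour_height t (n + i) = contour_height t (m + i)" using t unfolding closable_def by blast
qed

text \<open>Where the walk repeats, the heights repeat too, so pairs can be translated. The two
  offsets allow either end of the pair to be the coinciding time.\<close>

lemma matched_shift:
  assumes "walk t n = walk t m" "matched t (n + i) (n + j)"
  shows "matched t (m + i) (m + j)"
proof -
  note S = closable_shift[OF assms(1)] and D = matchedD[OF assms(2)]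
  have "contour_height t k \<le> contour_height t (m + j)" if "k \<in> {m + i<..m + j}" for k
    using D(5)[of "n + (k - m)"] S(2)[of "k - m"] S(2)[of j] that by simp
  then show ?thesis
    using D(1-4) S[of i] S[of j] by (simp add: matched_def)
qed

lemma mates_unique:
  assumes "mates t h h1" "mates t h h2"
  shows "h1 = h2"
proof -
  obtain n1 m1 where 1: "walk t n1 = h" "walk t m1 = h1" "matched t n1 m1 \<or> matched t m1 n1"
    using assms(1) by (auto simp: mates_def)
  obtain n2 m2 where 2: "walk t n2 = h" "walk t m2 = h2" "matched t n2 m2 \<or> matched t m2 n2"
    using assms(2) by (auto simp: mates_def)
  have w: "walk t n1 = walk t n2" using 1 2 by simp
  \<comment> \<open>The partner in the first pair, after translating that pair so that its end at
    \<open>n1\<close> comes to \<open>n2\<close>. Both pairs then have the same direction at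
    \<open>n2\<close>, since a stem is not both closing and opening.\<close>
  let ?m = "n2 + (m1 - n1)"
  have "matched t n2 ?m \<or> matched t ?m n2"
    using 1(3) matched_shift[OF w, of 0 "m1 - n1"] matched_shift[OF w, of "m1 - n1" 0] by auto
  moreover have "\<not> (matched t n2 k \<and> matched t l n2)" for k l
    using matchedD(2)[of t n2 k] matchedD(3)[of t l n2] closing_opening_disjoint by blast
  ultimately have "?m = m2"
    using 2(3) matched_unique_left[of t _ n2] matched_unique_right[of t n2] by blast
  then show ?thesis using closable_shift(1)[OF w, of "m1 - n1"] 1 2 by simp
qed

lemma mates_stem_mate:
  assumes "h \<in> stems t"
  shows "mates t h (stem_mate t h)"
proof -
  obtain n where n: "walk t n = h" using t assms stems_subset[of t] unfolding closable_def by blast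
  then obtain m where "matched t n m \<or> matched t m n" using t assms unfolding closable_def by blast
  then have "mates t h (walk t m)" using n by (auto simp: mates_def)
  then show ?thesis unfolding stem_mate_def by (rule theI) (rule mates_unique[OF _ \<open>mates t h (walk t m)\<close>])
qed

lemma stem_mate_eq: "mates t h h' \<Longrightarrow> stem_mate t h = h'"
  using mates_stem_mate mates_unique mates_stems(1) by blast

lemma stem_mate:
  assumes "h \<in> stems t"
  shows "stem_mate t h \<in> stems t" "stem_mate t (stem_mate t h) = h" "stem_mate t h \<noteq> h"
proof -
  note m = mates_stem_mate[OF assms]
  show "stem_mate t h \<in> stems t" "stem_mate t h \<noteq> h" using mates_stems[OF m] by auto
  show "stem_mate t (stem_mate t h) = h" by (rule stem_mate_eq[OF mates_sym[OF m]])
qed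

lemma glued_map_root_path:
  assumes "v \<in> tree_verts t"
  shows "([], v) \<in> (adj (glued_map t))\<^sup>*"
  using assms
proof (induction v rule: rev_induct)
  case (snoc i v)
  then have v: "v \<in> tree_verts t" "Slot v i \<in> tree_halves t" "Slot v i \<notin> stems t"
    by (auto simp: snoc_in_tree_verts)
  have "(v, v @ [i]) = (org (glued_map t) (Slot v i), org (glued_map t) (opp (glued_map t) (Slot v i)))"
    using v(3) by (simp del: in_stems)
  moreover have "Slot v i \<in> halves (glued_map t)" using v(2) by simp
  ultimately have "(v, v @ [i]) \<in> adj (glued_map t)" unfolding adj_def by blast
  with snoc.IH[OF v(1)] show ?case by (rule rtrancl_into_rtrancl)
qed simp

lemma rooted_map_glued_map: "rooted_map (glued_map t)"
  unfolding rooted_map_def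
proof (intro conjI ballI)
  fix h assume "h \<in> halves (glued_map t)"
  then have h: "h \<in> tree_halves t" by simp
  show "org (glued_map t) h \<in> verts (glued_map t)" using half_vertex_in_tree_verts[OF h] by simp
  show "opp (glued_map t) h \<in> halves (glued_map t)" "opp (glued_map t) h \<noteq> h"
    "opp (glued_map t) (opp (glued_map t) h) = h"
  proof (atomize(full), cases "h \<in> stems t")
    case True
    then show "opp (glued_map t) h \<in> halves (glued_map t) \<and> opp (glued_map t) h \<noteq> h \<and>
        opp (glued_map t) (opp (glued_map t) h) = h"
      using stem_mate[OF True] stems_subset[of t] by auto
  next
    case False
    then show "opp (glued_map t) h \<in> halves (glued_map t) \<and> opp (glued_map t) h \<noteq> h \<and>
        opp (glued_map t) (opp (glued_map t) h) = h"
      using tree_opp_tree_opp[OF h False] by simp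
  qed
next
  fix v assume "v \<in> verts (glued_map t)"
  then show "halves_at (glued_map t) v = {} \<or> cyclic_on (rot (glued_map t)) (halves_at (glued_map t) v)"
    using cyclic_on_tree_rot[of v t] unfolding halves_at_def glued_map_simps by blast
  show "(root_vertex (glued_map t), v) \<in> (adj (glued_map t))\<^sup>*"
    using glued_map_root_path \<open>v \<in> verts (glued_map t)\<close> by simp
next
  show "case root_half (glued_map t) of None \<Rightarrow> halves_at (glued_map t) (root_vertex (glued_map t)) = {}
      | Some h \<Rightarrow> h \<in> halves_at (glued_map t) (root_vertex (glued_map t))"
    using root_slot[OF closable_root] by (simp add: halves_at_def del: in_tree_halves)
qed simp

text \<open>A merged edge joins a closing stem, at a white vertex, to an opening stem, at a black
  one; a tree edge changes the parity of the depth.\<close>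

lemma proper_coloring_glued_map: "proper_coloring (glued_map t)"
  unfolding proper_coloring_def
proof
  fix h assume "h \<in> halves (glued_map t)"
  then have h: "h \<in> tree_halves t" by simp
  show "is_black (glued_map t) (org (glued_map t) (opp (glued_map t) h)) \<longleftrightarrow>
      \<not> is_black (glued_map t) (org (glued_map t) h)"
  proof (cases "h \<in> stems t")
    case True
    then show ?thesis using mates_stems[OF mates_stem_mate[OF True]]
      by (auto simp: closing_stems_def opening_stems_def)
  next
    case False
    then show ?thesis using h by (cases h) (simp_all del: in_stems)
  qed
qed

lemma regular_glued_map: "regular_tree d t \<Longrightarrow> regular_map d (glued_map t)"
  by (simp add: regular_map_def regular_tree_def halves_at_def)

end

section \<open>Locality of the closure\<close>

lemma eventually_tree_ball: "eventually (\<lambda>t'. tree_ball R t' = tree_ball R t) (nhds t)"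
proof -
  have "dist t' t < inverse (2 + real R) \<Longrightarrow> tree_ball R t' = tree_ball R t" for t'
    using dloc_le_iff[of tree_ball t' t R, OF tree_ball_Suc_eqD] tree_ball_Suc_eqD[of R t' t]
    by (simp add: dist_btree_def)
  moreover have "0 < inverse (2 + real R)" by simp
  ultimately show ?thesis unfolding eventually_nhds_metric by blast
qed

lemma tendsto_rmap:
  assumes "\<And>R. eventually (\<lambda>x. map_ball R (f x) = map_ball R l) F"
  shows "(f \<longlongrightarrow> l) F"
proof (rule tendstoI)
  fix e :: real assume "0 < e"
  then obtain R where R: "inverse (real (Suc R)) < e" using reals_Archimedean by blast
  have "dist (f x) l < e" if "map_ball (Suc R) (f x) = map_ball (Suc R) l" for x
  proof -
    have "dist (f x) l \<le> inverse (2 + real R)"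
      using dloc_le_iff[of map_ball "f x" l R, OF map_ball_Suc_eqD] that by (simp add: dist_rmap_def)
    also have "\<dots> \<le> inverse (real (Suc R))" by (simp add: inverse_eq_divide frac_le)
    finally show ?thesis using R by simp
  qed
  then show "eventually (\<lambda>x. dist (f x) l < e) F"
    using assms[of "Suc R"] by (auto elim: eventually_mono)
qed

text \<open>The local data that determine rotation and stems at \<open>v\<close>. What hangs below a
  slot is forgotten, except whether the slot is a stem.\<close>

definition same_at :: "btree \<Rightarrow> btree \<Rightarrow> nat list \<Rightarrow> bool" where
  "same_at t t' v \<longleftrightarrow> (v \<in> tree_verts t' \<longleftrightarrow> v \<in> tree_verts t) \<and>
     map (\<lambda>s. s = None) (slots_at t' v) = map (\<lambda>s. s = None) (slots_at t v)"

text \<open>The bound on the depth is strict because a tree ball of radius \<open>R\<close> keeps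
  the slots of vertices of depth less than \<open>R\<close> only.\<close>

lemma same_at_tree_ball:
  assumes "tree_ball R t' = tree_ball R t" "length v < R"
  shows "same_at t t' v"
proof -
  have 1: "map (map_option (tree_ball r)) (slots x') = map (map_option (tree_ball r)) (slots x)"
    if "tree_ball (Suc r) x' = tree_ball (Suc r) x" for r x x'
    using that by simp
  have "rel_option (\<lambda>x x'. tree_ball (R - length v) x' = tree_ball (R - length v) x)
      (subtree v t) (subtree v t')"
    using assms
  proof (induction v arbitrary: t t' R)
    case (Cons i v)
    then obtain r where r: "R = Suc r" "length v < r" by (cases R) auto
    note m = 1[OF Cons.prems(1)[unfolded r(1)]]
    have len: "length (slots t') = length (slots t)" using m by (rule map_eq_imp_length_eq)
    show ?case
    proof (cases "i < length (slots t)")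
      case True
      have "map_option (tree_ball r) (slots t' ! i) = map_option (tree_ball r) (slots t ! i)"
        using arg_cong[OF m, of "\<lambda>l. l ! i"] True len by simp
      then show ?thesis
        using Cons.IH[of r] r True len by (cases "slots t ! i"; cases "slots t' ! i") auto
    qed (simp add: len)
  qed simp
  then show ?thesis
  proof cases
    case None
    then show ?thesis by (simp add: same_at_def tree_verts_def slots_at_def)
  next
    case (Some x x')
    obtain r where r: "R - length v = Suc r" using assms(2) by (metis Suc_diff_Suc)
    note m = 1[OF Some(3)[unfolded r]]
    have "map (\<lambda>s. s = None) (map (map_option (tree_ball r)) (slots x')) =
        map (\<lambda>s. s = None) (map (map_option (tree_ball r)) (slots x))"
      unfolding m ..
    then show ?thesis using Some
      by (simp add: same_at_def tree_verts_def slots_at_def o_def)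
  qed
qed

lemma eventually_same_at: "eventually (\<lambda>t'. same_at t t' v) (nhds t)"
  using eventually_tree_ball[of "Suc (length v)" t]
  by (rule eventually_mono) (rule same_at_tree_ball[of "Suc (length v)"], auto)

lemma same_at_slots:
  assumes "same_at t t' v"
  shows "v \<in> tree_verts t' \<longleftrightarrow> v \<in> tree_verts t" "length (slots_at t' v) = length (slots_at t v)"
    "slots_at t' v = [] \<longleftrightarrow> slots_at t v = []"
    "i < length (slots_at t v) \<Longrightarrow> slots_at t' v ! i = None \<longleftrightarrow> slots_at t v ! i = None"
proof -
  have m: "map (\<lambda>s. s = None) (slots_at t' v) = map (\<lambda>s. s = None) (slots_at t v)"
    using assms by (simp add: same_at_def)
  show l: "length (slots_at t' v) = length (slots_at t v)" using m by (rule map_eq_imp_length_eq)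
  then show "slots_at t' v = [] \<longleftrightarrow> slots_at t v = []" by (metis length_0_conv)
  show "i < length (slots_at t v) \<Longrightarrow> slots_at t' v ! i = None \<longleftrightarrow> slots_at t v ! i = None"
    using arg_cong[OF m, of "\<lambda>l. l ! i"] l by simp
qed (use assms in \<open>simp add: same_at_def\<close>)

lemma same_at_half:
  assumes "same_at t t' (half_vertex h)"
  shows "h \<in> tree_halves t' \<longleftrightarrow> h \<in> tree_halves t" "h \<in> stems t' \<longleftrightarrow> h \<in> stems t"
    "tree_rot t' h = tree_rot t h" "edge_opp t' h = edge_opp t h" "stem_step t' h = stem_step t h"
    "h \<in> closing_stems t' \<longleftrightarrow> h \<in> closing_stems t" "h \<in> opening_stems t' \<longleftrightarrow> h \<in> opening_stems t"
proof -
  show "h \<in> tree_halves t' \<longleftrightarrow> h \<in> tree_halves t" "tree_rot t' h = tree_rot t h"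
    using same_at_slots[OF assms] by (cases h; auto)+
  show s: "h \<in> stems t' \<longleftrightarrow> h \<in> stems t"
    using same_at_slots[OF assms] by (cases h) auto
  then show "edge_opp t' h = edge_opp t h" by (simp add: edge_opp_def)
  show "h \<in> closing_stems t' \<longleftrightarrow> h \<in> closing_stems t" "h \<in> opening_stems t' \<longleftrightarrow> h \<in> opening_stems t"
    using s by (simp_all add: closing_stems_def opening_stems_def)
  then show "stem_step t' h = stem_step t h" by (simp add: stem_step_def)
qed

text \<open>The inverse is defined on the whole tree, but it is enough to control the rotation at
  its value: by injectivity, the half-edge that \<open>tree_rot t'\<close> sends to \<open>h\<close>
  is then the same.\<close>

lemma eventually_tree_rot_inv:
  assumes "h \<in> tree_halves t"
  shows "eventually (\<lambda>t'. tree_rot_inv t' h = tree_rot_inv t h) (nhds t)"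
  using eventually_same_at[of t "half_vertex (tree_rot_inv t h)"]
proof (rule eventually_mono)
  fix t' assume "same_at t t' (half_vertex (tree_rot_inv t h))"
  note s = same_at_half[OF this]
  show "tree_rot_inv t' h = tree_rot_inv t h"
    using tree_rot_inv_tree_rot[of "tree_rot_inv t h" t'] s(1,3) tree_rot_inv[OF assms] by simp
qed

text \<open>The neighbourhood depends on \<open>n\<close>: every step of the walk, in either
  direction, intersects it with the condition that the trees agree at the vertices just
  visited.\<close>

lemma eventually_walk:
  assumes root: "slots t \<noteq> []"
  shows "eventually (\<lambda>t'. walk t' n = walk t n) (nhds t)"
proof -
  have right: "eventually (\<lambda>t'. right_walk t' n = right_walk t n) (nhds t)" for n
  proof (induction n)
    case (Suc n)
    have eq: "right_walk x (Suc n) = tree_rot x (edge_opp x (right_walk x n))" for x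
      by (simp add: edge_opp_def)
    show ?case
      using Suc eventually_same_at[of t "half_vertex (right_walk t n)"]
        eventually_same_at[of t "half_vertex (edge_opp t (right_walk t n))"]
      unfolding eq
    proof eventually_elim
      case (elim t')
      then show ?case using same_at_half(4)[OF elim(2)] same_at_half(3)[OF elim(3)] by (simp only:)
    qed
  qed simp
  have left: "eventually (\<lambda>t'. left_walk t' n = left_walk t n) (nhds t)" for n
  proof (induction n)
    case 0
    then show ?case using eventually_tree_rot_inv[OF root_slot[OF root]] by simp
  next
    case (Suc n)
    have eq: "left_walk x (Suc n) = tree_rot_inv x (edge_opp x (left_walk x n))" for x
      by (simp add: edge_opp_def)
    have h: "edge_opp t (left_walk t n) \<in> tree_halves t" by (rule edge_opp(1)[OF left_walk_in[OF root]])
    show ?case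
      using Suc eventually_same_at[of t "half_vertex (left_walk t n)"]
        eventually_tree_rot_inv[OF h]
      unfolding eq
    proof eventually_elim
      case (elim t')
      then show ?case using same_at_half(4)[OF elim(2)] by (simp only:)
    qed
  qed
  have "eventually (\<lambda>t'. edge_opp t' (left_walk t' n) = edge_opp t (left_walk t n)) (nhds t)" for n
    using left[of n] eventually_same_at[of t "half_vertex (left_walk t n)"]
  proof eventually_elim
    case (elim t')
    then show ?case using same_at_half(4)[OF elim(2)] by (simp only:)
  qed
  then show ?thesis using right by (cases "0 \<le> n") (simp_all add: walk_def)
qed

lemma eventually_walk_stem:
  assumes root: "slots t \<noteq> []"
  shows "eventually (\<lambda>t'. walk t' n = walk t n \<and> same_at t t' (half_vertex (walk t n))) (nhds t)"
  using eventually_walk[OF root] eventually_same_at by (rule eventually_conj)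

lemma eventually_contour_height:
  assumes root: "slots t \<noteq> []"
  shows "eventually (\<lambda>t'. contour_height t' n = contour_height t n) (nhds t)"
proof -
  have "eventually (\<lambda>t'. \<forall>j\<in>{-\<bar>n\<bar>..\<bar>n\<bar>}. walk t' j = walk t j \<and> same_at t t' (half_vertex (walk t j))) (nhds t)"
    by (rule eventually_ball_finite) (use eventually_walk_stem[OF root] in auto)
  then show ?thesis
  proof (rule eventually_mono)
    fix t' assume *: "\<forall>j\<in>{-\<bar>n\<bar>..\<bar>n\<bar>}. walk t' j = walk t j \<and> same_at t t' (half_vertex (walk t j))"
    show "contour_height t' n = contour_height t n"
      unfolding contour_height_def
    proof (rule walk_sum_cong)
      fix j assume "\<bar>j\<bar> \<le> \<bar>n\<bar>"
      then have "j \<in> {-\<bar>n\<bar>..\<bar>n\<bar>}" by auto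
      then show "stem_step t' (walk t' j) = stem_step t (walk t j)" using * same_at_half(5) by simp
    qed
  qed
qed

lemma eventually_matched:
  assumes root: "slots t \<noteq> []" and m: "matched t n m"
  shows "eventually (\<lambda>t'. matched t' n m) (nhds t)"
proof -
  have "eventually (\<lambda>t'. \<forall>j\<in>{n..m}. contour_height t' j = contour_height t j) (nhds t)"
    by (rule eventually_ball_finite) (use eventually_contour_height[OF root] in auto)
  then show ?thesis
    using eventually_walk_stem[OF root, of n] eventually_walk_stem[OF root, of m]
  proof eventually_elim
    case (elim t')
    then show ?case using m same_at_half(6,7)[of t t'] by (auto simp: matched_def)
  qed
qed

text \<open>A nearby tree inherits one matched pair that makes \<open>stem_mate t h\<close> a mate
  of \<open>h\<close>. The guard \<open>closable t'\<close> supplies uniqueness, so that this mate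
  is the one chosen by \<open>stem_mate t'\<close>.\<close>

lemma eventually_opp_glued_map:
  assumes t: "closable t" and h: "h \<in> tree_halves t"
  shows "eventually (\<lambda>t'. closable t' \<longrightarrow> opp (glued_map t') h = opp (glued_map t) h) (nhds t)"
proof (cases "h \<in> stems t")
  case True
  note root = closable_root[OF t]
  obtain n m where nm: "walk t n = h" "walk t m = stem_mate t h" "matched t n m \<or> matched t m n"
    using mates_stem_mate[OF t True] unfolding mates_def by blast
  have "eventually (\<lambda>t'. matched t' n m \<or> matched t' m n) (nhds t)"
    using nm(3)
  proof
    assume "matched t n m"
    from eventually_matched[OF root this] show ?thesis by (rule eventually_mono) simp
  next
    assume "matched t m n"
    from eventually_matched[OF root this] show ?thesis by (rule eventually_mono) simp
  qed
  then show ?thesis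
    using eventually_walk[OF root, of n] eventually_walk[OF root, of m]
      eventually_same_at[of t "half_vertex h"]
  proof eventually_elim
    case (elim t')
    then have "mates t' h (stem_mate t h)" using nm(1,2) unfolding mates_def by metis
    then show ?case using stem_mate_eq[of t'] same_at_half(2)[OF elim(4)] True by simp
  qed
next
  case False
  show ?thesis using eventually_same_at[of t "half_vertex h"]
    by (rule eventually_mono) (use False same_at_half(2) in auto)
qed

text \<open>The maps share their half-edges near the root, so the identity is the isomorphism.
  Agreement is assumed only in terms of distances in \<open>m\<close>; the work is to show that
  distances, and hence balls, in \<open>m'\<close> are the same.\<close>

lemma map_iso_ball_if_agree:
  fixes m m' :: "('v, 'h) cmap"
  assumes m: "rooted_map m" and m': "rooted_map m'"
    and r: "root_vertex m' = root_vertex m" "root_half m = Some r" "root_half m' = Some r"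
    and same: "org m' = org m" "is_black m' = is_black m"
    and agree: "\<And>h. h \<in> halves m \<Longrightarrow> root_dist m (org m h) \<le> R \<Longrightarrow>
      h \<in> halves m' \<and> rot m' h = rot m h \<and> opp m' h = opp m h"
  shows "map_iso (cmap_ball R m) (cmap_ball R m')"
proof -
  have half: "\<exists>h\<in>halves m. org m h = v" if v: "v \<in> verts m" for v
  proof -
    obtain w where "v = org m (follow m w r)" using vertex_has_half[OF m r(2) v] by blast
    moreover have "r \<in> halves m" using rooted_mapD(9)[OF m r(2)] by (simp add: halves_at_def)
    ultimately show ?thesis using follow_halves[OF m] by blast
  qed
  \<comment> \<open>The half-edges at a vertex form one orbit of the rotation, so agreement along
    the orbit of a single half-edge identifies the whole vertex.\<close>
  have at: "halves_at m' v = halves_at m v" if v: "v \<in> verts m" "root_dist m v \<le> R" for v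
  proof -
    obtain h where h: "h \<in> halves m" "org m h = v" using half[OF v(1)] by blast
    have h': "h \<in> halves m'" "org m' h = v" using agree[of h] h v same by auto
    have "halves_at m v = orbit (rot m) h"
      using orbit_cyclic_eq3[OF cyclic_halves(1,2)[OF m h(1)]] h by simp
    also have "\<dots> = orbit (rot m') h"
    proof (rule orbit_cong0[of h "halves_at m v"])
      show "h \<in> halves_at m v" using h by (simp add: halves_at_def)
      show "rot m \<in> halves_at m v \<rightarrow> halves_at m v"
        using cyclic_halves(3,4)[OF m] by (auto simp: halves_at_def)
      show "rot m k = rot m' k" if "k \<in> halves_at m v" for k
        using agree[of k] that v by (simp add: halves_at_def)
    qed
    also have "\<dots> = halves_at m' v"
      using orbit_cyclic_eq3[OF cyclic_halves(1,2)[OF m' h'(1)]] h' by simp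
    finally show ?thesis ..
  qed
  have out: "(u, v) \<in> adj m' \<longleftrightarrow> (u, v) \<in> adj m" if u: "u \<in> verts m" "root_dist m u \<le> R" for u v
  proof -
    have "(u, v) \<in> adj x \<longleftrightarrow> (\<exists>h\<in>halves_at x u. v = org x (opp x h))" for x :: "('v, 'h) cmap"
      by (auto simp: adj_def halves_at_def)
    moreover have "org m' (opp m' h) = org m (opp m h)" if "h \<in> halves_at m u" for h
      using agree[of h] that u same by (simp add: halves_at_def)
    ultimately show ?thesis using at[OF u] by simp
  qed
  have adj_verts: "v \<in> verts m" if "(u, v) \<in> adj m" for u v
    using that rooted_mapD(2,3)[OF m] by (auto simp: adj_def)
  \<comment> \<open>Every step of such a path leaves a vertex at distance at most \<open>R\<close>,
    where the outgoing edges of the two maps agree by \<open>out\<close>.\<close>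
  have path: "((root_vertex m, v) \<in> adj m' ^^ n \<longleftrightarrow> (root_vertex m, v) \<in> adj m ^^ n) \<and>
      ((root_vertex m, v) \<in> adj m ^^ n \<longrightarrow> v \<in> verts m)" if "n \<le> Suc R" for n v
    using that
  proof (induction n arbitrary: v)
    case 0
    then show ?case using rooted_mapD(1)[OF m] by auto
  next
    case (Suc n)
    have IH: "(root_vertex m, u) \<in> adj m' ^^ n \<longleftrightarrow> (root_vertex m, u) \<in> adj m ^^ n" for u
      using Suc by simp
    have step: "(u, v) \<in> adj m' \<longleftrightarrow> (u, v) \<in> adj m" if "(root_vertex m, u) \<in> adj m ^^ n" for u
    proof (rule out)
      show "u \<in> verts m" using Suc that by simp
      show "root_dist m u \<le> R" using root_dist_le[OF that] Suc.prems by simp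
    qed
    have "(root_vertex m, v) \<in> adj x ^^ Suc n \<longleftrightarrow>
        (\<exists>u. (root_vertex m, u) \<in> adj x ^^ n \<and> (u, v) \<in> adj x)" for x :: "('v, 'h) cmap"
      by auto
    then show ?case using IH step adj_verts by blast
  qed
  have d1: "v \<in> verts m' \<and> root_dist m' v = root_dist m v" if v: "v \<in> verts m" "root_dist m v \<le> R" for v
  proof -
    obtain h where "h \<in> halves m" "org m h = v" using half[OF v(1)] by blast
    then have v': "v \<in> verts m'" using agree[of h] v same rooted_mapD(2)[OF m', of h] by simp
    have "(root_vertex m, v) \<in> adj m' ^^ root_dist m v"
      using path[of "root_dist m v" v] root_dist_path[OF m v(1)] v(2) by simp
    then have le: "root_dist m' v \<le> root_dist m v" using root_dist_le[of m'] r(1) by simp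
    have "(root_vertex m, v) \<in> adj m ^^ root_dist m' v"
      using path[of "root_dist m' v" v] root_dist_path[OF m' v'] v(2) le r(1) by simp
    then show ?thesis using root_dist_le[of m] le v' by (simp add: le_antisym)
  qed
  have d2: "v \<in> verts m \<and> root_dist m v \<le> R" if v: "v \<in> verts m'" "root_dist m' v \<le> R" for v
  proof -
    have "(root_vertex m, v) \<in> adj m' ^^ root_dist m' v" using root_dist_path[OF m' v(1)] r(1) by simp
    then have p: "(root_vertex m, v) \<in> adj m ^^ root_dist m' v" "v \<in> verts m"
      using path[of "root_dist m' v" v] v(2) by auto
    then show ?thesis using root_dist_le[OF p(1)] v(2) by simp
  qed
  have B: "h \<in> halves m \<and> h \<in> halves m' \<and> rot m' h = rot m h \<and> opp m' h = opp m h \<and> h \<in> ball_halves R m'"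
    if h: "h \<in> ball_halves R m" for h
  proof -
    note H = ball_halvesD[OF m h]
    note O = ball_halvesD(3)[OF m H(2)]
    have "root_dist m' (org m h) = root_dist m (org m h)"
      "root_dist m' (org m (opp m h)) = root_dist m (org m (opp m h))"
      using d1[of "org m h"] d1[of "org m (opp m h)"] H(1,3) O rooted_mapD(2,3)[OF m] by auto
    then show ?thesis using agree[OF H(1,3)] h H(1) same by (simp add: ball_halves_def)
  qed
  \<comment> \<open>Agreement is assumed for half-edges of \<open>m\<close> only, so a half-edge of
    \<open>m'\<close> near the root is first shown to belong to \<open>m\<close>; this is the inner
    fact \<open>k\<close>.\<close>
  have B': "h \<in> ball_halves R m" if h: "h \<in> ball_halves R m'" for h
  proof -
    note H = ball_halvesD[OF m' h]
    have k: "k \<in> halves m \<and> root_dist m (org m k) \<le> R \<and> root_dist m' (org m k) = root_dist m (org m k)"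
      if k: "k \<in> halves m'" "root_dist m' (org m' k) \<le> R" for k
    proof -
      have v: "org m' k \<in> verts m \<and> root_dist m (org m' k) \<le> R"
        using d2 rooted_mapD(2)[OF m' k(1)] k(2) by blast
      then have "k \<in> halves_at m (org m' k)" using at[of "org m' k"] k(1) by (auto simp: halves_at_def)
      then show ?thesis using v d1[of "org m' k"] by (simp add: halves_at_def same)
    qed
    have h1: "h \<in> halves m" "root_dist m (org m h) \<le> R" "root_dist m' (org m h) = root_dist m (org m h)"
      using k[OF H(1,3)] by auto
    have o: "opp m' h = opp m h" using agree[OF h1(1,2)] by simp
    have "root_dist m' (org m (opp m h)) = root_dist m (org m (opp m h))"
      using k[of "opp m' h"] ball_halvesD(1,3)[OF m' H(2)] o by simp
    then show ?thesis using h h1 o by (simp add: ball_halves_def same)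
  qed
  have balls: "ball_halves R m' = ball_halves R m" using B B' by blast
  have "first_return (rot m') (ball_halves R m) h = first_return (rot m) (ball_halves R m) h"
    if h: "h \<in> ball_halves R m" for h
  proof -
    have v: "org m h \<in> verts m" "root_dist m (org m h) \<le> R"
      using ball_halvesD[OF m h] rooted_mapD(2)[OF m] by auto
    have "(rot m' ^^ k) h = (rot m ^^ k) h \<and> (rot m ^^ k) h \<in> halves_at m (org m h)" for k
    proof (induction k)
      case 0
      then show ?case using ball_halvesD(1)[OF m h] by (simp add: halves_at_def)
    next
      case (Suc k)
      then have "(rot m ^^ k) h \<in> halves m" "org m ((rot m ^^ k) h) = org m h" by (auto simp: halves_at_def)
      then show ?case using Suc agree[of "(rot m ^^ k) h"] v cyclic_halves(3,4)[OF m, of "(rot m ^^ k) h"]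
        by (simp add: halves_at_def)
    qed
    then show ?thesis by (simp add: first_return_def)
  qed
  moreover have "{v \<in> verts m. root_dist m v \<le> R} = {v \<in> verts m'. root_dist m' v \<le> R}"
    using d1 d2 by auto
  ultimately have "iso_by (\<lambda>v. v) (\<lambda>h. h) (cmap_ball R m) (cmap_ball R m')"
    unfolding iso_by_def cmap_ball_simps balls using B r same
    by (simp add: bij_betw_def option.map_ident)
  then show ?thesis
    unfolding map_iso_def using rooted_map_cmap_ball[OF m] rooted_map_cmap_ball[OF m'] by blast
qed

text \<open>Degrees are finite because \<open>cyclic_on\<close> holds of finite sets only, so each
  sphere is reached from finitely many half-edges.\<close>

lemma finite_ball_verts:
  assumes m: "rooted_map m"
  shows "finite {v \<in> verts m. root_dist m v \<le> R}"
proof (induction R)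
  case 0
  have "v = root_vertex m" if "v \<in> verts m" "root_dist m v \<le> 0" for v
    using root_dist_path[OF m that(1)] that(2) by simp
  then have "{v \<in> verts m. root_dist m v \<le> 0} \<subseteq> {root_vertex m}" by auto
  then show ?case by (rule finite_subset) simp
next
  case (Suc R)
  let ?B = "{v \<in> verts m. root_dist m v \<le> R}"
  have "{v \<in> verts m. root_dist m v \<le> Suc R} \<subseteq> ?B \<union> (\<lambda>h. org m (opp m h)) ` (\<Union>u\<in>?B. halves_at m u)"
  proof
    fix v assume "v \<in> {v \<in> verts m. root_dist m v \<le> Suc R}"
    then have v: "v \<in> verts m" "root_dist m v \<le> Suc R" by auto
    show "v \<in> ?B \<union> (\<lambda>h. org m (opp m h)) ` (\<Union>u\<in>?B. halves_at m u)"
    proof (cases "root_dist m v \<le> R")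
      case False
      then have "(root_vertex m, v) \<in> adj m ^^ Suc R"
        using root_dist_path[OF m v(1)] v(2) by (simp add: le_Suc_eq)
      then obtain u where u: "(root_vertex m, u) \<in> adj m ^^ R" "(u, v) \<in> adj m" by auto
      then obtain h where h: "h \<in> halves m" "org m h = u" "org m (opp m h) = v" by (auto simp: adj_def)
      have "u \<in> ?B" using h(1,2) rooted_mapD(2)[OF m h(1)] root_dist_le[OF u(1)] by simp
      then show ?thesis using h by (auto simp: halves_at_def)
    qed (use v in simp)
  qed
  moreover have "finite (halves_at m u)" if "u \<in> verts m" for u
    using rooted_mapD(6)[OF m that] finite_cyclic_on by auto
  ultimately show ?case using Suc by (auto intro: finite_subset)
qed

lemma eventually_glued_map_ball:
  assumes t: "closable t"
  shows "eventually (\<lambda>t'. closable t' \<longrightarrow>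
    map_iso (cmap_ball R (glued_map t)) (cmap_ball R (glued_map t'))) (nhds t)"
proof -
  let ?m = "glued_map t"
  note m = rooted_map_glued_map[OF t]
  let ?V = "{v \<in> verts ?m. root_dist ?m v \<le> R}"
  \<comment> \<open>Distances are those of the closure, so these half-edges may sit deep in the
    tree. There are finitely many of them, which allows one common neighbourhood.\<close>
  let ?H = "\<Union>v\<in>?V. {h \<in> tree_halves t. half_vertex h = v}"
  have "finite ?H" using finite_ball_verts[OF m] finite_halves_at_tree by blast
  moreover have "eventually (\<lambda>t'. same_at t t' (half_vertex h) \<and>
      (closable t' \<longrightarrow> opp (glued_map t') h = opp (glued_map t) h)) (nhds t)" if "h \<in> ?H" for h
    using that by (intro eventually_conj eventually_same_at eventually_opp_glued_map t) auto
  ultimately have "eventually (\<lambda>t'. \<forall>h\<in>?H. same_at t t' (half_vertex h) \<and>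
      (closable t' \<longrightarrow> opp (glued_map t') h = opp (glued_map t) h)) (nhds t)"
    by (intro eventually_ball_finite ballI)
  then show ?thesis
  proof (rule eventually_mono, intro impI)
    fix t' assume *: "\<forall>h\<in>?H. same_at t t' (half_vertex h) \<and>
        (closable t' \<longrightarrow> opp (glued_map t') h = opp (glued_map t) h)" and t': "closable t'"
    show "map_iso (cmap_ball R ?m) (cmap_ball R (glued_map t'))"
    proof (rule map_iso_ball_if_agree[OF m rooted_map_glued_map[OF t']])
      fix h assume h: "h \<in> halves ?m" "root_dist ?m (org ?m h) \<le> R"
      then have "h \<in> ?H" using half_vertex_in_tree_verts[of h t] by simp
      then have s: "same_at t t' (half_vertex h)" "opp (glued_map t') h = opp ?m h" using * t' by blast+
      show "h \<in> halves (glued_map t') \<and> rot (glued_map t') h = rot ?m h \<and> opp (glued_map t') h = opp ?m h"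
        using same_at_half(1,3)[OF s(1)] s(2) h(1) by simp
    qed (simp_all add: fun_eq_iff)
  qed
qed

lemma eventually_map_ball_glued_map:
  assumes t: "closable t"
  shows "eventually (\<lambda>t'. closable t' \<longrightarrow>
    map_ball R (abs_rmap (glued_map t')) = map_ball R (abs_rmap (glued_map t))) (nhds t)"
  using eventually_glued_map_ball[OF t, of R]
proof (rule eventually_mono, intro impI)
  fix t' assume a: "closable t' \<longrightarrow> map_iso (cmap_ball R (glued_map t)) (cmap_ball R (glued_map t'))"
    and t': "closable t'"
  have "map_ball R (abs_rmap (glued_map x)) = abs_rmap (cmap_ball R (glued_map x))" if "closable x" for x
    using that by (intro map_ball.abs_eq map_iso_refl rooted_map_glued_map)
  moreover have "abs_rmap (cmap_ball R (glued_map t)) = abs_rmap (cmap_ball R (glued_map t'))"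
    using a t' by (intro Quotient3_rel_abs[OF Quotient3_rmap]) simp
  ultimately show "map_ball R (abs_rmap (glued_map t')) = map_ball R (abs_rmap (glued_map t))"
    using t t' by simp
qed

section \<open>The contour visits every half-edge\<close>

lemma periodic_int:
  fixes f :: "int \<Rightarrow> 'a"
  assumes "\<And>x. f (x + p) = f x"
  shows "f (x + k * p) = f x"
proof (induction k rule: int_bi_induct)
  case (up k)
  then show ?case using assms[of "x + k * p"] by (simp add: algebra_simps)
next
  case (down k)
  then show ?case using assms[of "x + (k - 1) * p"] by (simp add: algebra_simps)
qed simp

lemma range_periodic_int:
  fixes f :: "int \<Rightarrow> 'a"
  assumes "\<And>x. f (x + p) = f x" "0 < p"
  shows "range f = f ` {0..<p}"
proof -
  have "f x \<in> f ` {0..<p}" for x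
  proof (rule image_eqI[of _ _ "x mod p"])
    show "f x = f (x mod p)"
      using periodic_int[of f p "x mod p" "x div p"] assms(1) by (simp add: mod_div_mult_eq)
  qed (use assms(2) in auto)
  then show ?thesis by auto
qed

text \<open>The half-edge \<open>Up w\<close> is the only way out of the part of the tree below
  \<open>w\<close>.\<close>

lemma contour_step_stays_under:
  assumes "h \<in> tree_halves t" "prefix w (half_vertex h)" "h \<noteq> Up w"
  shows "prefix w (half_vertex (contour_step t h))"
proof -
  have "prefix w (half_vertex (edge_opp t h))"
  proof (cases "h \<in> stems t")
    case False
    show ?thesis
    proof (cases h)
      case (Up u)
      then obtain z where z: "u = w @ z" "z \<noteq> []" using assms(2,3) by (auto simp: prefix_def)
      then show ?thesis using Up by (simp add: edge_opp_def butlast_append del: butlast.simps)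
    next
      case (Slot u i)
      then show ?thesis using assms(2) False by (simp add: edge_opp_def del: in_stems)
    qed
  qed (use assms in \<open>simp add: edge_opp_def\<close>)
  then show ?thesis using tree_rot(2) edge_opp(1)[OF assms(1)] by (simp add: contour_step_def)
qed

text \<open>Dually, \<open>Slot v i\<close> is the only way into the part of the tree below
  \<open>v @ [i]\<close>.\<close>

lemma contour_step_stays_outside:
  assumes "h \<in> tree_halves t" "\<not> prefix (v @ [i]) (half_vertex h)" "h \<noteq> Slot v i"
  shows "\<not> prefix (v @ [i]) (half_vertex (contour_step t h))"
proof -
  have "\<not> prefix (v @ [i]) (half_vertex (edge_opp t h))"
  proof (cases "h \<in> stems t")
    case False
    show ?thesis
    proof (cases h)
      case (Up u)
      have "prefix (butlast u) u" by (simp add: prefixeq_butlast)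
      then show ?thesis using assms(2) Up prefix_order.trans[of _ "butlast u" u]
        by (auto simp: edge_opp_def)
    next
      case (Slot u j)
      then show ?thesis using assms(2,3) False by (auto simp: edge_opp_def simp del: in_stems)
    qed
  qed (use assms in \<open>simp add: edge_opp_def\<close>)
  then show ?thesis using tree_rot(2) edge_opp(1)[OF assms(1)] by (simp add: contour_step_def)
qed

lemma half_vertex_contour_step_edge:
  assumes "v @ [i] \<in> tree_verts t"
  shows "half_vertex (contour_step t (Slot v i)) = v @ [i]" "half_vertex (contour_step t (Up (v @ [i]))) = v"
proof -
  have *: "Slot v i \<in> tree_halves t" "Slot v i \<notin> stems t" "Up (v @ [i]) \<in> tree_halves t"
    using assms snoc_in_tree_verts[of v i t] by auto
  then show "half_vertex (contour_step t (Slot v i)) = v @ [i]" "half_vertex (contour_step t (Up (v @ [i]))) = v"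
    using tree_rot(2) edge_opp(1)[OF *(1)] edge_opp(1)[OF *(3)]
    by (simp_all add: contour_step_def edge_opp_def del: in_stems(2))
qed

section \<open>Crossing an edge in both directions\<close>

context
  fixes t :: btree
  assumes root: "slots t \<noteq> []"
begin

lemma walk_repeats_on_finite:
  assumes "finite A" "infinite I" "\<And>j. j \<in> I \<Longrightarrow> walk t j \<in> A"
  obtains j k where "j \<in> I" "k \<in> I" "j < k" "walk t j = walk t k"
proof -
  have "\<not> inj_on (walk t) I"
    using assms finite_subset[of "walk t ` I" A] finite_imageD[of "walk t" I] by blast
  then obtain a b where "a \<in> I" "b \<in> I" "a \<noteq> b" "walk t a = walk t b" by (auto simp: inj_on_def)
  then show ?thesis using that[of a b] that[of b a] by (cases "a < b") auto
qed

text \<open>A contour that enters a subtree through its edge and meets only finitely many half-edges there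
  has to leave it again, because the contour is injective up to periodicity.\<close>

lemma walk_crosses_both_ways:
  assumes w: "v @ [i] \<in> tree_verts t"
    and fin: "finite (range (walk t) \<inter> {h. prefix (v @ [i]) (half_vertex h)})" (is "finite ?A")
  shows "Slot v i \<in> range (walk t) \<longleftrightarrow> Up (v @ [i]) \<in> range (walk t)"
proof
  assume "Slot v i \<in> range (walk t)"
  then obtain n where n: "walk t n = Slot v i" by auto
  show "Up (v @ [i]) \<in> range (walk t)"
  proof (rule ccontr)
    assume no: "Up (v @ [i]) \<notin> range (walk t)"
    have "prefix (v @ [i]) (half_vertex (walk t j))" if "n + 1 \<le> j" for j
      using that
    proof (induction j rule: int_ge_induct)
      case base
      then show ?case using walk_Suc[OF root, of n] half_vertex_contour_step_edge(1)[OF w] n by simp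
    next
      case (step j)
      have "walk t j \<noteq> Up (v @ [i])" using no by (metis rangeI)
      then show ?case using contour_step_stays_under[OF walk_in[OF root] step.IH] walk_Suc[OF root] by simp
    qed
    then have A: "walk t j \<in> ?A" if "j \<in> {n + 1..}" for j using that by auto
    obtain j k where jk: "n + 1 \<le> j" "j < k" "walk t j = walk t k"
      using walk_repeats_on_finite[OF fin _ A] infinite_Ici[of "n + 1"] by (metis atLeast_iff)
    \<comment> \<open>Moving the repetition back to the entry time \<open>n\<close> shows that the
      entry recurs at \<open>k + (n - j) > n\<close>, when the walk is already confined to the
      subtree; but \<open>Slot v i\<close> lies outside it.\<close>
    have "walk t n = walk t (k + (n - j))" using walk_shift[OF root jk(3), of "n - j"] by simp
    then have "walk t n \<in> ?A" using A[of "k + (n - j)"] jk by simp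
    then show False using n by (auto simp: prefix_def)
  qed
next
  assume "Up (v @ [i]) \<in> range (walk t)"
  then obtain n where n: "walk t n = Up (v @ [i])" by auto
  show "Slot v i \<in> range (walk t)"
  proof (rule ccontr)
    assume no: "Slot v i \<notin> range (walk t)"
    have "prefix (v @ [i]) (half_vertex (walk t j))" if "j \<le> n" for j
      using that
    proof (induction j rule: int_le_induct)
      case base
      then show ?case using n by simp
    next
      case (step j)
      have "walk t (j - 1) \<noteq> Slot v i" using no by (metis rangeI)
      then show ?case
        using contour_step_stays_outside[OF walk_in[OF root], of v i "j - 1"] step.IH
          walk_Suc[OF root, of "j - 1"] by auto
    qed
    then have A: "walk t j \<in> ?A" if "j \<in> {..n}" for j using that by auto
    obtain j k where jk: "k \<le> n" "j < k" "walk t j = walk t k"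
      using walk_repeats_on_finite[OF fin _ A] infinite_Iic[of n] by (metis atMost_iff)
    \<comment> \<open>The mirror image: the half-edge met just after the exit at \<open>n\<close>
      already occurred at a time not later than \<open>n\<close>, when the walk was confined to the
      subtree.\<close>
    have "walk t (n + 1) = walk t (j + (n + 1 - k))" using walk_shift[OF root jk(3), of "n + 1 - k"] by simp
    then have "walk t (n + 1) \<in> ?A" using A[of "j + (n + 1 - k)"] jk by simp
    moreover have "half_vertex (walk t (n + 1)) = v"
      using walk_Suc[OF root, of n] half_vertex_contour_step_edge(2)[OF w] n by simp
    ultimately show False by (auto simp: prefix_def)
  qed
qed

text \<open>The walk starts at the root, outside the subtree. Without an entry it would stay outside
  at all positive times, and without an exit at all negative times; an injective walk cannot do this
  among finitely many half-edges.\<close>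

lemma walk_crosses_if_finite_outside:
  assumes w: "v @ [i] \<in> tree_verts t"
    and fin: "finite (range (walk t) \<inter> {h. \<not> prefix (v @ [i]) (half_vertex h)})" (is "finite ?A")
    and inj: "inj (walk t)"
  shows "Slot v i \<in> range (walk t)" "Up (v @ [i]) \<in> range (walk t)"
proof -
  have no: False if "infinite I" "\<And>j. j \<in> I \<Longrightarrow> \<not> prefix (v @ [i]) (half_vertex (walk t j))" for I
    using walk_repeats_on_finite[of ?A I] fin that inj by (metis (mono_tags) IntI injD less_irrefl mem_Collect_eq rangeI)
  have out0: "\<not> prefix (v @ [i]) (half_vertex (walk t 0))" by simp
  show "Slot v i \<in> range (walk t)"
  proof (rule ccontr)
    assume ex: "Slot v i \<notin> range (walk t)"
    have "\<not> prefix (v @ [i]) (half_vertex (walk t j))" if "0 \<le> j" for j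
      using that
    proof (induction j rule: int_ge_induct)
      case (step j)
      have "walk t j \<noteq> Slot v i" using ex by (metis rangeI)
      then show ?case using contour_step_stays_outside[OF walk_in[OF root] step.IH] walk_Suc[OF root] by simp
    qed (rule out0)
    then show False using no[of "{0..}"] infinite_Ici[of "0::int"] by simp
  qed
  show "Up (v @ [i]) \<in> range (walk t)"
  proof (rule ccontr)
    assume ex: "Up (v @ [i]) \<notin> range (walk t)"
    have "\<not> prefix (v @ [i]) (half_vertex (walk t j))" if "j \<le> 0" for j
      using that
    proof (induction j rule: int_le_induct)
      case (step j)
      have "walk t (j - 1) \<noteq> Up (v @ [i])" using ex by (metis rangeI)
      then show ?case
        using contour_step_stays_under[OF walk_in[OF root], of "v @ [i]" "j - 1"] step.IH
          walk_Suc[OF root, of "j - 1"] by auto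
    qed (rule out0)
    then show False using no[of "{..0}"] infinite_Iic[of "0::int"] by simp
  qed
qed

text \<open>The hypothesis closes the visited set under opposites. It is then closed under rotation,
  which is the contour step applied to the opposite, so it contains every half-edge at a visited
  vertex and spreads from the root along the edges.\<close>

lemma range_walk_if_crosses:
  assumes cross: "\<And>v i. v @ [i] \<in> tree_verts t \<Longrightarrow>
    Slot v i \<in> range (walk t) \<longleftrightarrow> Up (v @ [i]) \<in> range (walk t)"
  shows "range (walk t) = tree_halves t"
proof
  show "range (walk t) \<subseteq> tree_halves t" using walk_in[OF root] by auto
  have opp: "edge_opp t h \<in> range (walk t)" if h: "h \<in> range (walk t)" for h
  proof (cases "h \<in> stems t")
    case False
    have hin: "h \<in> tree_halves t" using h walk_in[OF root] by auto
    show ?thesis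
    proof (cases h)
      case (Up u)
      then obtain v i where "u = v @ [i]" using hin by (cases u rule: rev_cases) auto
      then show ?thesis using Up hin h cross[of v i] by (simp add: edge_opp_def)
    next
      case (Slot v i)
      then have "v @ [i] \<in> tree_verts t" using hin False by (simp add: snoc_in_tree_verts)
      then show ?thesis using Slot h False cross[of v i] by (simp add: edge_opp_def del: in_stems)
    qed
  qed (use h in \<open>simp add: edge_opp_def\<close>)
  have rot: "tree_rot t h \<in> range (walk t)" if h: "h \<in> range (walk t)" for h
  proof -
    obtain n where n: "edge_opp t h = walk t n" using opp[OF h] by auto
    have "edge_opp t (edge_opp t h) = h" using h walk_in[OF root] by (intro edge_opp(2)) auto
    then have "tree_rot t h = walk t (n + 1)" using walk_Suc[OF root, of n] n
      by (metis contour_step_def)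
    then show ?thesis by simp
  qed
  have around: "k \<in> range (walk t)"
    if "h \<in> range (walk t)" "k \<in> tree_halves t" "half_vertex k = half_vertex h" for h k
  proof -
    have hin: "h \<in> tree_halves t" using that(1) walk_in[OF root] by auto
    have "k \<in> orbit (tree_rot t) h"
      using orbit_cyclic_eq3[OF cyclic_on_tree_rot[OF half_vertex_in_tree_verts[OF hin]], of h] hin that
      by auto
    then show ?thesis by induction (use rot that(1) in auto)
  qed
  have "\<forall>h\<in>tree_halves t. half_vertex h = v \<longrightarrow> h \<in> range (walk t)" if "v \<in> tree_verts t" for v
    using that
  proof (induction v rule: rev_induct)
    case Nil
    have "Slot [] 0 \<in> range (walk t)" using walk_0 by (metis rangeI)
    then show ?case using around by simp
  next
    case (snoc i v)
    then have "Slot v i \<in> range (walk t)" by (simp add: snoc_in_tree_verts)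
    then have "Up (v @ [i]) \<in> range (walk t)" using cross snoc.prems by blast
    then show ?case using around by simp
  qed
  then show "tree_halves t \<subseteq> range (walk t)" using half_vertex_in_tree_verts by blast
qed

lemma range_walk_if_finite:
  assumes "finite (range (walk t))"
  shows "range (walk t) = tree_halves t"
  using assms by (intro range_walk_if_crosses walk_crosses_both_ways) auto

lemma finite_tree_verts_iff_halves: "finite (tree_verts t) \<longleftrightarrow> finite (tree_halves t)"
proof
  assume fin: "finite (tree_verts t)"
  have eq: "tree_halves t = (\<Union>v\<in>tree_verts t. {h \<in> tree_halves t. half_vertex h = v})"
    using half_vertex_in_tree_verts by auto
  show "finite (tree_halves t)" by (subst eq) (rule finite_UN_I[OF fin finite_halves_at_tree])
next
  assume "finite (tree_halves t)"
  moreover have "tree_verts t \<subseteq> insert [] (half_vertex ` tree_halves t)"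
  proof
    fix v assume "v \<in> tree_verts t"
    then have "v = [] \<or> Up v \<in> tree_halves t" by simp
    then show "v \<in> insert [] (half_vertex ` tree_halves t)" by (metis half_vertex.simps(1) imageI insert_iff)
  qed
  ultimately show "finite (tree_verts t)" by (meson finite_imageI finite_insert finite_subset)
qed

text \<open>One repetition makes the walk periodic, hence of finite range, and a walk of finite
  range exhausts the tree. Consequently the walk of an infinite tree is injective.\<close>

lemma finite_if_walk_repeats:
  assumes "walk t n = walk t m" "n < m"
  shows "range (walk t) = walk t ` {0..<m - n}" "range (walk t) = tree_halves t" "finite (tree_verts t)"
proof -
  have "walk t (x + (m - n)) = walk t x" for x
    using walk_shift[OF root assms(1), of "x - n"] by (simp add: algebra_simps)
  then show r: "range (walk t) = walk t ` {0..<m - n}" using assms(2) by (intro range_periodic_int) auto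
  then have "finite (range (walk t))" by simp
  then show "range (walk t) = tree_halves t" "finite (tree_verts t)"
    using range_walk_if_finite finite_tree_verts_iff_halves by auto
qed

lemma inj_walk: "infinite (tree_verts t) \<Longrightarrow> inj (walk t)"
  using finite_if_walk_repeats(3) by (metis injI linorder_neqE)

end

section \<open>Infinite branches and the spine\<close>

definition branch :: "btree \<Rightarrow> nat list \<Rightarrow> nat list set" where
  "branch t w = {u \<in> tree_verts t. prefix w u}"

lemma finite_halves_if_finite_verts:
  assumes "finite V"
  shows "finite {h \<in> tree_halves t. half_vertex h \<in> V}"
proof -
  have "{h \<in> tree_halves t. half_vertex h \<in> V} = (\<Union>v\<in>V. {h \<in> tree_halves t. half_vertex h = v})" by auto
  then show ?thesis using assms finite_halves_at_tree by simp
qed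

lemma branch_unfold:
  "branch t w \<subseteq> insert w (\<Union>i<length (slots_at t w). branch t (w @ [i]))"
proof
  fix u assume "u \<in> branch t w"
  then obtain z where z: "u = w @ z" "u \<in> tree_verts t" by (auto simp: branch_def prefix_def)
  show "u \<in> insert w (\<Union>i<length (slots_at t w). branch t (w @ [i]))"
  proof (cases z)
    case (Cons i y)
    then have u: "u = (w @ [i]) @ y" using z by simp
    then have "w @ [i] \<in> tree_verts t" using z prefix_in_tree_verts by metis
    then have "i < length (slots_at t w)" by (simp add: snoc_in_tree_verts)
    then show ?thesis using u z by (auto simp: branch_def prefix_def)
  qed (use z in simp)
qed

lemma infinite_branch_in_tree_verts: "infinite (branch t w) \<Longrightarrow> w \<in> tree_verts t"
proof -
  assume "infinite (branch t w)"
  then obtain u where "u \<in> branch t w" by (metis ex_in_conv finite.emptyI)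
  then show ?thesis using prefix_in_tree_verts by (auto simp: branch_def prefix_def)
qed

lemma infinite_branch_child:
  assumes "infinite (branch t w)"
  shows "\<exists>i. infinite (branch t (w @ [i]))"
  using assms branch_unfold[of t w] by (meson finite_UN_I finite_insert finite_lessThan finite_subset)

lemma infinite_branch_mono:
  "infinite (branch t (v @ w)) \<Longrightarrow> infinite (branch t v)"
  by (erule contrapos_nn, rule finite_subset[rotated], assumption) (auto simp: branch_def prefix_def)

text \<open>Koenig's argument: degrees are finite, so an infinite branch has an infinite child
  branch. The path goes straight to \<open>w\<close> and then follows such children forever.\<close>

lemma spine_through_infinite_branch:
  assumes "infinite (branch t w)"
  shows "\<exists>p. is_spine t p \<and> p (length w) = w \<and> (\<forall>n\<ge>length w. prefix w (p n))"
proof -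
  obtain nxt where nxt: "\<And>v. infinite (branch t v) \<Longrightarrow> infinite (branch t (v @ [nxt v]))"
    using infinite_branch_child by metis
  define f where "f v = v @ [nxt v]" for v
  define p where "p n = (if n \<le> length w then take n w else (f ^^ (n - length w)) w)" for n
  have f: "infinite (branch t ((f ^^ k) w)) \<and> length ((f ^^ k) w) = length w + k \<and> prefix w ((f ^^ k) w)" for k
  proof (induction k)
    case (Suc k)
    have "(f ^^ Suc k) w = (f ^^ k) w @ [nxt ((f ^^ k) w)]" by (simp add: f_def)
    then show ?case using Suc nxt[of "(f ^^ k) w"] by (simp add: prefix_prefix del: funpow.simps)
  qed (use assms in simp)
  have len: "length (p n) = n" for n using f[of "n - length w"] by (auto simp: p_def)
  have inf: "infinite (branch t (p n))" for n
  proof (cases "n \<le> length w")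
    case True
    then show ?thesis using assms infinite_branch_mono[of t "take n w" "drop n w"] by (simp add: p_def)
  next
    case False
    then show ?thesis using f[of "n - length w"] by (simp add: p_def)
  qed
  have step: "\<exists>i. p (Suc n) = p n @ [i]" for n
  proof (cases "n < length w")
    case True
    then show ?thesis by (auto simp: p_def take_Suc_conv_app_nth)
  next
    case False
    then have "p n = (f ^^ (n - length w)) w" "p (Suc n) = (f ^^ Suc (n - length w)) w"
      by (auto simp: p_def Suc_diff_le)
    then show ?thesis by (auto simp: f_def)
  qed
  have "inj p" using len by (metis injI)
  then have "is_spine t p"
    using infinite_branch_in_tree_verts[OF inf] step len[of 0]
    unfolding is_spine_def children_def by auto
  moreover have "p (length w) = w" by (simp add: p_def)
  moreover have "prefix w (p n)" if "length w \<le> n" for n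
    using f[of "n - length w"] that by (auto simp: p_def)
  ultimately show ?thesis by blast
qed

context
  fixes t :: btree
  assumes spine: "single_spine t"
begin

lemma infinite_tree_verts: "infinite (tree_verts t)"
proof -
  obtain p where p: "is_spine t p" using spine by (auto simp: single_spine_def)
  then have "infinite (range p)" by (simp add: is_spine_def range_inj_infinite)
  moreover have "range p \<subseteq> tree_verts t" using p by (auto simp: is_spine_def)
  ultimately show ?thesis using finite_subset by blast
qed

text \<open>The spines through \<open>v\<close> and through \<open>w\<close> coincide, so the deeper
  of the two vertices lies on a spine that stays below the other one.\<close>

lemma infinite_branches_comparable:
  assumes "infinite (branch t v)" "infinite (branch t w)"
  shows "prefix v w \<or> prefix w v"
proof -
  obtain p where p: "is_spine t p" "p (length v) = v" "\<forall>n\<ge>length v. prefix v (p n)"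
    using spine_through_infinite_branch[OF assms(1)] by blast
  obtain q where q: "is_spine t q" "q (length w) = w" "\<forall>n\<ge>length w. prefix w (q n)"
    using spine_through_infinite_branch[OF assms(2)] by blast
  have "p = q" using spine p(1) q(1) unfolding single_spine_def by blast
  then show ?thesis using p q by (metis nat_le_linear)
qed

text \<open>What is cut off along the path to \<open>w\<close> consists of sibling branches, which
  are incomparable with an infinite branch and therefore finite.\<close>

lemma finite_outside_infinite_branch:
  assumes "infinite (branch t w)"
  shows "finite (tree_verts t - branch t w)"
  using assms
proof (induction w rule: rev_induct)
  case Nil
  then show ?case by (simp add: branch_def)
next
  case (snoc i w)
  have "finite (branch t (w @ [j]))" if "j \<noteq> i" for j
    using infinite_branches_comparable[OF snoc.prems, of "w @ [j]"] that by auto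
  then have "finite (\<Union>j\<in>{..<length (slots_at t w)} - {i}. branch t (w @ [j]))" by auto
  moreover have "finite (tree_verts t - branch t w)"
    using snoc.IH infinite_branch_mono[OF snoc.prems] by blast
  moreover have "tree_verts t - branch t (w @ [i]) \<subseteq>
      (tree_verts t - branch t w) \<union> insert w (\<Union>j\<in>{..<length (slots_at t w)} - {i}. branch t (w @ [j]))"
    using branch_unfold[of t w] by auto
  ultimately show ?case by (meson finite_UnI finite_insert finite_subset)
qed

text \<open>Every edge has a finite side. If it is the lower side, an excursion there has to be
  completed; if it is the upper side, the injective walk has to leave it in both time
  directions.\<close>

lemma range_walk_single_spine:
  assumes root: "slots t \<noteq> []"
  shows "range (walk t) = tree_halves t"
proof (rule range_walk_if_crosses[OF root])
  fix v i assume w: "v @ [i] \<in> tree_verts t"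
  let ?w = "v @ [i]"
  have sub: "range (walk t) \<subseteq> tree_halves t" using walk_in[OF root] by auto
  show "Slot v i \<in> range (walk t) \<longleftrightarrow> Up ?w \<in> range (walk t)"
  proof (cases "finite (branch t ?w)")
    case True
    have "range (walk t) \<inter> {h. prefix ?w (half_vertex h)} \<subseteq> {h \<in> tree_halves t. half_vertex h \<in> branch t ?w}"
      using sub half_vertex_in_tree_verts by (auto simp: branch_def)
    then show ?thesis using walk_crosses_both_ways[OF root w] finite_halves_if_finite_verts[OF True]
      by (meson finite_subset)
  next
    case False
    have "range (walk t) \<inter> {h. \<not> prefix ?w (half_vertex h)} \<subseteq>
        {h \<in> tree_halves t. half_vertex h \<in> tree_verts t - branch t ?w}"
      using sub half_vertex_in_tree_verts by (auto simp: branch_def)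
    then have "finite (range (walk t) \<inter> {h. \<not> prefix ?w (half_vertex h)})"
      using finite_halves_if_finite_verts[OF finite_outside_infinite_branch[OF False]] finite_subset by blast
    then show ?thesis
      using walk_crosses_if_finite_outside[OF root w _ inj_walk[OF root infinite_tree_verts]] by blast
  qed
qed

end


section \<open>From stem indices to walk times\<close>

lemma int_Sup_in:
  fixes X :: "int set"
  assumes "X \<noteq> {}" "bdd_above X"
  shows "Sup X \<in> X"
proof -
  obtain x where x: "x \<in> X" "Sup X - 1 < x" using less_cSupD[OF assms(1), of "Sup X - 1"] by auto
  then have "x = Sup X" using cSup_upper[OF x(1) assms(2)] by simp
  then show ?thesis using x by simp
qed

lemma int_Inf_in:
  fixes X :: "int set"
  assumes "X \<noteq> {}" "bdd_below X"
  shows "Inf X \<in> X"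
proof -
  obtain x where x: "x \<in> X" "x < Inf X + 1" using cInf_lessD[OF assms(1), of "Inf X + 1"] by auto
  then have "x = Inf X" using cInf_lower[OF x(1) assms(2)] by simp
  then show ?thesis using x by simp
qed

text \<open>Heights change by at most one per step, so the last time above level \<open>c\<close> is
  at \<open>c + 1\<close> exactly and its step is a closing stem. Extending the interval to the left
  keeps that last time.\<close>

lemma last_descent:
  assumes "i \<le> j" "c < contour_height t i" "contour_height t j \<le> c"
  obtains x where "i \<le> x" "x < j" "contour_height t x = c + 1" "walk t x \<in> closing_stems t"
    "\<And>y. x < y \<Longrightarrow> y \<le> j \<Longrightarrow> contour_height t y \<le> c"
proof -
  have "(\<exists>y\<in>{i..j}. c < contour_height t y) \<longrightarrow> (\<exists>x. i \<le> x \<and> x < j \<and> contour_height t x = c + 1 \<and>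
      walk t x \<in> closing_stems t \<and> (\<forall>y. x < y \<longrightarrow> y \<le> j \<longrightarrow> contour_height t y \<le> c))"
    using assms(1)
  proof (induction i rule: int_le_induct)
    case base
    then show ?case using assms(3) by auto
  next
    case (step i)
    show ?case
    proof (cases "\<exists>y\<in>{i..j}. c < contour_height t y")
      case True
      then obtain x where x: "i \<le> x" "x < j \<and> contour_height t x = c + 1 \<and> walk t x \<in> closing_stems t \<and>
          (\<forall>y. x < y \<longrightarrow> y \<le> j \<longrightarrow> contour_height t y \<le> c)"
        using step.IH by blast
      have "i - 1 \<le> x" using x(1) by simp
      then show ?thesis using x(2) by blast
    next
      case False
      then have le: "contour_height t y \<le> c" if "i - 1 < y" "y \<le> j" for y
      proof -
        have "y \<in> {i..j}" using that by simp
        then show ?thesis using False by (meson linorder_not_le)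
      qed
      show ?thesis
      proof
        assume "\<exists>y\<in>{i - 1..j}. c < contour_height t y"
        then obtain y where y: "i - 1 \<le> y" "y \<le> j" "c < contour_height t y" by auto
        then have "\<not> i - 1 < y" using le[of y] by linarith
        then have "y = i - 1" using y(1) by linarith
        then have "c < contour_height t (i - 1)" using y(3) by simp
        then have "walk t (i - 1) \<in> closing_stems t \<and> contour_height t (i - 1) = c + 1"
          using le[of i] step.hyps contour_height_Suc[of t "i - 1"] by (auto simp: stem_step_def split: if_splits)
        then show "\<exists>x\<ge>i - 1. x < j \<and> contour_height t x = c + 1 \<and> walk t x \<in> closing_stems t \<and>
            (\<forall>y. x < y \<longrightarrow> y \<le> j \<longrightarrow> contour_height t y \<le> c)"
          using le step.hyps by (intro exI[of _ "i - 1"]) auto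
      qed
    qed
  qed
  moreover have "\<exists>y\<in>{i..j}. c < contour_height t y" using assms by auto
  ultimately show ?thesis using that by blast
qed

text \<open>The counterpart in the other direction: the step that first leads above level
  \<open>c\<close> starts at \<open>c\<close> and is an opening stem.\<close>

lemma first_ascent:
  assumes "i \<le> j" "contour_height t i \<le> c" "c < contour_height t j"
  obtains x where "i \<le> x" "x < j" "contour_height t x = c" "walk t x \<in> opening_stems t"
    "\<And>y. i \<le> y \<Longrightarrow> y \<le> x \<Longrightarrow> contour_height t y \<le> c"
proof -
  have "(\<exists>y\<in>{i..j}. c < contour_height t y) \<longrightarrow> (\<exists>x. i \<le> x \<and> x < j \<and> contour_height t x = c \<and>
      walk t x \<in> opening_stems t \<and> (\<forall>y. i \<le> y \<longrightarrow> y \<le> x \<longrightarrow> contour_height t y \<le> c))"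
    using assms(1)
  proof (induction j rule: int_ge_induct)
    case base
    then show ?case using assms(2) by auto
  next
    case (step j)
    show ?case
    proof (cases "\<exists>y\<in>{i..j}. c < contour_height t y")
      case True
      then obtain x where x: "x < j" "i \<le> x \<and> contour_height t x = c \<and> walk t x \<in> opening_stems t \<and>
          (\<forall>y. i \<le> y \<longrightarrow> y \<le> x \<longrightarrow> contour_height t y \<le> c)"
        using step.IH by blast
      have "x < j + 1" using x(1) by simp
      then show ?thesis using x(2) by blast
    next
      case False
      then have le: "contour_height t y \<le> c" if "i \<le> y" "y \<le> j" for y
        using that by (meson atLeastAtMost_iff linorder_not_le)
      show ?thesis
      proof
        assume "\<exists>y\<in>{i..j + 1}. c < contour_height t y"
        then obtain y where y: "i \<le> y" "y \<le> j + 1" "c < contour_height t y" by auto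
        then have "\<not> y \<le> j" using le[of y] by linarith
        then have "y = j + 1" using y(2) by linarith
        then have "c < contour_height t (j + 1)" using y(3) by simp
        then have "walk t j \<in> opening_stems t \<and> contour_height t j = c"
          using le[of j] step.hyps contour_height_Suc[of t j] by (auto simp: stem_step_def split: if_splits)
        then show "\<exists>x\<ge>i. x < j + 1 \<and> contour_height t x = c \<and> walk t x \<in> opening_stems t \<and>
            (\<forall>y\<ge>i. y \<le> x \<longrightarrow> contour_height t y \<le> c)"
          using le step.hyps by (intro exI[of _ j]) auto
      qed
    qed
  qed
  moreover have "\<exists>y\<in>{i..j}. c < contour_height t y" using assms by auto
  ultimately show ?thesis using that by blast
qed

lemma contour_Suc: "contour t (k + 1) = contour t k + (if closing_at t k then - 1 else 1)"
  using walk_sum_Suc[of "\<lambda>j. if closing_at t j then - 1 else 1" k]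
  by (simp add: contour_def walk_sum_def)

text \<open>The time of the walk at which the stem of index \<open>k\<close> is met. Position
  \<open>i\<close> of the left walk is time \<open>- i - 1\<close> of the walk, whence the final
  \<open>- 1\<close>.\<close>

definition stem_time :: "btree \<Rightarrow> int \<Rightarrow> int" where
  "stem_time t k = (if 0 \<le> k then int (Infinite_Set.enumerate (right_times t) (nat k))
                    else - int (Infinite_Set.enumerate (left_times t) (nat (- k - 1))) - 1)"

context
  fixes t :: btree
  assumes root: "slots t \<noteq> []" and right: "infinite (right_times t)" and left: "infinite (left_times t)"
begin

lemma walk_stem_time: "walk t (stem_time t k) = stem_at t k" "stem_at t k \<in> stems t"
proof -
  have "walk t (stem_time t k) = stem_at t k \<and> stem_at t k \<in> stems t"
  proof (cases "0 \<le> k")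
    case True
    then show ?thesis
      using enumerate_in_set[OF right, of "nat k"] by (simp add: stem_time_def stem_at_def walk_def right_times_def)
  next
    case False
    then show ?thesis
      using enumerate_in_set[OF left, of "nat (- k - 1)"]
      by (simp add: stem_time_def stem_at_def walk_def left_times_def edge_opp_def)
  qed
  then show "walk t (stem_time t k) = stem_at t k" "stem_at t k \<in> stems t" by auto
qed

lemma stem_time_less: "stem_time t k < stem_time t l" if "k < l"
proof -
  consider "0 \<le> k" | "k < 0" "0 \<le> l" | "l < 0" by linarith
  then show ?thesis
  proof cases
    case 1
    then show ?thesis using enumerate_mono[of "nat k" "nat l", OF _ right] that by (simp add: stem_time_def)
  next
    case 3
    then show ?thesis using enumerate_mono[of "nat (- l - 1)" "nat (- k - 1)", OF _ left] that
      by (simp add: stem_time_def)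
  qed (simp add: stem_time_def)
qed

lemma stem_time_less_iff: "stem_time t k < stem_time t l \<longleftrightarrow> k < l"
  using stem_time_less by (metis linorder_neqE not_less_iff_gr_or_eq)

lemma stem_time_surj:
  assumes "walk t n \<in> stems t"
  shows "\<exists>k. stem_time t k = n"
proof (cases "0 \<le> n")
  case True
  then have "nat n \<in> right_times t" using assms by (simp add: walk_def right_times_def)
  then obtain k where "Infinite_Set.enumerate (right_times t) k = nat n" using enumerate_Ex[OF right] by blast
  then have "stem_time t (int k) = n" using True by (simp add: stem_time_def)
  then show ?thesis ..
next
  case False
  then have "nat (- n - 1) \<in> left_times t"
    using assms edge_opp(3)[OF left_walk_in[OF root]] by (simp add: walk_def left_times_def)
  then obtain k where "Infinite_Set.enumerate (left_times t) k = nat (- n - 1)" using enumerate_Ex[OF left] by blast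
  then have "stem_time t (- int k - 1) = n" using False by (simp add: stem_time_def)
  then show ?thesis ..
qed

lemma contour_height_constant:
  assumes "a \<le> b" "\<And>n. a \<le> n \<Longrightarrow> n < b \<Longrightarrow> walk t n \<notin> stems t"
  shows "contour_height t b = contour_height t a"
  using assms
proof (induction b rule: int_ge_induct)
  case (step b)
  then show ?case using contour_height_Suc[of t b] by simp
qed simp

text \<open>Between two consecutive stems the walk meets only tree edges, which leave the height
  unchanged. The matching compares heights only through differences, so an additive constant is
  harmless.\<close>

lemma contour_height_stem_time:
  "contour_height t (stem_time t k) = contour_height t (stem_time t 0) + contour t k"
proof -
  have step: "contour_height t (stem_time t (k + 1)) - contour t (k + 1) = contour_height t (stem_time t k) - contour t k" for k
  proof -
    have "contour_height t (stem_time t (k + 1)) = contour_height t (stem_time t k + 1)"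
    proof (rule contour_height_constant)
      show "stem_time t k + 1 \<le> stem_time t (k + 1)" using stem_time_less[of k "k + 1"] by simp
      fix n assume n: "stem_time t k + 1 \<le> n" "n < stem_time t (k + 1)"
      show "walk t n \<notin> stems t"
      proof
        assume "walk t n \<in> stems t"
        then obtain l where "stem_time t l = n" using stem_time_surj by blast
        then have "k < l" "l < k + 1" using n stem_time_less_iff[of k l] stem_time_less_iff[of l "k + 1"] by auto
        then show False by simp
      qed
    qed
    moreover have "stem_step t (stem_at t k) = (if closing_at t k then - 1 else 1)"
      using walk_stem_time(2)[of k] stems_cases by (auto simp: closing_at_def stem_step_def)
    ultimately show ?thesis using contour_height_Suc[of t "stem_time t k"] contour_Suc[of t k] walk_stem_time(1) by simp
  qed
  show ?thesis
  proof (induction k rule: int_bi_induct)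
    case zero
    then show ?case by (simp add: contour_def)
  next
    case (up k)
    then show ?case using step[of k] by simp
  next
    case (down k)
    then show ?case using step[of "k - 1"] by simp
  qed
qed

text \<open>The partner is the nearest stem of the right kind at the right level. A violation of the
  height bound in between would force a level crossing at another such stem, nearer to
  \<open>k\<close>.\<close>

lemma matched_stem_matching:
  assumes "partners t k \<noteq> {}"
  shows "opening_at t k \<Longrightarrow> matched t (stem_time t (stem_matching t k)) (stem_time t k)"
    and "\<not> opening_at t k \<Longrightarrow> matched t (stem_time t k) (stem_time t (stem_matching t k))"
proof -
  note w = walk_stem_time(1) and H = contour_height_stem_time
  let ?j = "stem_matching t k"
  {
    assume o: "opening_at t k"
    then have P: "partners t k = {j. j < k \<and> closing_at t j \<and> contour t j = contour t k + 1}"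
      by (simp add: partners_def)
    have bdd: "bdd_above (partners t k)" unfolding P by (rule bdd_aboveI[of _ k]) simp
    then have j: "?j \<in> partners t k" using int_Sup_in[OF assms] o by (simp add: stem_matching_def)
    have "contour_height t i \<le> contour_height t (stem_time t k)" if i: "i \<in> {stem_time t ?j<..stem_time t k}" for i
    proof (rule ccontr)
      assume "\<not> ?thesis"
      then obtain x where x: "i \<le> x" "x < stem_time t k" "walk t x \<in> closing_stems t"
        "contour_height t x = contour_height t (stem_time t k) + 1"
        using last_descent[of i "stem_time t k" "contour_height t (stem_time t k)" t thesis] i by simp
      obtain l where l: "stem_time t l = x" using stem_time_surj x(3) stems_cases by blast
      then have "?j < l" "l < k" using i x stem_time_less_iff[of ?j l] stem_time_less_iff[of l k] by auto
      moreover have "l \<in> partners t k" using P l x H[of l] H[of k] w[of l] \<open>l < k\<close> by (auto simp: closing_at_def)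
      ultimately show False using cSup_upper[OF _ bdd] o by (force simp: stem_matching_def)
    qed
    then show "matched t (stem_time t ?j) (stem_time t k)"
      using j P o stem_time_less[of ?j k] H[of ?j] H[of k] w
      by (auto simp: matched_def closing_at_def opening_at_def)
  }
  {
    assume o: "\<not> opening_at t k"
    then have c: "closing_at t k" using walk_stem_time(2)[of k] stems_cases by (auto simp: closing_at_def opening_at_def)
    have P: "partners t k = {j. k < j \<and> opening_at t j \<and> contour t j = contour t k - 1}"
      using o by (simp add: partners_def)
    have bdd: "bdd_below (partners t k)" unfolding P by (rule bdd_belowI[of _ k]) simp
    then have j: "?j \<in> partners t k" using int_Inf_in[OF assms] o by (simp add: stem_matching_def)
    then have hj: "contour_height t (stem_time t ?j) = contour_height t (stem_time t k) - 1"
      using P H[of ?j] H[of k] by auto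
    have "contour_height t i \<le> contour_height t (stem_time t ?j)" if i: "i \<in> {stem_time t k<..stem_time t ?j}" for i
    proof (rule ccontr)
      assume "\<not> ?thesis"
      moreover have "contour_height t (stem_time t k + 1) = contour_height t (stem_time t ?j)"
        using contour_height_Suc[of t "stem_time t k"] w[of k] c hj by (simp add: closing_at_def)
      ultimately obtain x where x: "stem_time t k + 1 \<le> x" "x < i" "walk t x \<in> opening_stems t"
        "contour_height t x = contour_height t (stem_time t ?j)"
        using first_ascent[of "stem_time t k + 1" i t "contour_height t (stem_time t ?j)" thesis] i by simp
      obtain l where l: "stem_time t l = x" using stem_time_surj x(3) stems_cases by blast
      then have "k < l" "l < ?j" using i x stem_time_less_iff[of k l] stem_time_less_iff[of l ?j] by auto
      moreover have "l \<in> partners t k" using P l x hj H[of l] H[of k] w[of l] \<open>k < l\<close> by (auto simp: opening_at_def)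
      ultimately show False using cInf_lower[OF _ bdd] o by (force simp: stem_matching_def)
    qed
    then show "matched t (stem_time t k) (stem_time t ?j)"
      using j P c hj stem_time_less[of k ?j] w
      by (auto simp: matched_def closing_at_def opening_at_def)
  }
qed

end

text \<open>The walk is injective here, so equal half-edges mean equal times, and the index of a
  stem, which \<open>closure_map\<close> selects by a definite description, is unique.\<close>

lemma closable_single_spine:
  assumes root: "slots t \<noteq> []" and spine: "single_spine t" and matching: "has_matching t"
  shows "closable t" "glued_map t = closure_map t"
proof -
  have inf: "infinite (right_times t)" "infinite (left_times t)" and partners: "partners t k \<noteq> {}" for k
    using matching by (auto simp: has_matching_def)
  note w = walk_stem_time[OF root inf] and surj = stem_time_surj[OF root inf]
    and M = matched_stem_matching[OF root inf partners]
  have range: "range (walk t) = tree_halves t" by (rule range_walk_single_spine[OF spine root])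
  have inj: "inj (walk t)" by (rule inj_walk[OF root infinite_tree_verts[OF spine]])
  have stem: "matched t (stem_time t k) (stem_time t (stem_matching t k)) \<or>
      matched t (stem_time t (stem_matching t k)) (stem_time t k)" for k
    using M[of k] by blast
  show c: "closable t"
    unfolding closable_def
  proof (intro conjI allI impI)
    fix n assume "walk t n \<in> stems t"
    then obtain k where "stem_time t k = n" using surj by blast
    then show "\<exists>m. matched t n m \<or> matched t m n" using stem[of k] by blast
  next
    fix n m assume "walk t n = walk t m"
    then show "contour_height t n = contour_height t m" using inj by (simp add: inj_eq)
  qed (use root range in auto)
  have "stem_mate t h = stem_at t (stem_matching t (THE k. stem_at t k = h))" if h: "h \<in> stems t" for h
  proof -
    have "h \<in> range (walk t)" unfolding range using h stems_subset by auto
    then obtain n where "walk t n = h" by auto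
    then obtain k where k: "stem_at t k = h" using surj h w(1) by metis
    have "(THE k. stem_at t k = h) = k"
    proof (rule the_equality)
      show "stem_at t k = h" by (rule k)
      fix l assume "stem_at t l = h"
      then have "stem_time t l = stem_time t k" using k w(1) inj by (metis injD)
      then show "l = k" using stem_time_less[OF root inf, of l k] stem_time_less[OF root inf, of k l]
        by (cases l k rule: linorder_cases) auto
    qed
    moreover have "mates t h (stem_at t (stem_matching t k))"
      unfolding mates_def using stem[of k] w(1) k by blast
    ultimately show ?thesis using stem_mate_eq[OF c] by simp
  qed
  then show "glued_map t = closure_map t"
    by (auto simp: glued_map_def closure_map_def fun_eq_iff)
qed

section \<open>Orbits of a noncrossing matching\<close>

text \<open>Composing with the transposition of two points of one cycle cuts that cycle in two and
  leaves the others alone.\<close>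

lemma card_orbits_transpose:
  assumes p: "p permutes S" and fin: "finite S" and xS: "x \<in> S" and xy: "x \<noteq> y" and y: "y \<in> orbit p x"
  shows "card (orbit (p \<circ> Transposition.transpose x y) ` S) = Suc (card (orbit p ` S))"
proof -
  define q where "q = p \<circ> Transposition.transpose x y"
  define N where "N = funpow_dist1 p x x"
  have self: "z \<in> orbit p z" for z
    by (rule permutation_self_in_orbit) (use p fin permutation_permutes in blast)
  have O: "orbit p x = (\<lambda>n. (p ^^ n) x) ` {0..<N}" unfolding N_def by (rule orbit_conv_funpow_dist1[OF self])
  have inj: "inj_on (\<lambda>n. (p ^^ n) x) {0..<N}" unfolding N_def by (rule inj_on_funpow_dist1[OF self])
  have pN: "(p ^^ N) x = x" unfolding N_def by (rule funpow_dist1_prop[OF self])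
  obtain j where j: "j < N" "y = (p ^^ j) x" using y O by auto
  have j0: "0 < j" using j xy by (cases j) auto
  \<comment> \<open>The cycle of \<open>x\<close> is cut into the arc that ends at \<open>y\<close>
    and the arc from there back to \<open>x\<close>. The new permutation sends \<open>y\<close> to
    \<open>p x\<close> and \<open>x\<close> to \<open>p y\<close>, so each arc closes up.\<close>
  define A where "A = (\<lambda>n. (p ^^ n) x) ` {1..j}"
  define B where "B = (\<lambda>n. (p ^^ n) x) ` {j<..N}"
  have neq: "(p ^^ n) x \<noteq> (p ^^ m) x" if "n \<in> {0..<N}" "m \<in> {0..<N}" "n \<noteq> m" for n m
    using inj_onD[OF inj, of n m] that by blast
  have q: "q z = p z" if "z \<noteq> x" "z \<noteq> y" for z using that by (simp add: q_def Transposition.transpose_def)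
  have qA: "(q ^^ k) y = (p ^^ k) x" if "1 \<le> k" "k \<le> j" for k
    using that
  proof (induction k rule: dec_induct)
    case base
    then show ?case by (simp add: q_def)
  next
    case (step k)
    then have "(p ^^ k) x \<noteq> x" "(p ^^ k) x \<noteq> y" using neq[of k 0] neq[of k j] j by auto
    then show ?case using step q by simp
  qed
  have qB: "(q ^^ (k - j)) x = (p ^^ k) x" if "Suc j \<le> k" "k \<le> N" for k
    using that
  proof (induction k rule: dec_induct)
    case base
    then show ?case using j by (simp add: q_def)
  next
    case (step k)
    then have "(p ^^ k) x \<noteq> x" "(p ^^ k) x \<noteq> y" using neq[of k 0] neq[of k j] j by auto
    then show ?case using step q by (simp add: Suc_diff_le)
  qed
  have qy: "(q ^^ j) y = y" using qA[of j] j j0 by simp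
  have qx: "(q ^^ (N - j)) x = x" using qB[of N] j pN by simp
  have orbA: "orbit q y = A"
  proof -
    have "orbit q y = {(q ^^ m) y | m. m < j}" by (rule orbit_altdef_bounded[OF qy j0])
    also have "\<dots> = (\<lambda>m. (q ^^ m) y) ` {0..<j}" by auto
    also have "\<dots> = (\<lambda>m. (q ^^ m) y) ` {1..j}"
    proof -
      have "{0..<j} = insert 0 {1..<j}" "{1..j} = insert j {1..<j}" using j0 by auto
      then show ?thesis using qy by simp
    qed
    also have "\<dots> = A" unfolding A_def by (rule image_cong) (use qA in auto)
    finally show ?thesis .
  qed
  have orbB: "orbit q x = B"
  proof -
    have "orbit q x = {(q ^^ m) x | m. m < N - j}" by (rule orbit_altdef_bounded[OF qx]) (use j in simp)
    also have "\<dots> = (\<lambda>m. (q ^^ m) x) ` {0..<N - j}" by auto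
    also have "\<dots> = (\<lambda>m. (q ^^ m) x) ` {1..N - j}"
    proof -
      have "{0..<N - j} = insert 0 {1..<N - j}" "{1..N - j} = insert (N - j) {1..<N - j}" using j by auto
      then show ?thesis using qx by simp
    qed
    also have "\<dots> = (\<lambda>k. (q ^^ (k - j)) x) ` {j<..N}"
    proof -
      have "{1..N - j} = (\<lambda>k. k - j) ` {j<..N}"
      proof
        show "{1..N - j} \<subseteq> (\<lambda>k. k - j) ` {j<..N}"
        proof
          fix m assume "m \<in> {1..N - j}"
          then show "m \<in> (\<lambda>k. k - j) ` {j<..N}" by (intro image_eqI[of _ _ "m + j"]) auto
        qed
      qed auto
      then show ?thesis by (simp add: image_image)
    qed
    also have "\<dots> = B" unfolding B_def by (rule image_cong) (use qB in auto)
    finally show ?thesis .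
  qed
  have AB: "A \<union> B = orbit p x"
  proof -
    have "{1..j} \<union> {j<..N} = insert N {1..<N}" "{0..<N} = insert 0 {1..<N}" using j by auto
    then show ?thesis unfolding A_def B_def O image_Un[symmetric] using pN by simp
  qed
  have disj: "A \<inter> B = {}"
  proof -
    have "(p ^^ n) x \<noteq> (p ^^ m) x" if "n \<in> {1..j}" "m \<in> {j<..N}" for n m
      using neq[of n m] neq[of n 0] that j pN by (cases "m = N") auto
    then show ?thesis unfolding A_def B_def by blast
  qed
  have yA: "y \<in> A" using j j0 by (auto simp: A_def)
  have xB: "x \<in> B" unfolding B_def by (rule image_eqI[of _ _ N]) (use pN j in auto)
  have swap: "orbit p w = orbit p z" if "w \<in> orbit p z" for w z
    using that orbit_swap[OF self that] by (meson orbit_trans subsetI subset_antisym)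
  have outside: "orbit q z = orbit p z" if z: "z \<notin> orbit p x" for z
  proof (rule orbit_cong[OF self])
    fix s assume s: "s \<in> orbit p z"
    have "s \<noteq> x \<and> s \<noteq> y" using swap[OF s] swap[OF y] self z by metis
    then show "q s = p s" using q by blast
  qed
  have inA: "orbit q z = A" if "z \<in> A" for z
    using that orbA cyclic_on_singleI[OF yA orbA[symmetric]] orbit_cyclic_eq3 by metis
  have inB: "orbit q z = B" if "z \<in> B" for z
    using that orbB cyclic_on_singleI[OF xB orbB[symmetric]] orbit_cyclic_eq3 by metis
  have ySx: "y \<in> S" using permutes_orbit_subset[OF p xS] y by blast
  let ?rest = "orbit p ` S - {orbit p x}"
  have "orbit q ` S = {A, B} \<union> ?rest"
  proof
    show "orbit q ` S \<subseteq> {A, B} \<union> ?rest"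
    proof
      fix X assume "X \<in> orbit q ` S"
      then obtain z where z: "z \<in> S" "X = orbit q z" by auto
      show "X \<in> {A, B} \<union> ?rest"
      proof (cases "z \<in> orbit p x")
        case True
        then show ?thesis using z AB inA inB by blast
      next
        case False
        then have "orbit p z \<noteq> orbit p x" using self by metis
        then show ?thesis using z outside[OF False] by auto
      qed
    qed
    show "{A, B} \<union> ?rest \<subseteq> orbit q ` S"
    proof
      fix X assume X: "X \<in> {A, B} \<union> ?rest"
      show "X \<in> orbit q ` S"
      proof (cases "X \<in> ?rest")
        case True
        then obtain z where z: "z \<in> S" "X = orbit p z" "orbit p z \<noteq> orbit p x" by auto
        then have "z \<notin> orbit p x" using swap by blast
        then show ?thesis using outside[of z] z by (metis imageI)
      next
        case False
        then show ?thesis using X orbA orbB xS ySx by auto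
      qed
    qed
  qed
  moreover have "A \<noteq> B" using disj yA by auto
  moreover have "A \<notin> ?rest" "B \<notin> ?rest"
  proof -
    have "X = orbit p x" if "X \<in> orbit p ` S" "w \<in> X" "w \<in> orbit p x" for X w
      using that swap by blast
    then show "A \<notin> ?rest" "B \<notin> ?rest" using AB yA xB by blast+
  qed
  ultimately have "card (orbit q ` S) = 2 + card ?rest" using fin by (simp add: card_insert_if)
  moreover have "Suc (card ?rest) = card (orbit p ` S)"
    using fin xS by (metis card_Suc_Diff1 finite_imageI imageI)
  ultimately show ?thesis by (simp add: q_def)
qed

text \<open>The induction adds the pairs by decreasing length, so that both points of a new pair lie on
  the same cycle.\<close>

lemma card_orbits_noncrossing:
  fixes f :: "'a \<Rightarrow> 'a" and e :: "nat \<Rightarrow> 'a" and M :: "(nat \<times> nat) set"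
  assumes e: "bij_betw e {..<N} S" "0 < N" "e N = e 0" "\<And>i. i < N \<Longrightarrow> f (e i) = e (Suc i)"
    and f: "f permutes S"
    and "s permutes S" and "finite M"
    and "\<And>a b. (a, b) \<in> M \<Longrightarrow> a < b \<and> b < N \<and> s (e a) = e b \<and> s (e b) = e a"
    and "\<And>a b c d. (a, b) \<in> M \<Longrightarrow> (c, d) \<in> M \<Longrightarrow> (a, b) \<noteq> (c, d) \<Longrightarrow> {a, b} \<inter> {c, d} = {}"
    and "\<And>a b c d. (a, b) \<in> M \<Longrightarrow> (c, d) \<in> M \<Longrightarrow> a < c \<Longrightarrow> c < b \<Longrightarrow> d \<le> b"
    and "\<And>i. i < N \<Longrightarrow> i \<notin> fst ` M \<union> snd ` M \<Longrightarrow> s (e i) = e i"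
  shows "card (orbit (f \<circ> s) ` S) = Suc (card M)"
  using assms(6-)
proof (induction "card M" arbitrary: M s)
  case 0
  have S: "S = e ` {..<N}" using e(1) by (simp add: bij_betw_def)
  have M: "M = {}" using 0 by simp
  have fs: "f permutes S" "(f \<circ> s) z = f z" if "z \<in> S" for z
    using f that "0.prems"(6) S M by auto
  have pow: "(f ^^ n) (e 0) = e n" if "n \<le> N" for n
    using that by (induction n) (use e(4) in auto)
  then have "(f ^^ N) (e 0) = e 0" using e(3) by simp
  then have "orbit f (e 0) = {(f ^^ m) (e 0) | m. m < N}" by (rule orbit_altdef_bounded[OF _ e(2)])
  also have "\<dots> = (\<lambda>m. (f ^^ m) (e 0)) ` {..<N}" by auto
  also have "\<dots> = S" unfolding S by (rule image_cong) (use pow in auto)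
  finally have orb: "S = orbit f (e 0)" ..
  then have cyc: "cyclic_on f S" using e(2) S by (intro cyclic_on_singleI[of "e 0"]) auto
  have "orbit (f \<circ> s) z = S" if z: "z \<in> S" for z
  proof -
    have "orbit f z = orbit (f \<circ> s) z"
      by (rule orbit_cong0[OF z]) (use fs permutes_in_image[OF f] in auto)
    then show ?thesis using orbit_cyclic_eq3[OF cyc z] by simp
  qed
  then have "orbit (f \<circ> s) ` S = {S}" using e(2) S by auto
  then show ?case by (metis M card.empty is_singletonI is_singleton_altdef One_nat_def)
next
  case (Suc n)
  have S: "S = e ` {..<N}" and einj: "inj_on e {..<N}" using e(1) by (auto simp: bij_betw_def)
  have finS: "finite S" using S by simp
  have "M \<noteq> {}" using Suc.hyps(2) by auto
  then obtain ab where ab: "ab \<in> M" "\<And>cd. cd \<in> M \<Longrightarrow> snd ab - fst ab \<le> snd cd - fst cd"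
    using ex_is_arg_min_if_finite[OF Suc.prems(2), of "\<lambda>p. snd p - fst p"]
    unfolding is_arg_min_linorder by blast
  obtain a b where abeq: "ab = (a, b)" by (cases ab)
  have short: "b - a \<le> d - c" if "(c, d) \<in> M" for c d
    using ab(2)[of "(c, d)"] that abeq by auto
  have abM: "(a, b) \<in> M" using ab abeq by simp
  note AB = Suc.prems(3)[OF abM]
  define M' where "M' = M - {(a, b)}"
  \<comment> \<open>Since \<open>s\<close> exchanges the two points, this composition unlinks the
    pair \<open>(a, b)\<close> and changes nothing else.\<close>
  define s' where "s' = s \<circ> Transposition.transpose (e a) (e b)"
  have eS: "e i \<in> S" if "i < N" for i using that S by auto
  have eq: "e i = e j \<longleftrightarrow> i = j" if "i < N" "j < N" for i j using einj that by (auto simp: inj_on_eq_iff)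
  have s'a: "s' (e a) = e a" "s' (e b) = e b" using AB by (auto simp: s'_def)
  have s'o: "s' (e i) = s (e i)" if "i < N" "i \<noteq> a" "i \<noteq> b" for i
    using that AB eq[of i a] eq[of i b] by (auto simp: s'_def Transposition.transpose_def)
  have tr: "s' \<circ> Transposition.transpose (e a) (e b) = s" by (simp add: s'_def fun_eq_iff)
  have perm: "s' permutes S"
    unfolding s'_def using AB eS by (intro permutes_compose[OF permutes_swap_id] Suc.prems(1)) auto
  have M'M: "(c, d) \<in> M \<and> c \<noteq> a \<and> c \<noteq> b \<and> d \<noteq> a \<and> d \<noteq> b" if "(c, d) \<in> M'" for c d
    using that Suc.prems(4)[OF abM, of c d] by (auto simp: M'_def)
  have IH: "card (orbit (f \<circ> s') ` S) = Suc (card M')"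
  proof (rule Suc.hyps(1))
    show "n = card M'" using Suc.hyps(2) abM Suc.prems(2) by (simp add: M'_def)
    show "s' permutes S" by (rule perm)
    show "finite M'" using Suc.prems(2) by (simp add: M'_def)
    show "c < d \<and> d < N \<and> s' (e c) = e d \<and> s' (e d) = e c" if "(c, d) \<in> M'" for c d
      using M'M[OF that] Suc.prems(3)[of c d] s'o[of c] s'o[of d] by auto
    show "{c, d} \<inter> {c', d'} = {}" if "(c, d) \<in> M'" "(c', d') \<in> M'" "(c, d) \<noteq> (c', d')" for c d c' d'
      using that Suc.prems(4) by (auto simp: M'_def)
    show "d' \<le> d" if "(c, d) \<in> M'" "(c', d') \<in> M'" "c < c'" "c' < d" for c d c' d'
      using that Suc.prems(5) by (auto simp: M'_def)
    show "s' (e i) = e i" if i: "i < N" "i \<notin> fst ` M' \<union> snd ` M'" for i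
    proof (cases "i = a \<or> i = b")
      case False
      then have "i \<notin> fst ` M \<union> snd ` M" using i(2) by (force simp: M'_def)
      then show ?thesis using Suc.prems(6)[OF i(1)] s'o i(1) False by simp
    qed (use s'a in auto)
  qed
  \<comment> \<open>By noncrossing, a pair with an end strictly between \<open>a\<close> and
    \<open>b\<close> would be nested in \<open>(a, b)\<close>, hence shorter than the shortest one.
    So \<open>f o s'\<close> simply follows \<open>e\<close> from \<open>e a\<close> to
    \<open>e b\<close>, which puts them on one cycle.\<close>
  have inside: "s' (e i) = e i" if i: "a \<le> i" "i < b" for i
  proof (cases "i = a")
    case False
    have "i \<notin> fst ` M \<union> snd ` M"
    proof
      assume "i \<in> fst ` M \<union> snd ` M"
      then obtain c d where cd: "(c, d) \<in> M" "i = c \<or> i = d" by force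
      have dis: "{a, b} \<inter> {c, d} = {}" using Suc.prems(4)[OF abM cd(1)] cd(2) i False by auto
      have lt: "c < d" using Suc.prems(3)[OF cd(1)] by simp
      from cd(2) show False
      proof
        assume c: "i = c"
        then have "d \<le> b" using Suc.prems(5)[OF abM cd(1)] i False by simp
        then show False using short[OF cd(1)] c i dis lt False by auto
      next
        assume d: "i = d"
        show False
        proof (cases "c < a")
          case True
          then have "b \<le> d" using Suc.prems(5)[OF cd(1) abM] d i False by simp
          then show False using d i by simp
        next
          case False
          then show False using short[OF cd(1)] d i dis lt by auto
        qed
      qed
    qed
    then show ?thesis using Suc.prems(6)[of i] s'o[of i] i AB False by auto
  qed (use s'a in simp)
  have "((f \<circ> s') ^^ k) (e a) = e (a + k)" if "k \<le> b - a" for k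
    using that by (induction k) (use inside e(4) AB in auto)
  then have pow: "((f \<circ> s') ^^ (b - a)) (e a) = e b" using AB by simp
  have "0 < b - a" using AB by simp
  then have "e b \<in> orbit (f \<circ> s') (e a)" unfolding orbit_altdef
    using pow by (intro CollectI exI[of _ "b - a"]) simp
  then have "card (orbit ((f \<circ> s') \<circ> Transposition.transpose (e a) (e b)) ` S) = Suc (card (orbit (f \<circ> s') ` S))"
    using AB eS eq by (intro card_orbits_transpose permutes_compose[OF perm f] finS) auto
  moreover have "(f \<circ> s') \<circ> Transposition.transpose (e a) (e b) = f \<circ> s" using tr by (simp add: comp_assoc)
  moreover have "card M = Suc (card M')" using card_Suc_Diff1[OF Suc.prems(2) abM] by (simp add: M'_def)
  ultimately show ?case using IH by simp
qed

section \<open>Closure of finite trees\<close>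

text \<open>Charge 0 at the root in terms of cardinalities. The condition on the root excludes the
  tree without half-edges, where there is nothing to walk on.\<close>

definition balanced :: "btree \<Rightarrow> bool" where
  "balanced t \<longleftrightarrow> finite (tree_verts t) \<and> slots t \<noteq> [] \<and> card (closing_stems t) = card (opening_stems t)"

section \<open>The periodic contour of a balanced tree\<close>

context
  fixes t :: btree
  assumes bal: "balanced t"
begin

lemma balanced_root: "slots t \<noteq> []"
  using bal by (simp add: balanced_def)

lemma finite_halves: "finite (tree_halves t)"
  using bal finite_tree_verts_iff_halves[OF balanced_root] by (simp add: balanced_def)

lemma finite_stems: "finite (closing_stems t)" "finite (opening_stems t)"
  by (rule finite_subset[OF _ finite_halves]; auto simp: closing_stems_def opening_stems_def stems_def)+

text \<open>The period is the least positive return time to the root slot; by minimality, a period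
  visits each half-edge exactly once.\<close>

lemma walk_period:
  obtains N :: nat where "0 < N" "\<And>n. walk t (n + int N) = walk t n" "inj_on (walk t) {0..<int N}"
    "walk t ` {0..<int N} = tree_halves t"
proof -
  note root = balanced_root
  have "range (walk t) \<subseteq> tree_halves t" using walk_in[OF root] by auto
  then obtain j k where jk: "j < k" "walk t j = walk t k"
    using walk_repeats_on_finite[OF root finite_halves infinite_UNIV_int] walk_in[OF root] by metis
  have "walk t 0 = walk t (int (nat (k - j)))" using walk_shift[OF root jk(2), of "- j"] jk(1) by simp
  then have ex: "\<exists>n. 0 < n \<and> walk t 0 = walk t (int n)" using jk(1) by (intro exI[of _ "nat (k - j)"]) simp
  define N where "N = (LEAST n. 0 < n \<and> walk t 0 = walk t (int n))"
  have N: "0 < N" "walk t 0 = walk t (int N)" using LeastI_ex[OF ex] unfolding N_def by auto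
  have least: "\<not> (0 < n \<and> walk t 0 = walk t (int n))" if "n < N" for n
    using that not_less_Least unfolding N_def by blast
  have "walk t (n + int N) = walk t n" for n
    using walk_shift[OF root N(2), of n] by (simp add: add.commute)
  moreover have "inj_on (walk t) {0..<int N}"
  proof (rule inj_onI)
    have no: "\<not> a < b" if "a \<in> {0..<int N}" "b \<in> {0..<int N}" "walk t a = walk t b" for a b
    proof
      assume "a < b"
      then have "nat (b - a) < N" "0 < nat (b - a)" using that(1,2) by auto
      then show False using least[of "nat (b - a)"] walk_shift[OF root that(3), of "- a"] \<open>a < b\<close> by simp
    qed
    fix a b assume "a \<in> {0..<int N}" "b \<in> {0..<int N}" "walk t a = walk t b"
    then show "a = b" using no[of a b] no[of b a] by simp
  qed
  moreover have "walk t ` {0..<int N} = tree_halves t"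
    using finite_if_walk_repeats(1,2)[OF root N(2)] N(1) by simp
  ultimately show ?thesis using that N(1) by blast
qed

context
  fixes N :: nat
  assumes N: "0 < N" and period: "\<And>n. walk t (n + int N) = walk t n"
    and inj: "inj_on (walk t) {0..<int N}" and range: "walk t ` {0..<int N} = tree_halves t"
begin

text \<open>The increment over one period sums \<open>stem_step\<close> over all half-edges, which
  gives the opening stems minus the closing ones, that is 0.\<close>

lemma contour_height_period: "contour_height t (n + int N) = contour_height t n"
proof (induction n rule: int_bi_induct)
  case zero
  have "contour_height t (int N) = (\<Sum>j\<in>{0..<int N}. stem_step t (walk t j))"
    by (simp add: contour_height_def walk_sum_def)
  also have "\<dots> = (\<Sum>h\<in>tree_halves t. stem_step t h)"
    using sum.reindex[OF inj, of "stem_step t"] range by simp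
  also have "\<dots> = (\<Sum>h\<in>closing_stems t \<union> opening_stems t. stem_step t h)"
    using stems_cases stems_subset
    by (intro sum.mono_neutral_right[OF finite_halves]) auto
  also have "\<dots> = 0"
    using bal finite_stems closing_opening_disjoint[of _ t]
    by (subst sum.union_disjoint) (auto simp: balanced_def)
  finally show ?case by simp
next
  case (up n)
  then show ?case using contour_height_Suc[of t n] contour_height_Suc[of t "n + int N"] period[of n]
    by (simp add: algebra_simps)
next
  case (down n)
  then show ?case
    using contour_height_Suc[of t "n - 1"] contour_height_Suc[of t "n - 1 + int N"] period[of "n - 1"]
    by (simp add: algebra_simps)
qed

lemma walk_eq_iff: "walk t n = walk t m \<longleftrightarrow> n mod int N = m mod int N"
proof -
  have "walk t x = walk t (x mod int N)" for x
    using periodic_int[of "walk t" "int N" "x mod int N" "x div int N"] period by (simp add: mod_div_mult_eq)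
  moreover have "x mod int N \<in> {0..<int N}" for x using N by simp
  ultimately show ?thesis using inj by (metis inj_on_def)
qed

text \<open>Heights are periodic, so the level of a stem is reached again within one period on
  either side; the nearest level crossing gives the partner.\<close>

lemma closable_balanced: "closable t"
  unfolding closable_def
proof (intro conjI allI impI balanced_root)
  show "tree_halves t \<subseteq> range (walk t)" using range by auto
next
  fix n m assume "walk t n = walk t m"
  then have "n mod int N = m mod int N" by (simp add: walk_eq_iff)
  moreover have "contour_height t x = contour_height t (x mod int N)" for x
    using periodic_int[of "contour_height t" "int N" "x mod int N" "x div int N"] contour_height_period
    by (simp add: mod_div_mult_eq)
  ultimately show "contour_height t n = contour_height t m" by metis
next
  fix n assume "walk t n \<in> stems t"
  then consider "walk t n \<in> closing_stems t" | "walk t n \<in> opening_stems t" using stems_cases by blast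
  then show "\<exists>m. matched t n m \<or> matched t m n"
  proof cases
    case 1
    define c where "c = contour_height t n - 1"
    have c: "contour_height t (n + 1) = c" "contour_height t (n + int N) = c + 1"
      using contour_height_Suc[of t n] 1 contour_height_period[of n] by (simp_all add: c_def)
    obtain x where x: "n + 1 \<le> x" "contour_height t x = c" "walk t x \<in> opening_stems t"
      "\<And>y. n + 1 \<le> y \<Longrightarrow> y \<le> x \<Longrightarrow> contour_height t y \<le> c"
      using first_ascent[of "n + 1" "n + int N" t c] N c by auto
    then have "matched t n x" using 1 by (auto simp: matched_def c_def)
    then show ?thesis by blast
  next
    case 2
    define c where "c = contour_height t n"
    \<comment> \<open>The time just after the previous visit to the same opening stem, where the
      height is above \<open>c\<close>; from there it has to descend to \<open>c\<close> by time
      \<open>n\<close>.\<close>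
    have c: "contour_height t (n + 1 - int N) = c + 1"
      using contour_height_Suc[of t n] 2 contour_height_period[of "n + 1 - int N"] by (simp add: c_def)
    obtain x where x: "x < n" "contour_height t x = c + 1" "walk t x \<in> closing_stems t"
      "\<And>y. x < y \<Longrightarrow> y \<le> n \<Longrightarrow> contour_height t y \<le> c"
      using last_descent[of "n + 1 - int N" n c t] N c by (auto simp: c_def)
    then have "matched t x n" using 2 by (auto simp: matched_def c_def)
    then show ?thesis by blast
  qed
qed

text \<open>One period after \<open>n\<close> the height is back at its value at \<open>n\<close>,
  which is above the bound valid inside the pair.\<close>

lemma matched_within_period:
  assumes "matched t n m"
  shows "m < n + int N"
proof (rule ccontr)
  assume "\<not> m < n + int N"
  then show False using matchedD(4)[OF assms] matchedD(5)[OF assms, of "n + int N"] N contour_height_period[of n]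
    by simp
qed

lemma walk_eq_close:
  assumes "walk t n = walk t m" "\<bar>n - m\<bar> < int N"
  shows "n = m"
proof -
  have "int N dvd n - m" using assms(1) by (simp add: walk_eq_iff mod_eq_dvd_iff)
  then show ?thesis using assms(2) zdvd_not_zless[of "\<bar>n - m\<bar>" "int N"] by (cases "n = m") auto
qed

text \<open>A pair is shorter than a period, so translating it to the given positions leaves two
  possibilities: it goes from \<open>a\<close> to \<open>b\<close>, or from \<open>b\<close> around
  the cycle to the next copy of \<open>a\<close>.\<close>

lemma mates_positions:
  assumes "mates t (walk t a) (walk t b)" "a < b" "b < a + int N"
  shows "matched t a b \<or> matched t b (a + int N)"
proof -
  obtain n m where nm: "walk t n = walk t a" "walk t m = walk t b" "matched t n m \<or> matched t m n"
    using assms(1) unfolding mates_def by blast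
  from nm(3) show ?thesis
  proof
    assume "matched t n m"
    then have s: "matched t a (a + (m - n))"
      using matched_shift[OF closable_balanced nm(1), of 0 "m - n"] by simp
    have "walk t (a + (m - n)) = walk t b"
      using walk_shift[OF balanced_root nm(1), of "m - n"] nm(2) by simp
    then have "a + (m - n) = b"
      by (rule walk_eq_close) (use matchedD(1)[OF s] matched_within_period[OF s] assms(2,3) in simp)
    then show ?thesis using s by simp
  next
    assume "matched t m n"
    then have s: "matched t b (b + (n - m))"
      using matched_shift[OF closable_balanced nm(2), of 0 "n - m"] by simp
    have "walk t (b + (n - m)) = walk t (a + int N)"
      using walk_shift[OF balanced_root nm(2), of "n - m"] nm(1) period[of a] by simp
    then have "b + (n - m) = a + int N"
      by (rule walk_eq_close) (use matchedD(1)[OF s] matched_within_period[OF s] assms(2,3) in simp)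
    then show ?thesis using s by simp
  qed
qed

text \<open>Each of the two pairs may or may not go around the cycle. In all four cases suitable
  copies of them cross on the line.\<close>

lemma mates_noncrossing:
  assumes "mates t (walk t a) (walk t b)" "mates t (walk t c) (walk t d)"
    and "0 \<le> a" "a < c" "c < b" "b < d" "d < int N"
  shows False
proof -
  have shift: "matched t (n - int N) (m - int N)" if "matched t n m" for n m
    using matched_shift[OF closable_balanced, of "int N" 0 "n - int N" "m - int N"] that period[of 0] by simp
  have "matched t a b \<or> matched t b (a + int N)" "matched t c d \<or> matched t d (c + int N)"
    using assms by (intro mates_positions; simp)+
  then show False
    using matched_noncrossing[of t a b c d] matched_noncrossing[of t "d - int N" c a b]
      matched_noncrossing[of t c d b "a + int N"] matched_noncrossing[of t b "a + int N" d "c + int N"]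
      shift[of d "c + int N"] assms(3-) by auto
qed

text \<open>Each vertex other than the root contributes the two halves of the edge to its
  parent.\<close>

lemma card_halves_balanced:
  "card (tree_halves t) = 2 * (card (tree_verts t) - 1) + card (stems t)"
proof -
  let ?U = "Up ` (tree_verts t - {[]})"
  let ?L = "tree_halves t - stems t - ?U"
  have fin: "finite (tree_verts t)" using bal by (simp add: balanced_def)
  have U: "?U \<subseteq> tree_halves t - stems t" by auto
  have "bij_betw tree_opp ?U ?L"
  proof (rule bij_betw_byWitness[of _ tree_opp])
    show "\<forall>h\<in>?U. tree_opp (tree_opp h) = h" "\<forall>h\<in>?L. tree_opp (tree_opp h) = h"
      using tree_opp_tree_opp(3) U by blast+
    show "tree_opp ` ?U \<subseteq> ?L" using tree_opp_tree_opp(1,2) U by fastforce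
    show "tree_opp ` ?L \<subseteq> ?U"
    proof
      fix k assume "k \<in> tree_opp ` ?L"
      then obtain h where h: "h \<in> tree_halves t" "h \<notin> stems t" "h \<notin> ?U" "k = tree_opp h" by auto
      then obtain v i where "h = Slot v i" by (cases h) auto
      then show "k \<in> ?U" using tree_opp_tree_opp(1)[OF h(1,2)] h(4) by auto
    qed
  qed
  then have "card ?L = card ?U" by (simp add: bij_betw_same_card)
  moreover have "card ?U = card (tree_verts t) - 1"
    using fin by (simp add: card_image inj_on_def card_Diff_singleton)
  moreover have "card (tree_halves t - stems t) = card ?U + card ?L"
    using U finite_halves by (metis Diff_partition Diff_disjoint card_Un_disjoint finite_Diff finite_subset)
  moreover have "card (tree_halves t) = card (tree_halves t - stems t) + card (stems t)"
    using stems_subset[of t] finite_halves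
    by (metis Diff_partition Diff_disjoint add.commute card_Un_disjoint finite_Diff finite_subset)
  ultimately show ?thesis by simp
qed

text \<open>The face permutation factors as the contour step, a single cycle, after the involution
  that exchanges mates. This is the situation of \<open>card_orbits_noncrossing\<close>, with one
  pair in \<open>M\<close> for each merged edge.\<close>

lemma card_faces_balanced: "2 * card (faces (glued_map t)) = card (stems t) + 2"
proof -
  note cl = closable_balanced
  let ?H = "tree_halves t"
  define e where "e i = walk t (int i)" for i :: nat
  \<comment> \<open>The identity outside the half-edges, as \<open>permutes\<close> demands.\<close>
  define f where "f h = (if h \<in> ?H then contour_step t h else h)" for h
  define s where "s h = (if h \<in> stems t then stem_mate t h else h)" for h
  define M where "M = {(a, b). a < b \<and> b < N \<and> mates t (e a) (e b)}"
  have e_bij: "bij_betw e {..<N} ?H"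
  proof -
    have "int ` {..<N} = {0..<int N}" by (auto simp: image_iff intro!: bexI[of _ "nat _"])
    then have "bij_betw int {..<N} {0..<int N}" by (simp add: bij_betw_def)
    moreover have "bij_betw (walk t) {0..<int N} ?H" using inj range by (simp add: bij_betw_def)
    ultimately have "bij_betw (walk t \<circ> int) {..<N} ?H" by (rule bij_betw_trans)
    moreover have "walk t \<circ> int = e" by (simp add: e_def fun_eq_iff)
    ultimately show ?thesis by simp
  qed
  then have e_inj: "e a = e b \<longleftrightarrow> a = b" if "a < N" "b < N" for a b
    using that by (auto simp: bij_betw_def inj_on_eq_iff)
  have e_in: "e i \<in> ?H" for i unfolding e_def by (rule walk_in[OF balanced_root])
  have e_surj: "\<exists>i<N. e i = h" if "h \<in> ?H" for h
    using e_bij that unfolding bij_betw_def by (metis imageE lessThan_iff)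
  have f_perm: "f permutes ?H"
  proof (rule bij_imp_permutes)
    have "inj_on f ?H" using inj_on_contour_step[of t] by (auto simp: inj_on_def f_def)
    moreover have "f ` ?H \<subseteq> ?H" using contour_step_in by (auto simp: f_def)
    ultimately show "bij_betw f ?H ?H" using endo_inj_surj[OF finite_halves] by (simp add: bij_betw_def)
  qed (simp add: f_def)
  have s_in: "s h \<in> ?H" if "h \<in> ?H" for h
    using that stem_mate(1)[OF cl] stems_subset by (auto simp: s_def)
  have s_perm: "s permutes ?H"
  proof (rule bij_imp_permutes)
    have "s (s h) = h" for h using stem_mate(1,2)[OF cl] by (auto simp: s_def)
    then show "bij_betw s ?H ?H" using s_in by (intro bij_betw_byWitness[of _ s]) auto
  qed (use stems_subset in \<open>auto simp: s_def\<close>)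
  have M_sub: "M \<subseteq> {..<N} \<times> {..<N}" by (auto simp: M_def)
  then have M_fin: "finite M" by (rule finite_subset) simp
  have M_D: "a < b \<and> b < N \<and> s (e a) = e b \<and> s (e b) = e a" if "(a, b) \<in> M" for a b
    using that stem_mate_eq[OF cl] mates_sym mates_stems(1,2) by (auto simp: M_def s_def)
  have M_mate: "(a, b) \<in> M \<or> (b, a) \<in> M" if "a < N" "b < N" "e b = s (e a)" "e a \<in> stems t" for a b
  proof -
    have m: "mates t (e a) (e b)" using mates_stem_mate[OF cl] that by (simp add: s_def)
    then have "a \<noteq> b" using mates_stems(4) by blast
    then show ?thesis using m mates_sym[OF m] that by (auto simp: M_def)
  qed
  have M_dis: "{a, b} \<inter> {c, d} = {}" if "(a, b) \<in> M" "(c, d) \<in> M" "(a, b) \<noteq> (c, d)" for a b c d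
  proof -
    note A = M_D[OF that(1)] and C = M_D[OF that(2)]
    have "a = c \<longleftrightarrow> b = d" "a \<noteq> d" "b \<noteq> c"
      using A C e_inj[of b d] e_inj[of a c] e_inj[of b c] e_inj[of a d] by auto
    then show ?thesis using that(3) by auto
  qed
  have M_nc: "d \<le> b" if "(a, b) \<in> M" "(c, d) \<in> M" "a < c" "c < b" for a b c d
    using mates_noncrossing[of "int a" "int b" "int c" "int d"] that by (force simp: M_def e_def)
  have M_other: "s (e i) = e i" if "i < N" "i \<notin> fst ` M \<union> snd ` M" for i
  proof (cases "e i \<in> stems t")
    case True
    obtain j where "j < N" "e j = s (e i)" using e_surj[OF s_in[OF e_in[of i]]] by auto
    then have "(i, j) \<in> M \<or> (j, i) \<in> M" using M_mate[of i j] that True by simp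
    then show ?thesis using that(2) by force
  qed (simp add: s_def)
  have "card (orbit (f \<circ> s) ` ?H) = Suc (card M)"
  proof (rule card_orbits_noncrossing[OF e_bij N _ _ f_perm s_perm M_fin M_D M_dis M_nc M_other])
    show "e N = e 0" using period[of 0] by (simp add: e_def)
    show "f (e i) = e (Suc i)" for i
      using walk_Suc[OF balanced_root, of "int i"] walk_in[OF balanced_root]
      by (simp add: e_def f_def add.commute)
  qed
  moreover have "faces (glued_map t) = orbit (f \<circ> s) ` ?H"
  proof -
    \<comment> \<open>At a tree edge \<open>s\<close> does nothing and the contour step crosses the
      edge; at a stem \<open>s\<close> jumps to the mate and the contour step only turns.\<close>
    have rot_opp: "(f \<circ> s) h = (rot (glued_map t) \<circ> opp (glued_map t)) h" if h: "h \<in> ?H" for h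
      using s_in[OF h] h stem_mate(1)[OF cl, of h]
      by (auto simp: f_def s_def contour_step_def edge_opp_def)
    have "orbit (f \<circ> s) h = orbit (rot (glued_map t) \<circ> opp (glued_map t)) h" if "h \<in> ?H" for h
    proof (rule orbit_cong0[OF that _ rot_opp])
      show "f \<circ> s \<in> ?H \<rightarrow> ?H" using s_in permutes_in_image[OF f_perm] by simp
    qed
    then show ?thesis by (simp add: faces_def)
  qed
  moreover have "card (stems t) = 2 * card M"
  proof -
    have "stems t = e ` (fst ` M \<union> snd ` M)"
    proof
      show "stems t \<subseteq> e ` (fst ` M \<union> snd ` M)"
      proof
        fix h assume h: "h \<in> stems t"
        then obtain i where i: "i < N" "e i = h" using e_surj stems_subset by blast
        have "s (e i) \<noteq> e i" using stem_mate(3)[OF cl h] i h by (simp add: s_def)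
        then have "i \<in> fst ` M \<union> snd ` M" using M_other i(1) by blast
        then show "h \<in> e ` (fst ` M \<union> snd ` M)" using i by blast
      qed
      show "e ` (fst ` M \<union> snd ` M) \<subseteq> stems t" using mates_stems(1,2) by (force simp: M_def)
    qed
    moreover have "inj_on e (fst ` M \<union> snd ` M)"
      using M_D e_inj by (intro inj_onI) (fastforce dest: M_D)
    moreover have "card (fst ` M \<union> snd ` M) = card (fst ` M) + card (snd ` M)"
    proof (rule card_Un_disjoint)
      show "fst ` M \<inter> snd ` M = {}"
      proof -
        have "a \<noteq> d" if "(a, b) \<in> M" "(c, d) \<in> M" for a b c d
          using M_dis[OF that] M_D[OF that(1)] by auto
        then show ?thesis by force
      qed
    qed (use M_fin in auto)
    moreover have "card (fst ` M) = card M"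
      by (rule card_image) (use M_dis in \<open>force intro!: inj_onI\<close>)
    moreover have "card (snd ` M) = card M"
      by (rule card_image) (use M_dis in \<open>force intro!: inj_onI\<close>)
    ultimately show ?thesis by (simp add: card_image)
  qed
  ultimately show ?thesis by simp
qed

text \<open>With \<open>V\<close> vertices and \<open>k\<close> merged pairs there are
  \<open>V - 1 + k\<close> edges and \<open>k + 1\<close> faces.\<close>

lemma planar_balanced: "planar_map (glued_map t)"
proof -
  \<comment> \<open>Makes the subtraction in \<open>card (tree_verts t) - 1\<close> exact.\<close>
  have "0 < card (tree_verts t)" using bal root_in_tree_verts[of t]
    unfolding balanced_def card_gt_0_iff by blast
  then show ?thesis
    using card_faces_balanced card_halves_balanced by (simp add: planar_map_def)
qed

end

end

section \<open>Passage to the limit from finite trees\<close>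

lemma balanced_glued_map:
  assumes "balanced t"
  shows "closable t" "planar_map (glued_map t)"
proof -
  obtain N where "0 < N" "\<And>n. walk t (n + int N) = walk t n" "inj_on (walk t) {0..<int N}"
    "walk t ` {0..<int N} = tree_halves t"
    using walk_period[OF assms] by blast
  note N = this
  show "closable t" by (rule closable_balanced[OF assms N])
  show "planar_map (glued_map t)" by (rule planar_balanced[OF assms N])
qed

lemma regular_tree_root:
  assumes "regular_tree d t" "0 < d"
  shows "slots t \<noteq> []"
proof
  assume "slots t = []"
  then have "{h \<in> tree_halves t. half_vertex h = []} = {}" by (auto simp: tree_halves_def slots_at_def)
  then show False using assms root_in_tree_verts unfolding regular_tree_def by (metis card.empty less_irrefl)
qed

lemma balanced_finite_trees:
  assumes "t \<in> finite_trees d" "0 < d"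
  shows "balanced t" "regular_tree d t"
proof -
  have t: "finite (tree_verts t)" "regular_tree d t" "charge t [] = 0"
    using assms(1) by (auto simp: finite_trees_def finite_trees_of_size_def)
  then show "regular_tree d t" by simp
  show "balanced t" using t regular_tree_root[OF t(2) assms(2)] by (simp add: balanced_def charge_def)
qed

lemma glued_map_in_finite_maps:
  assumes "t \<in> finite_trees d" "0 < d"
  shows "abs_rmap (glued_map t) \<in> finite_maps d"
proof -
  note b = balanced_finite_trees[OF assms] and g = balanced_glued_map[OF balanced_finite_trees(1)[OF assms]]
  have "finite (tree_verts t)" using b(1) by (simp add: balanced_def)
  then show ?thesis
    unfolding finite_maps_def
    using rooted_map_glued_map[OF g(1)] g(2) proper_coloring_glued_map[OF g(1)] regular_glued_map[OF g(1) b(2)]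
    by (intro CollectI exI[of _ "glued_map t"]) simp
qed

lemma tendsto_glued_map:
  assumes "closable t"
  shows "((\<lambda>t'. abs_rmap (glued_map t')) \<longlongrightarrow> abs_rmap (glued_map t)) (at t within {t'. closable t'})"
proof (rule tendsto_rmap)
  fix R
  show "\<forall>\<^sub>F t' in at t within {t'. closable t'}.
      map_ball R (abs_rmap (glued_map t')) = map_ball R (abs_rmap (glued_map t))"
    using eventually_map_ball_glued_map[OF assms, of R]
    by (auto simp: eventually_at_filter elim: eventually_mono)
qed

theorem theorem11:
  fixes d :: nat and P :: "btree measure"
  assumes "3 \<le> d" and "is_limit_law d P"
  shows "tree_closure \<in> limit_support d P \<rightarrow> maps_completion d \<and>
         continuous_on (limit_support d P) tree_closure"
proof -
  have d: "0 < d" using assms(1) by simp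
  have space: "space P = trees_completion d"
    using assms(2) sets_eq_imp_space_eq[of P "restrict_space borel (trees_completion d)"]
    by (simp add: is_limit_law_def space_restrict_space)
  let ?S = "limit_support d P"
  have S: "closable t \<and> tree_closure t = abs_rmap (glued_map t) \<and> t \<in> closure (finite_trees d)"
    if "t \<in> ?S" for t
    using that closable_single_spine[OF regular_tree_root[OF _ d], of t] space
    by (auto simp: limit_support_def topological_support_def tree_closure_def trees_completion_def)
  have fin: "finite_trees d \<subseteq> {t. closable t}" using balanced_glued_map(1) balanced_finite_trees(1) d by blast
  have "continuous_on {t. closable t} (\<lambda>t. abs_rmap (glued_map t))"
    using tendsto_glued_map by (simp add: continuous_on_def)
  \<comment> \<open>The approximating finite trees and the limit trees are put into one domain, so
    that membership in a closed set passes to the limit.\<close>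
  then have cont: "continuous_on (finite_trees d \<union> ?S) (\<lambda>t. abs_rmap (glued_map t))"
    by (rule continuous_on_subset) (use fin S in auto)
  have "continuous_on ?S tree_closure"
    using continuous_on_subset[OF cont, of ?S] S by (simp cong: continuous_on_cong)
  moreover have "tree_closure t \<in> maps_completion d" if t: "t \<in> ?S" for t
  proof -
    have "t \<in> closure (finite_trees d)" "t \<in> finite_trees d \<union> ?S" using S t by auto
    \<comment> \<open>The preimage of a closed set is closed relative to the union, hence the trace
      of a closed set \<open>C\<close> of trees. As \<open>C\<close> contains the finite trees, it
      contains their closure.\<close>
    moreover obtain C where C: "closed C" "(finite_trees d \<union> ?S) \<inter>
        (\<lambda>t. abs_rmap (glued_map t)) -` maps_completion d = (finite_trees d \<union> ?S) \<inter> C"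
      using continuous_closedin_preimage[OF cont, of "maps_completion d"]
      by (auto simp: maps_completion_def closedin_closed)
    moreover have "finite_trees d \<subseteq> C"
      using glued_map_in_finite_maps[OF _ d] closure_subset C(2) unfolding maps_completion_def by blast
    then have "closure (finite_trees d) \<subseteq> C" using C(1) by (rule closure_minimal)
    ultimately have "abs_rmap (glued_map t) \<in> maps_completion d" by blast
    then show ?thesis using S t by simp
  qed
  ultimately show ?thesis by blast
qed

end
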